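(* Let $\mathbf{C}, \mathbf{D}, \mathbf{E}$ be three categories and let $F:\mathbf{D}\to\mathbf{C}$, $G:\mathbf{E}\to\mathbf{C}$ and $A:\mathbf{E}\to\mathbf{D}$ be three functors with $FA=G$. Let $J$ be a Grothendieck topology on $\mathbf{C}$ and let $J_{\mathbf{D}}$ be the induced topology on $\mathbf{D}$ (via $F$). Then: (1) If $F$ is a stack over $(\mathbf{C},J)$ and $A$ is a stack over $(\mathbf{D},J_{\mathbf{D}})$, then $G$ is a stack over $(\mathbf{C},J)$. (2) If $G$ is a stack over $(\mathbf{C},J)$ and $F$ is a prestack over $(\mathbf{C},J)$, then there is a stack $G':\mathbf{E}'\to\mathbf{C}$ over $(\mathbf{C},J)$, an equivalence $I:G\to G'$ of stacks over $(\mathbf{C},J)$, and a map $P:G'\to F$ of fibered categories over $\mathbf{C}$ with $PI=A$, such that the underlying functor $P:\mathbf{E}'\to\mathbf{D}$ is a stack over $(\mathbf{D},J_{\mathbf{D}})$. (3) If $G$ is a stack over $(\mathbf{C},J)$ and $F$ is a sheaf (i.e. a discretely fibered stack) over $(\mathbf{C},J)$, then $A$ itself is a stack over $(\mathbf{D},J_{\mathbf{D}})$.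
   Context: A site $(\mathbf{C},J)$ is a small category with a Grothendieck topology, described by covering families. A "fibered category over $\mathbf{C}$" always means a category fibered in groupoids: a functor $F:\mathbf{D}\to\mathbf{C}$ such that (i) for every arrow $f:C'\to C$ in $\mathbf{C}$ and every $D$ with $F(D)=C$ there is an arrow $g:D'\to D$ with $F(g)=f$; (ii) given $a:D''\to D$ and $b:D'\to D$ in $\mathbf{D}$ and $f:F(D'')\to F(D')$ with $F(b)f=F(a)$, there is a unique $g:D''\to D'$ with $bg=a$ and $F(g)=f$. The fiber $F_C$ is the groupoid of objects over $C$ and arrows over $1_C$. $F$ is discretely fibered if all fibers are sets (only identity arrows). For $f:C'\to C$ and $D\in F_C$, $f^*D$ (or $D|_{C'}$) denotes the source of a chosen lift of $f$ with target $D$. $F$ is a prestack if for every $C$ and $D_1,D_2\in F_C$ the presheaf on $\mathbf{C}/C$ sending $f:C'\to C$ to $\mathrm{Iso}_{F_{C'}}(f^*D_1,f^*D_2)$ is a sheaf. A prestack $F$ is a stack if every descent datum is effective: for each covering family $\{C_i\to C\}$, objects $D_i\in F_{C_i}$ and isomorphisms $\phi_{ji}:D_i|_{C_{ij}}\to D_j|_{C_{ij}}$ in $F_{C_{ij}}$ (where $C_{ij}=C_i\times_C C_j$) with $\phi_{ii}=1$ satisfying the cocycle condition $\phi_{ij}\circ\phi_{jk}=\phi_{ik}$ on triple fiber products, there are $D\in F_C$ and isomorphisms $\psi_i:D|_{C_i}\to D_i$ with $\psi_j|_{C_{ij}}=\phi_{ji}\circ\psi_i|_{C_{ij}}$. A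 map of fibered categories (in particular of prestacks or stacks) from $F':\mathbf{D}'\to\mathbf{C}$ to $F:\mathbf{D}\to\mathbf{C}$ is a functor $a:\mathbf{D}'\to\mathbf{D}$ with $Fa=F'$; a 2-isomorphism of maps is a natural isomorphism of functors over $\mathbf{C}$. An equivalence is a map having a quasi-inverse map up to 2-isomorphism. Induced topology: a family $\{f_i:D_i\to D\}$ in $\mathbf{D}$ is a covering family for $J_{\mathbf{D}}$ if and only if $\{F(f_i)\}$ is a covering family for $J$. *)

theory Defs
  imports Main
begin

section \<open>Categories and functors\<close>

record ('o, 'm) cat =
  Obj :: "'o set"
  Arr :: "'m set"
  Dom :: "'m \<Rightarrow> 'o"
  Cod :: "'m \<Rightarrow> 'o"
  Ident :: "'o \<Rightarrow> 'm"
  Comp :: "'m \<Rightarrow> 'm \<Rightarrow> 'm"  (infixl "\<cdot>\<index>" 70)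

definition hom :: "('o, 'm) cat \<Rightarrow> 'o \<Rightarrow> 'o \<Rightarrow> 'm set" where
  "hom C X Y = {f \<in> Arr C. Dom C f = X \<and> Cod C f = Y}"

locale category =
  fixes C :: "('o, 'm) cat" (structure)
  assumes Dom_in: "f \<in> Arr C \<Longrightarrow> Dom C f \<in> Obj C"
    and Cod_in: "f \<in> Arr C \<Longrightarrow> Cod C f \<in> Obj C"
    and Ident_in: "X \<in> Obj C \<Longrightarrow> Ident C X \<in> hom C X X"
    and Comp_in: "\<lbrakk>f \<in> hom C X Y; g \<in> hom C Y Z\<rbrakk> \<Longrightarrow> g \<cdot> f \<in> hom C X Z"
    and Comp_Ident: "f \<in> hom C X Y \<Longrightarrow> f \<cdot> Ident C X = f"
    and Ident_Comp: "f \<in> hom C X Y \<Longrightarrow> Ident C Y \<cdot> f = f"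
    and Comp_assoc: "\<lbrakk>f \<in> hom C W X; g \<in> hom C X Y; h \<in> hom C Y Z\<rbrakk>
      \<Longrightarrow> h \<cdot> g \<cdot> f = h \<cdot> (g \<cdot> f)"

definition isos :: "('o, 'm) cat \<Rightarrow> 'o \<Rightarrow> 'o \<Rightarrow> 'm set" where
  "isos C X Y = {f \<in> hom C X Y.
     \<exists>g \<in> hom C Y X. g \<cdot>\<^bsub>C\<^esub> f = Ident C X \<and> f \<cdot>\<^bsub>C\<^esub> g = Ident C Y}"

definition is_pullback :: "('o, 'm) cat \<Rightarrow> 'm \<Rightarrow> 'm \<Rightarrow> 'm \<Rightarrow> 'm \<Rightarrow> bool" where
  "is_pullback C f g p q \<longleftrightarrow>
     f \<in> Arr C \<and> g \<in> Arr C \<and> Cod C f = Cod C g \<and>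
     p \<in> hom C (Dom C p) (Dom C f) \<and> q \<in> hom C (Dom C p) (Dom C g) \<and>
     f \<cdot>\<^bsub>C\<^esub> p = g \<cdot>\<^bsub>C\<^esub> q \<and>
     (\<forall>T. \<forall>s \<in> hom C T (Dom C f). \<forall>t \<in> hom C T (Dom C g).
        f \<cdot>\<^bsub>C\<^esub> s = g \<cdot>\<^bsub>C\<^esub> t \<longrightarrow>
        (\<exists>!m. m \<in> hom C T (Dom C p) \<and> p \<cdot>\<^bsub>C\<^esub> m = s \<and> q \<cdot>\<^bsub>C\<^esub> m = t))"

text \<open>
  Chosen fiber products. The results of \<open>fprod\<close>, \<open>pr1\<close>, \<open>pr2\<close> and \<open>fpair\<close> are
  meaningful only if a fiber product of the two arrows exists.
\<close>

definition fprod :: "('o, 'm) cat \<Rightarrow> 'm \<Rightarrow> 'm \<Rightarrow> 'm \<times> 'm" where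
  "fprod C f g = (SOME pq. is_pullback C f g (fst pq) (snd pq))"

definition pr1 :: "('o, 'm) cat \<Rightarrow> 'm \<Rightarrow> 'm \<Rightarrow> 'm" where
  "pr1 C f g = fst (fprod C f g)"

definition pr2 :: "('o, 'm) cat \<Rightarrow> 'm \<Rightarrow> 'm \<Rightarrow> 'm" where
  "pr2 C f g = snd (fprod C f g)"

definition fpair :: "('o, 'm) cat \<Rightarrow> 'm \<Rightarrow> 'm \<Rightarrow> 'm \<Rightarrow> 'm \<Rightarrow> 'm" where
  "fpair C f g s t = (THE m. m \<in> hom C (Dom C s) (Dom C (pr1 C f g)) \<and>
     pr1 C f g \<cdot>\<^bsub>C\<^esub> m = s \<and> pr2 C f g \<cdot>\<^bsub>C\<^esub> m = t)"

text \<open>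
  Functors are pairs of total functions, whose values outside the source category carry no
  meaning; equality of functors is therefore \<open>functor_eq\<close>.
\<close>

record ('o, 'm, 'p, 'n) fctr =
  OMap :: "'o \<Rightarrow> 'p"
  AMap :: "'m \<Rightarrow> 'n"

definition is_functor ::
  "('o, 'm) cat \<Rightarrow> ('p, 'n) cat \<Rightarrow> ('o, 'm, 'p, 'n) fctr \<Rightarrow> bool" where
  "is_functor C D F \<longleftrightarrow> category C \<and> category D \<and>
     (\<forall>X \<in> Obj C. OMap F X \<in> Obj D) \<and>
     (\<forall>f \<in> Arr C. AMap F f \<in> hom D (OMap F (Dom C f)) (OMap F (Cod C f))) \<and>
     (\<forall>X \<in> Obj C. AMap F (Ident C X) = Ident D (OMap F X)) \<and>
     (\<forall>f \<in> Arr C. \<forall>g \<in> Arr C. Dom C g = Cod C f \<longrightarrow>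
        AMap F (g \<cdot>\<^bsub>C\<^esub> f) = AMap F g \<cdot>\<^bsub>D\<^esub> AMap F f)"

definition functor_eq ::
  "('o, 'm) cat \<Rightarrow> ('o, 'm, 'p, 'n) fctr \<Rightarrow> ('o, 'm, 'p, 'n) fctr \<Rightarrow> bool" where
  "functor_eq C F G \<longleftrightarrow>
     (\<forall>X \<in> Obj C. OMap F X = OMap G X) \<and> (\<forall>f \<in> Arr C. AMap F f = AMap G f)"

definition id_functor :: "('o, 'm, 'o, 'm) fctr" where
  "id_functor = \<lparr>OMap = \<lambda>X. X, AMap = \<lambda>f. f\<rparr>"

definition comp_functor ::
  "('p, 'n, 'q, 'k) fctr \<Rightarrow> ('o, 'm, 'p, 'n) fctr \<Rightarrow> ('o, 'm, 'q, 'k) fctr"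
  (infixl "\<odot>" 70) where
  "G \<odot> F = \<lparr>OMap = OMap G \<circ> OMap F, AMap = AMap G \<circ> AMap F\<rparr>"


section \<open>Sites and sheaves\<close>

text \<open>
  A covering family of \<open>X\<close> is a set of arrows with target \<open>X\<close>; \<open>J X\<close> is the collection of
  covering families of \<open>X\<close>. The fiber products of covering arrows along arbitrary arrows exist,
  and every choice of them for the members of a covering family gives a covering family.
\<close>

definition grothendieck_topology :: "('o, 'm) cat \<Rightarrow> ('o \<Rightarrow> 'm set set) \<Rightarrow> bool" where
  "grothendieck_topology C J \<longleftrightarrow>
     (\<forall>X \<in> Obj C. \<forall>R \<in> J X. R \<subseteq> {f \<in> Arr C. Cod C f = X}) \<and>
     (\<forall>X \<in> Obj C. \<forall>Y \<in> Obj C. \<forall>f \<in> isos C Y X. {f} \<in> J X) \<and>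
     (\<forall>X \<in> Obj C. \<forall>R \<in> J X. \<forall>g \<in> Arr C. Cod C g = X \<longrightarrow>
        (\<forall>f \<in> R. \<exists>p q. is_pullback C g f p q) \<and>
        (\<forall>p. (\<forall>f \<in> R. \<exists>q. is_pullback C g f (p f) q) \<longrightarrow> p ` R \<in> J (Dom C g))) \<and>
     (\<forall>X \<in> Obj C. \<forall>R \<in> J X. \<forall>S. (\<forall>f \<in> R. S f \<in> J (Dom C f)) \<longrightarrow>
        {f \<cdot>\<^bsub>C\<^esub> g | f g. f \<in> R \<and> g \<in> S f} \<in> J X)"

definition induced_topology ::
  "('p, 'n) cat \<Rightarrow> ('p, 'n, 'o, 'm) fctr \<Rightarrow> ('o \<Rightarrow> 'm set set) \<Rightarrow> 'p \<Rightarrow> 'n set set" where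
  "induced_topology D F J X =
     {R. R \<subseteq> {f \<in> Arr D. Cod D f = X} \<and> AMap F ` R \<in> J (OMap F X)}"

text \<open>An arrow \<open>f' \<rightarrow> f\<close> of the slice category is a triple \<open>(f', h, f)\<close> with \<open>f' = f \<cdot> h\<close>.\<close>

definition slice :: "('o, 'm) cat \<Rightarrow> 'o \<Rightarrow> ('m, 'm \<times> 'm \<times> 'm) cat" where
  "slice C X = \<lparr>
     Obj = {f \<in> Arr C. Cod C f = X},
     Arr = {(f \<cdot>\<^bsub>C\<^esub> h, h, f) | f h.
              f \<in> Arr C \<and> Cod C f = X \<and> h \<in> Arr C \<and> Cod C h = Dom C f},
     Dom = \<lambda>(f', h, f). f',
     Cod = \<lambda>(f', h, f). f,
     Ident = \<lambda>f. (f, Ident C (Dom C f), f),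
     Comp = \<lambda>(_, h, f) (f'', k, _). (f'', h \<cdot>\<^bsub>C\<^esub> k, f)\<rparr>"

definition slice_forget :: "('o, 'm) cat \<Rightarrow> ('m, 'm \<times> 'm \<times> 'm, 'o, 'm) fctr" where
  "slice_forget C = \<lparr>OMap = Dom C, AMap = \<lambda>(f', h, f). h\<rparr>"

record ('o, 'm, 'x) presheaf =
  Sec :: "'o \<Rightarrow> 'x set"
  Res :: "'m \<Rightarrow> 'x \<Rightarrow> 'x"

definition is_presheaf :: "('o, 'm) cat \<Rightarrow> ('o, 'm, 'x) presheaf \<Rightarrow> bool" where
  "is_presheaf C S \<longleftrightarrow> category C \<and>
     (\<forall>f \<in> Arr C. \<forall>x \<in> Sec S (Cod C f). Res S f x \<in> Sec S (Dom C f)) \<and>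
     (\<forall>X \<in> Obj C. \<forall>x \<in> Sec S X. Res S (Ident C X) x = x) \<and>
     (\<forall>f \<in> Arr C. \<forall>g \<in> Arr C. Dom C g = Cod C f \<longrightarrow>
        (\<forall>x \<in> Sec S (Cod C g). Res S (g \<cdot>\<^bsub>C\<^esub> f) x = Res S f (Res S g x)))"

definition is_sheaf ::
  "('o, 'm) cat \<Rightarrow> ('o \<Rightarrow> 'm set set) \<Rightarrow> ('o, 'm, 'x) presheaf \<Rightarrow> bool" where
  "is_sheaf C J S \<longleftrightarrow> is_presheaf C S \<and>
     (\<forall>X \<in> Obj C. \<forall>R \<in> J X. \<forall>x.
        (\<forall>f \<in> R. x f \<in> Sec S (Dom C f)) \<and>
        (\<forall>f \<in> R. \<forall>g \<in> R. \<forall>T. \<forall>s \<in> hom C T (Dom C f). \<forall>t \<in> hom C T (Dom C g).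
           f \<cdot>\<^bsub>C\<^esub> s = g \<cdot>\<^bsub>C\<^esub> t \<longrightarrow> Res S s (x f) = Res S t (x g)) \<longrightarrow>
        (\<exists>!y. y \<in> Sec S X \<and> (\<forall>f \<in> R. Res S f y = x f)))"


section \<open>Categories fibered in groupoids\<close>

text \<open>Here and below \<open>F\<close> is a functor from \<open>D\<close> to \<open>C\<close>.\<close>

definition fibered ::
  "('p, 'n) cat \<Rightarrow> ('o, 'm) cat \<Rightarrow> ('p, 'n, 'o, 'm) fctr \<Rightarrow> bool" where
  "fibered D C F \<longleftrightarrow> is_functor D C F \<and>
     (\<forall>f \<in> Arr C. \<forall>Y \<in> Obj D. OMap F Y = Cod C f \<longrightarrow>
        (\<exists>g \<in> Arr D. Cod D g = Y \<and> AMap F g = f)) \<and>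
     (\<forall>a \<in> Arr D. \<forall>b \<in> Arr D. Cod D a = Cod D b \<longrightarrow>
        (\<forall>f \<in> hom C (OMap F (Dom D a)) (OMap F (Dom D b)).
           AMap F b \<cdot>\<^bsub>C\<^esub> f = AMap F a \<longrightarrow>
           (\<exists>!g. g \<in> hom D (Dom D a) (Dom D b) \<and> b \<cdot>\<^bsub>D\<^esub> g = a \<and> AMap F g = f)))"

definition fiber ::
  "('p, 'n) cat \<Rightarrow> ('o, 'm) cat \<Rightarrow> ('p, 'n, 'o, 'm) fctr \<Rightarrow> 'o \<Rightarrow> ('p, 'n) cat" where
  "fiber D C F X = D\<lparr>
     Obj := {Y \<in> Obj D. OMap F Y = X},
     Arr := {u \<in> Arr D. OMap F (Dom D u) = X \<and> OMap F (Cod D u) = X \<and>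
               AMap F u = Ident C X}\<rparr>"

definition discretely_fibered ::
  "('p, 'n) cat \<Rightarrow> ('o, 'm) cat \<Rightarrow> ('p, 'n, 'o, 'm) fctr \<Rightarrow> bool" where
  "discretely_fibered D C F \<longleftrightarrow> fibered D C F \<and>
     (\<forall>X \<in> Obj C. \<forall>u \<in> Arr (fiber D C F X). \<exists>Y \<in> Obj (fiber D C F X). u = Ident D Y)"

text \<open>
  \<open>lift D F f Y\<close> is the chosen lift of \<open>f\<close> with target \<open>Y\<close>, \<open>pb D F f Y\<close> is its source
  (the restriction of \<open>Y\<close> along \<open>f\<close>), and \<open>cart_fact D F b f a\<close> is the unique arrow \<open>g\<close>
  over \<open>f\<close> with \<open>b \<cdot> g = a\<close>.
\<close>

definition lift :: "('p, 'n) cat \<Rightarrow> ('p, 'n, 'o, 'm) fctr \<Rightarrow> 'm \<Rightarrow> 'p \<Rightarrow> 'n" where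
  "lift D F f Y = (SOME g. g \<in> Arr D \<and> Cod D g = Y \<and> AMap F g = f)"

definition pb :: "('p, 'n) cat \<Rightarrow> ('p, 'n, 'o, 'm) fctr \<Rightarrow> 'm \<Rightarrow> 'p \<Rightarrow> 'p" where
  "pb D F f Y = Dom D (lift D F f Y)"

definition cart_fact :: "('p, 'n) cat \<Rightarrow> ('p, 'n, 'o, 'm) fctr \<Rightarrow> 'n \<Rightarrow> 'm \<Rightarrow> 'n \<Rightarrow> 'n" where
  "cart_fact D F b f a =
     (THE g. g \<in> hom D (Dom D a) (Dom D b) \<and> b \<cdot>\<^bsub>D\<^esub> g = a \<and> AMap F g = f)"

text \<open>The comparison arrow from the restriction of \<open>Y\<close> along \<open>p \<cdot> h\<close> to that along \<open>p\<close>, over \<open>h\<close>.\<close>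

definition canon ::
  "('p, 'n) cat \<Rightarrow> ('o, 'm) cat \<Rightarrow> ('p, 'n, 'o, 'm) fctr \<Rightarrow> 'm \<Rightarrow> 'm \<Rightarrow> 'p \<Rightarrow> 'n" where
  "canon D C F p h Y = cart_fact D F (lift D F p Y) h (lift D F (p \<cdot>\<^bsub>C\<^esub> h) Y)"

text \<open>
  For \<open>a : X' \<rightarrow> X\<close> and \<open>b : Y' \<rightarrow> Y\<close> over the same arrow \<open>h\<close>, and \<open>u : X \<rightarrow> Y\<close> in a fiber,
  \<open>base_change D C F a b u\<close> is the restriction of \<open>u\<close> along \<open>h\<close>, as an arrow \<open>X' \<rightarrow> Y'\<close>:
  the arrow \<open>v\<close> over an identity with \<open>b \<cdot> v = u \<cdot> a\<close>.
\<close>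

definition base_change ::
  "('p, 'n) cat \<Rightarrow> ('o, 'm) cat \<Rightarrow> ('p, 'n, 'o, 'm) fctr \<Rightarrow> 'n \<Rightarrow> 'n \<Rightarrow> 'n \<Rightarrow> 'n" where
  "base_change D C F a b u = cart_fact D F b (Ident C (OMap F (Dom D a))) (u \<cdot>\<^bsub>D\<^esub> a)"

definition iso_presheaf ::
  "('p, 'n) cat \<Rightarrow> ('o, 'm) cat \<Rightarrow> ('p, 'n, 'o, 'm) fctr \<Rightarrow> 'p \<Rightarrow> 'p
   \<Rightarrow> ('m, 'm \<times> 'm \<times> 'm, 'n) presheaf" where
  "iso_presheaf D C F Y1 Y2 = \<lparr>
     Sec = \<lambda>f. isos (fiber D C F (Dom C f)) (pb D F f Y1) (pb D F f Y2),
     Res = \<lambda>(f', h, f). base_change D C F (canon D C F f h Y1) (canon D C F f h Y2)\<rparr>"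


section \<open>Prestacks and stacks\<close>

definition prestack ::
  "('p, 'n) cat \<Rightarrow> ('o, 'm) cat \<Rightarrow> ('o \<Rightarrow> 'm set set) \<Rightarrow> ('p, 'n, 'o, 'm) fctr \<Rightarrow> bool" where
  "prestack D C J F \<longleftrightarrow> fibered D C F \<and>
     (\<forall>X \<in> Obj C. \<forall>Y1 \<in> Obj (fiber D C F X). \<forall>Y2 \<in> Obj (fiber D C F X).
        is_sheaf (slice C X) (induced_topology (slice C X) (slice_forget C) J)
          (iso_presheaf D C F Y1 Y2))"

text \<open>
  The index set of a covering family \<open>R\<close> is \<open>R\<close> itself. In a descent datum \<open>(Y, \<phi>)\<close>, the arrow
  \<open>\<phi> g f\<close> goes from the restriction of \<open>Y f\<close> to the restriction of \<open>Y g\<close> over the fiber product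
  of \<open>f\<close> and \<open>g\<close> (in this order). For \<open>f \<cdot> s = g \<cdot> t\<close>, \<open>restr_datum D C F Y \<phi> g f s t\<close> is the
  restriction of \<open>\<phi> g f\<close> along the arrow \<open>(s, t)\<close> into this fiber product, as an arrow from the
  restriction of \<open>Y f\<close> along \<open>s\<close> to that of \<open>Y g\<close> along \<open>t\<close>.
\<close>

definition restr_datum ::
  "('p, 'n) cat \<Rightarrow> ('o, 'm) cat \<Rightarrow> ('p, 'n, 'o, 'm) fctr \<Rightarrow> ('m \<Rightarrow> 'p) \<Rightarrow> ('m \<Rightarrow> 'm \<Rightarrow> 'n)
   \<Rightarrow> 'm \<Rightarrow> 'm \<Rightarrow> 'm \<Rightarrow> 'm \<Rightarrow> 'n" where
  "restr_datum D C F Y \<phi> g f s t =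
     base_change D C F
       (canon D C F (pr1 C f g) (fpair C f g s t) (Y f))
       (canon D C F (pr2 C f g) (fpair C f g s t) (Y g))
       (\<phi> g f)"

text \<open>
  The two restrictions of \<open>Y f\<close> to the fiber product of \<open>f\<close> with itself are different objects
  in general, so the normalisation \<open>\<phi> f f = 1\<close> is imposed after restriction to the diagonal.
  The triple fiber product of \<open>f\<close>, \<open>g\<close>, \<open>h\<close> is formed as that of \<open>f \<cdot> pr1 C f g\<close> and \<open>h\<close>.
\<close>

definition descent_datum ::
  "('p, 'n) cat \<Rightarrow> ('o, 'm) cat \<Rightarrow> ('p, 'n, 'o, 'm) fctr \<Rightarrow> 'm set
   \<Rightarrow> ('m \<Rightarrow> 'p) \<Rightarrow> ('m \<Rightarrow> 'm \<Rightarrow> 'n) \<Rightarrow> bool" where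
  "descent_datum D C F R Y \<phi> \<longleftrightarrow>
     (\<forall>f \<in> R. Y f \<in> Obj (fiber D C F (Dom C f))) \<and>
     (\<forall>f \<in> R. \<forall>g \<in> R. \<phi> g f \<in> isos (fiber D C F (Dom C (pr1 C f g)))
        (pb D F (pr1 C f g) (Y f)) (pb D F (pr2 C f g) (Y g))) \<and>
     (\<forall>f \<in> R. let i = Ident C (Dom C f) in
        restr_datum D C F Y \<phi> f f i i = Ident D (pb D F i (Y f))) \<and>
     (\<forall>f \<in> R. \<forall>g \<in> R. \<forall>h \<in> R.
        let w = pr1 C (f \<cdot>\<^bsub>C\<^esub> pr1 C f g) h;
            s = pr1 C f g \<cdot>\<^bsub>C\<^esub> w;
            t = pr2 C f g \<cdot>\<^bsub>C\<^esub> w;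
            r = pr2 C (f \<cdot>\<^bsub>C\<^esub> pr1 C f g) h
        in restr_datum D C F Y \<phi> f g t s \<cdot>\<^bsub>D\<^esub> restr_datum D C F Y \<phi> g h r t
           = restr_datum D C F Y \<phi> f h r s)"

definition effective ::
  "('p, 'n) cat \<Rightarrow> ('o, 'm) cat \<Rightarrow> ('p, 'n, 'o, 'm) fctr \<Rightarrow> 'o \<Rightarrow> 'm set
   \<Rightarrow> ('m \<Rightarrow> 'p) \<Rightarrow> ('m \<Rightarrow> 'm \<Rightarrow> 'n) \<Rightarrow> bool" where
  "effective D C F X R Y \<phi> \<longleftrightarrow>
     (\<exists>Z \<in> Obj (fiber D C F X). \<exists>\<psi>.
        (\<forall>f \<in> R. \<psi> f \<in> isos (fiber D C F (Dom C f)) (pb D F f Z) (Y f)) \<and>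
        (\<forall>f \<in> R. \<forall>g \<in> R.
           base_change D C F
             (canon D C F g (pr2 C f g) Z) (lift D F (pr2 C f g) (Y g)) (\<psi> g)
           = \<phi> g f \<cdot>\<^bsub>D\<^esub> base_change D C F
               (canon D C F f (pr1 C f g) Z) (lift D F (pr1 C f g) (Y f)) (\<psi> f)))"

definition stack ::
  "('p, 'n) cat \<Rightarrow> ('o, 'm) cat \<Rightarrow> ('o \<Rightarrow> 'm set set) \<Rightarrow> ('p, 'n, 'o, 'm) fctr \<Rightarrow> bool" where
  "stack D C J F \<longleftrightarrow> prestack D C J F \<and>
     (\<forall>X \<in> Obj C. \<forall>R \<in> J X. \<forall>Y \<phi>.
        descent_datum D C F R Y \<phi> \<longrightarrow> effective D C F X R Y \<phi>)"


section \<open>Maps of fibered categories\<close>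

text \<open>In this section \<open>F' : D' \<rightarrow> C\<close> and \<open>F : D \<rightarrow> C\<close> are functors.\<close>

definition fibered_map ::
  "('p1, 'n1) cat \<Rightarrow> ('p1, 'n1, 'o, 'm) fctr \<Rightarrow> ('p2, 'n2) cat \<Rightarrow> ('p2, 'n2, 'o, 'm) fctr
   \<Rightarrow> ('p1, 'n1, 'p2, 'n2) fctr \<Rightarrow> bool" where
  "fibered_map D' F' D F a \<longleftrightarrow> is_functor D' D a \<and> functor_eq D' (F \<odot> a) F'"

definition two_isomorphic ::
  "('o, 'm) cat \<Rightarrow> ('p1, 'n1) cat \<Rightarrow> ('p1, 'n1, 'o, 'm) fctr
   \<Rightarrow> ('p2, 'n2) cat \<Rightarrow> ('p2, 'n2, 'o, 'm) fctr
   \<Rightarrow> ('p1, 'n1, 'p2, 'n2) fctr \<Rightarrow> ('p1, 'n1, 'p2, 'n2) fctr \<Rightarrow> bool" where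
  "two_isomorphic C D' F' D F a b \<longleftrightarrow>
     (\<exists>\<eta>. (\<forall>X \<in> Obj D'. \<eta> X \<in> isos D (OMap a X) (OMap b X) \<and>
             AMap F (\<eta> X) = Ident C (OMap F' X)) \<and>
          (\<forall>u \<in> Arr D'.
             \<eta> (Cod D' u) \<cdot>\<^bsub>D\<^esub> AMap a u = AMap b u \<cdot>\<^bsub>D\<^esub> \<eta> (Dom D' u)))"

definition fibered_equivalence ::
  "('o, 'm) cat \<Rightarrow> ('p1, 'n1) cat \<Rightarrow> ('p1, 'n1, 'o, 'm) fctr
   \<Rightarrow> ('p2, 'n2) cat \<Rightarrow> ('p2, 'n2, 'o, 'm) fctr \<Rightarrow> ('p1, 'n1, 'p2, 'n2) fctr \<Rightarrow> bool" where
  "fibered_equivalence C D' F' D F a \<longleftrightarrow> fibered_map D' F' D F a \<and>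
     (\<exists>b. fibered_map D F D' F' b \<and>
        two_isomorphic C D' F' D' F' (b \<odot> a) id_functor \<and>
        two_isomorphic C D F D F (a \<odot> b) id_functor)"

end

theory Submission
  imports Defs
begin

text \<open>
  Both halves of the stack condition are restated without chosen lifts and fiber products. The
  prestack condition says that arrows glue along families covering their source in the induced
  topology (\<open>arrows_glue\<close>). A descent datum \<open>\<phi>\<close> is encoded by the relation on pairs of arrows
  \<open>a : Z \<rightarrow> Y f\<close>, \<open>b : Z \<rightarrow> Y g\<close> saying that \<open>\<phi> g f\<close> carries \<open>a\<close> to \<open>b\<close>; normalisation and
  the cocycle condition become reflexivity and transitivity, and effectiveness means that arrows
  \<open>c f : Y f \<rightarrow> Z\<close> over the covering identify related pairs.

  In this form (1) is gluing first in \<open>D\<close> and then in \<open>E\<close>. Conversely, let \<open>F H = G\<close> with \<open>H\<close>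
  fibered, \<open>G\<close> a stack and \<open>F\<close> a prestack. A descent datum for \<open>H\<close> is one for \<open>G\<close>, and glues to
  some \<open>Z0\<close>; since arrows glue for \<open>F\<close>, the images of the gluing arrows come from an arrow
  \<open>X \<rightarrow> H Z0\<close> along which \<open>Z0\<close> is pulled back, so \<open>H\<close> is a stack. For (2) the functor \<open>A\<close> is made
  fibered by passing to the category of pairs of an object \<open>e\<close> and an arrow \<open>d \<rightarrow> A e\<close> over an
  identity; in (3) it is already fibered, as arrows over identities in \<open>D\<close> are identities.
\<close>

section \<open>Categories fibered in groupoids\<close>

text \<open>The chosen lifts for \<open>G\<close> are not built from those for \<open>A\<close> and
  \<open>F\<close>, and restricted isomorphisms are compared through different \<open>canon\<close>
  arrows in \<open>D\<close> and in \<open>E\<close>. Translating descent data between the three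
  functors in that form would be a computation with coherence isomorphisms. The restated conditions
  mention only arrows and their composites, so that one family of arrows, or one relation, can be
  read over \<open>C\<close> or over \<open>D\<close> without being changed.

  Part (2) has to replace \<open>G\<close> because an object of \<open>D\<close> with an arrow to
  \<open>A e\<close> over an identity need not be the image of an object of \<open>E\<close>:
  \<open>A\<close> may lack strict lifts. By \<open>fibered_upper\<close> this is the only
  obstruction, and an object of \<open>E'\<close> removes it by carrying its own arrow
  \<open>d -> A e\<close>.

  Gluing of arrows is all that is asked of \<open>F\<close> in (2): in a descent problem for the
  functor to \<open>D\<close>, the covered object \<open>X\<close> of \<open>D\<close> is given, and
  only an arrow out of it has to be glued.\<close>

context category
begin

lemma arr_comp [simp]:
  assumes "f \<in> Arr C" "g \<in> Arr C" "Dom C g = Cod C f"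
  shows "g \<cdot> f \<in> Arr C" "Dom C (g \<cdot> f) = Dom C f" "Cod C (g \<cdot> f) = Cod C g"
  using Comp_in[of f "Dom C f" "Cod C f" g "Cod C g"] assms by (auto simp: hom_def)

lemma arr_ident [simp]:
  assumes "X \<in> Obj C"
  shows "Ident C X \<in> Arr C" "Dom C (Ident C X) = X" "Cod C (Ident C X) = X"
  using Ident_in[OF assms] by (auto simp: hom_def)

lemma comp_ident [simp]:
  assumes "f \<in> Arr C"
  shows "Dom C f = X \<Longrightarrow> f \<cdot> Ident C X = f" "Cod C f = Y \<Longrightarrow> Ident C Y \<cdot> f = f"
  using Comp_Ident[of f] Ident_Comp[of f] assms by (auto simp: hom_def)

lemma comp_assoc [simp]:
  assumes "f \<in> Arr C" "g \<in> Arr C" "h \<in> Arr C" "Dom C g = Cod C f" "Dom C h = Cod C g"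
  shows "h \<cdot> g \<cdot> f = h \<cdot> (g \<cdot> f)"
  using Comp_assoc[of f "Dom C f" "Cod C f" g "Cod C g" h "Cod C h"] assms by (auto simp: hom_def)

text \<open>The simplifier keeps composites nested to the right, so an equation between two
  composites no longer matches once another arrow \<open>z\<close> stands behind them. This rule and
  the next restore such equations.\<close>

lemma comp_eq_precomp:
  assumes "g \<cdot> f = g' \<cdot> f'" "f \<in> Arr C" "f' \<in> Arr C" "g \<in> Arr C" "g' \<in> Arr C" "z \<in> Arr C"
    "Dom C g = Cod C f" "Dom C g' = Cod C f'" "Dom C f = Cod C z"
  shows "g \<cdot> (f \<cdot> z) = g' \<cdot> (f' \<cdot> z)"
proof -
  have "Dom C f' = Dom C f"
    using assms arr_comp(2)[of f g] arr_comp(2)[of f' g'] by metis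
  then show ?thesis
    using assms comp_assoc by metis
qed

lemma comp_eq_precomp1:
  assumes "g \<cdot> f = k" "f \<in> Arr C" "g \<in> Arr C" "z \<in> Arr C"
    "Dom C g = Cod C f" "Dom C f = Cod C z"
  shows "g \<cdot> (f \<cdot> z) = k \<cdot> z"
  using assms comp_assoc by metis

declare Dom_in [simp] Cod_in [simp]

lemma ident_iso: "X \<in> Obj C \<Longrightarrow> Ident C X \<in> isos C X X"
  by (auto simp: isos_def hom_def intro!: exI[of _ "Ident C X"])

section \<open>The universal property of the chosen fiber products\<close>

lemma pullback_chosen:
  assumes "\<exists>p q. is_pullback C f g p q"
  shows "is_pullback C f g (pr1 C f g) (pr2 C f g)"
proof -
  have "\<exists>pq. is_pullback C f g (fst pq) (snd pq)"
    using assms by auto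
  then show ?thesis
    unfolding pr1_def pr2_def fprod_def by (rule someI_ex)
qed

lemma pullback_arr:
  assumes "is_pullback C f g p q"
  shows "f \<in> Arr C" "g \<in> Arr C" "p \<in> Arr C" "q \<in> Arr C" "Cod C f = Cod C g"
    "Dom C q = Dom C p" "Cod C p = Dom C f" "Cod C q = Dom C g" "f \<cdot> p = g \<cdot> q"
  using assms by (auto simp: is_pullback_def hom_def)

lemma pullback_univ:
  assumes "is_pullback C f g p q" "s \<in> Arr C" "t \<in> Arr C" "Dom C s = Dom C t"
    "Cod C s = Dom C f" "Cod C t = Dom C g" "f \<cdot> s = g \<cdot> t"
  shows "\<exists>!m. m \<in> Arr C \<and> Dom C m = Dom C s \<and> Cod C m = Dom C p \<and> p \<cdot> m = s \<and> q \<cdot> m = t"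
proof -
  have "s \<in> hom C (Dom C s) (Dom C f)" "t \<in> hom C (Dom C s) (Dom C g)"
    using assms by (auto simp: hom_def)
  then have "\<exists>!m. m \<in> hom C (Dom C s) (Dom C p) \<and> p \<cdot> m = s \<and> q \<cdot> m = t"
    using assms(1,7) unfolding is_pullback_def by blast
  then show ?thesis
    by (simp add: hom_def conj_assoc)
qed

lemma pullback_unique:
  assumes "is_pullback C f g p q" "m \<in> Arr C" "m' \<in> Arr C" "Cod C m = Dom C p" "Cod C m' = Dom C p"
    "p \<cdot> m = p \<cdot> m'" "q \<cdot> m = q \<cdot> m'"
  shows "m = m'"
proof -
  note [simp] = pullback_arr[OF assms(1)]
  have d: "Dom C m = Dom C m'"
    using assms arr_comp(2)[of m p] arr_comp(2)[of m' p] by simp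
  have "f \<cdot> (p \<cdot> m) = g \<cdot> (q \<cdot> m)"
    using assms by - (rule comp_eq_precomp, simp_all)
  then show ?thesis
    using pullback_univ[OF assms(1), of "p \<cdot> m" "q \<cdot> m"] assms(2-) d by auto
qed

lemma fpair:
  assumes "is_pullback C f g (pr1 C f g) (pr2 C f g)" "s \<in> Arr C" "t \<in> Arr C" "Dom C s = Dom C t"
    "Cod C s = Dom C f" "Cod C t = Dom C g" "f \<cdot> s = g \<cdot> t"
  shows "fpair C f g s t \<in> Arr C" "Dom C (fpair C f g s t) = Dom C s"
    "Cod C (fpair C f g s t) = Dom C (pr1 C f g)"
    "pr1 C f g \<cdot> fpair C f g s t = s" "pr2 C f g \<cdot> fpair C f g s t = t"
proof -
  have "\<exists>!m. m \<in> hom C (Dom C s) (Dom C (pr1 C f g)) \<and> pr1 C f g \<cdot> m = s \<and> pr2 C f g \<cdot> m = t"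
    using pullback_univ[OF assms] by (simp add: hom_def conj_assoc)
  from theI'[OF this, folded fpair_def]
  show "fpair C f g s t \<in> Arr C" "Dom C (fpair C f g s t) = Dom C s"
    "Cod C (fpair C f g s t) = Dom C (pr1 C f g)"
    "pr1 C f g \<cdot> fpair C f g s t = s" "pr2 C f g \<cdot> fpair C f g s t = t"
    by (auto simp: hom_def)
qed

end

section \<open>Lifts and cartesian factorisation\<close>

lemma functor_simps:
  assumes "is_functor C D F"
  shows "Y \<in> Obj C \<Longrightarrow> OMap F Y \<in> Obj D"
    "a \<in> Arr C \<Longrightarrow> AMap F a \<in> Arr D"
    "a \<in> Arr C \<Longrightarrow> Dom D (AMap F a) = OMap F (Dom C a)"
    "a \<in> Arr C \<Longrightarrow> Cod D (AMap F a) = OMap F (Cod C a)"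
    "Y \<in> Obj C \<Longrightarrow> AMap F (Ident C Y) = Ident D (OMap F Y)"
    "a \<in> Arr C \<Longrightarrow> b \<in> Arr C \<Longrightarrow> Dom C b = Cod C a \<Longrightarrow>
       AMap F (b \<cdot>\<^bsub>C\<^esub> a) = AMap F b \<cdot>\<^bsub>D\<^esub> AMap F a"
  using assms by (auto simp: is_functor_def hom_def)

locale fibration =
  fixes D :: "('p, 'n) cat" (structure) and C :: "('o, 'm) cat" and F :: "('p, 'n, 'o, 'm) fctr"
  assumes fibered: "fibered D C F"
begin

lemma is_functor: "is_functor D C F"
  using fibered by (simp add: fibered_def)

sublocale D: category D
  using is_functor by (simp add: is_functor_def)

sublocale C: category C
  using is_functor by (simp add: is_functor_def)

lemmas F_simps [simp] = functor_simps[OF is_functor]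

lemma lift_ex:
  assumes "f \<in> Arr C" "Y \<in> Obj D" "OMap F Y = Cod C f"
  obtains g where "g \<in> Arr D" "Cod D g = Y" "AMap F g = f"
  using fibered assms unfolding fibered_def by blast

lemma lift [simp]:
  assumes "f \<in> Arr C" "Y \<in> Obj D" "OMap F Y = Cod C f"
  shows "lift D F f Y \<in> Arr D" "Dom D (lift D F f Y) = pb D F f Y" "Cod D (lift D F f Y) = Y"
    "AMap F (lift D F f Y) = f" "pb D F f Y \<in> Obj D" "OMap F (pb D F f Y) = Dom C f"
proof -
  have "\<exists>g. g \<in> Arr D \<and> Cod D g = Y \<and> AMap F g = f"
    using lift_ex[OF assms] by blast
  from someI_ex[OF this, folded lift_def]
  have *: "lift D F f Y \<in> Arr D" "Cod D (lift D F f Y) = Y" "AMap F (lift D F f Y) = f"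
    by auto
  show "Dom D (lift D F f Y) = pb D F f Y"
    by (simp add: pb_def)
  then show "OMap F (pb D F f Y) = Dom C f"
    using F_simps(3)[OF *(1)] * by simp
  show "pb D F f Y \<in> Obj D"
    using * by (simp add: pb_def)
  show "lift D F f Y \<in> Arr D" "Cod D (lift D F f Y) = Y" "AMap F (lift D F f Y) = f"
    by (fact *)+
qed

lemma cart_ex1:
  assumes "a \<in> Arr D" "b \<in> Arr D" "Cod D a = Cod D b" "f \<in> Arr C" "Dom C f = OMap F (Dom D a)"
    "Cod C f = OMap F (Dom D b)" "AMap F b \<cdot>\<^bsub>C\<^esub> f = AMap F a"
  shows "\<exists>!g. g \<in> hom D (Dom D a) (Dom D b) \<and> b \<cdot> g = a \<and> AMap F g = f"
proof -
  have "f \<in> hom C (OMap F (Dom D a)) (OMap F (Dom D b))"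
    using assms by (simp add: hom_def)
  then show ?thesis
    using fibered assms unfolding fibered_def by blast
qed

lemma cart_fact [simp]:
  assumes "a \<in> Arr D" "b \<in> Arr D" "Cod D a = Cod D b" "f \<in> Arr C" "Dom C f = OMap F (Dom D a)"
    "Cod C f = OMap F (Dom D b)" "AMap F b \<cdot>\<^bsub>C\<^esub> f = AMap F a"
  shows "cart_fact D F b f a \<in> Arr D" "Dom D (cart_fact D F b f a) = Dom D a"
    "Cod D (cart_fact D F b f a) = Dom D b" "b \<cdot> cart_fact D F b f a = a"
    "AMap F (cart_fact D F b f a) = f"
  using theI'[OF cart_ex1[OF assms], folded cart_fact_def] by (auto simp: hom_def)

lemma cart_ex:
  assumes "a \<in> Arr D" "b \<in> Arr D" "Cod D a = Cod D b" "f \<in> Arr C" "Dom C f = OMap F (Dom D a)"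
    "Cod C f = OMap F (Dom D b)" "AMap F b \<cdot>\<^bsub>C\<^esub> f = AMap F a"
  obtains g where "g \<in> Arr D" "Dom D g = Dom D a" "Cod D g = Dom D b" "b \<cdot> g = a" "AMap F g = f"
  using cart_fact[OF assms] by blast

text \<open>All arrows of a category fibered in groupoids are cartesian, so each \<open>b\<close>
  acts as a monomorphism on arrows with a common image in \<open>C\<close>. Most equations in the
  total categories are proved by this cancellation.\<close>

lemma cart_cancel:
  assumes "b \<cdot> g = b \<cdot> g'" "AMap F g = AMap F g'" "b \<in> Arr D" "g \<in> Arr D" "g' \<in> Arr D"
    "Cod D g = Dom D b" "Cod D g' = Dom D b"
  shows "g = g'"
proof -
  have *: "Dom D g = Dom D g'"
    using assms D.arr_comp(2)[of g b] D.arr_comp(2)[of g' b] by simp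
  have "\<exists>!x. x \<in> hom D (Dom D (b \<cdot> g)) (Dom D b) \<and> b \<cdot> x = b \<cdot> g \<and> AMap F x = AMap F g"
    using assms by (intro cart_ex1) auto
  moreover have "g \<in> hom D (Dom D (b \<cdot> g)) (Dom D b)" "g' \<in> hom D (Dom D (b \<cdot> g)) (Dom D b)"
    using assms * by (auto simp: hom_def)
  ultimately show ?thesis
    using assms(1,2) by metis
qed

section \<open>Arrows over identities\<close>

text \<open>The right inverse is the factorisation of the identity of the target through
  \<open>u\<close>. It is a left inverse as well, because \<open>u\<close> can be cancelled.\<close>

lemma vertical_inverse:
  assumes "u \<in> Arr D" "AMap F u = Ident C X"  "OMap F (Dom D u) = X" "OMap F (Cod D u) = X"
  obtains v where "v \<in> Arr D" "Dom D v = Cod D u" "Cod D v = Dom D u" "AMap F v = Ident C X"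
    "u \<cdot> v = Ident D (Cod D u)" "v \<cdot> u = Ident D (Dom D u)"
proof -
  have X: "X \<in> Obj C"
    using assms F_simps(1) D.Dom_in by metis
  obtain v where v: "v \<in> Arr D" "Dom D v = Cod D u" "Cod D v = Dom D u" "AMap F v = Ident C X"
    "u \<cdot> v = Ident D (Cod D u)"
    using cart_ex[of "Ident D (Cod D u)" u "Ident C X"] assms X by auto
  have "v \<cdot> u = Ident D (Dom D u)"
  proof (rule cart_cancel[of u])
    show "u \<cdot> (v \<cdot> u) = u \<cdot> Ident D (Dom D u)"
      using D.comp_eq_precomp1[OF v(5), of u] assms v by simp
  qed (use assms v X in auto)
  with v that show thesis
    by blast
qed

lemma vertical_cancel:
  assumes "a \<cdot> u = b \<cdot> u" "u \<in> Arr D" "AMap F u = Ident C X"  "OMap F (Dom D u) = X"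
    "OMap F (Cod D u) = X" "a \<in> Arr D" "b \<in> Arr D" "Dom D a = Cod D u" "Dom D b = Cod D u"
  shows "a = b"
proof -
  obtain v where v: "v \<in> Arr D" "Dom D v = Cod D u" "Cod D v = Dom D u"
    "u \<cdot> v = Ident D (Cod D u)"
    using vertical_inverse[OF assms(2-5)] by metis
  have "a \<cdot> (u \<cdot> v) = b \<cdot> (u \<cdot> v)"
    using assms v by - (rule D.comp_eq_precomp, auto)
  then show ?thesis
    using v assms by simp
qed

text \<open>Invertibility is automatic for arrows over identities. This removes the inverses hidden
  in \<open>isos\<close> from all later arguments.\<close>

lemma isos_fiber:
  "u \<in> isos (fiber D C F X) Y1 Y2 \<longleftrightarrow>
     u \<in> Arr D \<and> Dom D u = Y1 \<and> Cod D u = Y2 \<and> OMap F Y1 = X \<and> OMap F Y2 = X \<and> AMap F u = Ident C X"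
  (is "?L \<longleftrightarrow> ?R")
proof
  assume ?L
  then show ?R
    by (auto simp: isos_def hom_def fiber_def)
next
  assume u: ?R
  then obtain v where "v \<in> Arr D" "Dom D v = Cod D u" "Cod D v = Dom D u" "AMap F v = Ident C X"
    "u \<cdot> v = Ident D (Cod D u)" "v \<cdot> u = Ident D (Dom D u)"
    using vertical_inverse by metis
  with u show ?L
    by (auto simp: isos_def hom_def fiber_def)
qed

lemma canon [simp]:
  assumes "p \<in> Arr C" "h \<in> Arr C" "Cod C h = Dom C p" "Y \<in> Obj D" "OMap F Y = Cod C p"
  shows "canon D C F p h Y \<in> Arr D" "Dom D (canon D C F p h Y) = pb D F (p \<cdot>\<^bsub>C\<^esub> h) Y"
    "Cod D (canon D C F p h Y) = pb D F p Y" "AMap F (canon D C F p h Y) = h"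
    "lift D F p Y \<cdot> canon D C F p h Y = lift D F (p \<cdot>\<^bsub>C\<^esub> h) Y"
  using assms unfolding canon_def by auto

lemma base_change [simp]:
  assumes "a \<in> Arr D" "b \<in> Arr D" "u \<in> Arr D" "Dom D u = Cod D a" "Cod D u = Cod D b"
    "AMap F a = AMap F b" "AMap F u = Ident C (OMap F (Cod D a))"
  shows "base_change D C F a b u \<in> Arr D" "Dom D (base_change D C F a b u) = Dom D a"
    "Cod D (base_change D C F a b u) = Dom D b"
    "AMap F (base_change D C F a b u) = Ident C (OMap F (Dom D a))"
    "b \<cdot> base_change D C F a b u = u \<cdot> a"
proof -
  have 1: "OMap F (Dom D a) = OMap F (Dom D b)" "OMap F (Cod D a) = OMap F (Cod D b)"
    using F_simps(3)[of a] F_simps(3)[of b] F_simps(4)[of a] F_simps(4)[of b] assms(1,2,6) by metis+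
  have 2: "Ident C (OMap F (Cod D a)) \<cdot>\<^bsub>C\<^esub> AMap F a = AMap F b"
    using assms 1 by simp
  show "base_change D C F a b u \<in> Arr D" "Dom D (base_change D C F a b u) = Dom D a"
    "Cod D (base_change D C F a b u) = Dom D b"
    "AMap F (base_change D C F a b u) = Ident C (OMap F (Dom D a))"
    "b \<cdot> base_change D C F a b u = u \<cdot> a"
    using assms 1 2 unfolding base_change_def by auto
qed

end

section \<open>Gluing of arrows\<close>

locale pretopology = category C for C :: "('o, 'm) cat" (structure) +
  fixes J :: "'o \<Rightarrow> 'm set set"
  assumes cover_arr: "\<lbrakk>X \<in> Obj C; R \<in> J X; f \<in> R\<rbrakk> \<Longrightarrow> f \<in> Arr C \<and> Cod C f = X"
    and cover_pullback: "\<lbrakk>X \<in> Obj C; R \<in> J X; f \<in> R; g \<in> Arr C; Cod C g = X\<rbrakk>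
      \<Longrightarrow> \<exists>p q. is_pullback C g f p q"

lemma grothendieck_pretopology:
  assumes "category C" "grothendieck_topology C J"
  shows "pretopology C J"
proof (intro pretopology.intro pretopology_axioms.intro)
  note J = assms(2)[unfolded grothendieck_topology_def]
  show "f \<in> Arr C \<and> Cod C f = X" if "X \<in> Obj C" "R \<in> J X" "f \<in> R" for X R f
    using conjunct1[OF J] that by blast
  show "\<exists>p q. is_pullback C g f p q"
    if "X \<in> Obj C" "R \<in> J X" "f \<in> R" "g \<in> Arr C" "Cod C g = X" for X R f g
    using conjunct1[OF conjunct2[OF conjunct2[OF J]]] that by metis
qed fact

text \<open>The base arrow \<open>h\<close> is fixed in advance, since arrows of \<open>C\<close>
  itself need not glue uniquely for \<open>J\<close>. Allowing any \<open>h\<close>, not only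
  identities, gives a condition that composes along functors; it reduces to the identity case by
  restricting \<open>Y2\<close> along \<open>h\<close>. Compatibility is tested on all pairs
  \<open>s\<close>, \<open>t\<close>, so no fiber product occurs.\<close>

definition arrows_glue ::
  "('p, 'n) cat \<Rightarrow> ('o, 'm) cat \<Rightarrow> ('o \<Rightarrow> 'm set set) \<Rightarrow> ('p, 'n, 'o, 'm) fctr \<Rightarrow> bool" where
  "arrows_glue D C J F \<longleftrightarrow>
     (\<forall>Y1 \<in> Obj D. \<forall>Y2 \<in> Obj D. \<forall>R \<in> induced_topology D F J Y1. \<forall>h \<in> Arr C. \<forall>u.
        Dom C h = OMap F Y1 \<longrightarrow> Cod C h = OMap F Y2 \<longrightarrow>
        (\<forall>a \<in> R. u a \<in> Arr D \<and> Dom D (u a) = Dom D a \<and> Cod D (u a) = Y2 \<and>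
           AMap F (u a) = h \<cdot>\<^bsub>C\<^esub> AMap F a) \<longrightarrow>
        (\<forall>a \<in> R. \<forall>b \<in> R. \<forall>s \<in> Arr D. \<forall>t \<in> Arr D. Dom D s = Dom D t \<longrightarrow> Cod D s = Dom D a \<longrightarrow>
           Cod D t = Dom D b \<longrightarrow> a \<cdot>\<^bsub>D\<^esub> s = b \<cdot>\<^bsub>D\<^esub> t \<longrightarrow> u a \<cdot>\<^bsub>D\<^esub> s = u b \<cdot>\<^bsub>D\<^esub> t) \<longrightarrow>
        (\<exists>!w. w \<in> Arr D \<and> Dom D w = Y1 \<and> Cod D w = Y2 \<and> AMap F w = h \<and>
           (\<forall>a \<in> R. w \<cdot>\<^bsub>D\<^esub> a = u a)))"

section \<open>Slice categories and the presheaf of isomorphisms\<close>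

context category
begin

lemma slice_simps [simp]:
  "Obj (slice C X) = {f \<in> Arr C. Cod C f = X}"
  "Dom (slice C X) (f', h, f) = f'"
  "Cod (slice C X) (f', h, f) = f"
  "Ident (slice C X) f = (f, Ident C (Dom C f), f)"
  "Comp (slice C X) (f', h, f) (f'', k, g) = (f'', h \<cdot> k, f)"
  by (auto simp: slice_def)

lemma slice_Arr [simp]:
  "(f', h, f) \<in> Arr (slice C X) \<longleftrightarrow>
     f' = f \<cdot> h \<and> f \<in> Arr C \<and> Cod C f = X \<and> h \<in> Arr C \<and> Cod C h = Dom C f"
  by (auto simp: slice_def)

lemma slice_hom:
  "(f', h, f) \<in> hom (slice C X) S T \<longleftrightarrow>
     f' = f \<cdot> h \<and> f \<in> Arr C \<and> Cod C f = X \<and> h \<in> Arr C \<and> Cod C h = Dom C f \<and> S = f' \<and> T = f"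
  by (auto simp: hom_def)

lemma category_slice: "category (slice C X)"
proof
  show "S \<in> Arr (slice C X) \<Longrightarrow> Dom (slice C X) S \<in> Obj (slice C X)" for S
    by (cases S) simp
  show "S \<in> Arr (slice C X) \<Longrightarrow> Cod (slice C X) S \<in> Obj (slice C X)" for S
    by (cases S) simp
  show "Ident (slice C X) f \<in> hom (slice C X) f f" if "f \<in> Obj (slice C X)" for f
    using that by (simp add: slice_hom)
  show "Comp (slice C X) g f \<in> hom (slice C X) S U"
    if "f \<in> hom (slice C X) S T" "g \<in> hom (slice C X) T U" for f g S T U
    using that by (cases f; cases g) (simp add: slice_hom)
  show "Comp (slice C X) f (Ident (slice C X) S) = f" if "f \<in> hom (slice C X) S T" for f S T
    using that by (cases f) (simp add: slice_hom)
  show "Comp (slice C X) (Ident (slice C X) T) f = f" if "f \<in> hom (slice C X) S T" for f S T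
    using that by (cases f) (simp add: slice_hom)
  show "Comp (slice C X) (Comp (slice C X) h g) f = Comp (slice C X) h (Comp (slice C X) g f)"
    if "f \<in> hom (slice C X) S T" "g \<in> hom (slice C X) T U" "h \<in> hom (slice C X) U V"
    for f g h S T U V
    using that by (cases f; cases g; cases h) (simp add: slice_hom)
qed

end

context fibration
begin

lemma Sec_iso_presheaf:
  assumes "f \<in> Arr C" "Y1 \<in> Obj D" "Y2 \<in> Obj D" "OMap F Y1 = Cod C f" "OMap F Y2 = Cod C f"
  shows "x \<in> Sec (iso_presheaf D C F Y1 Y2) f \<longleftrightarrow>
    x \<in> Arr D \<and> Dom D x = pb D F f Y1 \<and> Cod D x = pb D F f Y2 \<and> AMap F x = Ident C (Dom C f)"
  using assms by (auto simp: iso_presheaf_def isos_fiber)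

lemma Res_iso_presheaf:
  assumes "f \<in> Arr C" "Y1 \<in> Obj D" "Y2 \<in> Obj D" "OMap F Y1 = Cod C f" "OMap F Y2 = Cod C f"
    "h \<in> Arr C" "Cod C h = Dom C f" "x \<in> Sec (iso_presheaf D C F Y1 Y2) f"
  shows "Res (iso_presheaf D C F Y1 Y2) (f', h, f) x \<in> Sec (iso_presheaf D C F Y1 Y2) (f \<cdot>\<^bsub>C\<^esub> h)"
    "canon D C F f h Y2 \<cdot> Res (iso_presheaf D C F Y1 Y2) (f', h, f) x = x \<cdot> canon D C F f h Y1"
    "lift D F (f \<cdot>\<^bsub>C\<^esub> h) Y2 \<cdot> Res (iso_presheaf D C F Y1 Y2) (f', h, f) x =
       lift D F f Y2 \<cdot> (x \<cdot> canon D C F f h Y1)"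
proof -
  note x = assms(8)[unfolded Sec_iso_presheaf[OF assms(1-5)]]
  let ?v = "base_change D C F (canon D C F f h Y1) (canon D C F f h Y2) x"
  have v: "Res (iso_presheaf D C F Y1 Y2) (f', h, f) x = ?v"
    by (simp add: iso_presheaf_def)
  have 1: "?v \<in> Arr D" "Dom D ?v = pb D F (f \<cdot>\<^bsub>C\<^esub> h) Y1" "Cod D ?v = pb D F (f \<cdot>\<^bsub>C\<^esub> h) Y2"
    "AMap F ?v = Ident C (Dom C h)"
    "canon D C F f h Y2 \<cdot> ?v = x \<cdot> canon D C F f h Y1"
    using assms(1-7) x base_change[of "canon D C F f h Y1" "canon D C F f h Y2" x] by simp_all
  show "Res (iso_presheaf D C F Y1 Y2) (f', h, f) x \<in> Sec (iso_presheaf D C F Y1 Y2) (f \<cdot>\<^bsub>C\<^esub> h)"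
    unfolding v using 1 assms(1-7) by (simp add: Sec_iso_presheaf)
  show 2: "canon D C F f h Y2 \<cdot> Res (iso_presheaf D C F Y1 Y2) (f', h, f) x = x \<cdot> canon D C F f h Y1"
    unfolding v by (rule 1)
  show "lift D F (f \<cdot>\<^bsub>C\<^esub> h) Y2 \<cdot> Res (iso_presheaf D C F Y1 Y2) (f', h, f) x =
       lift D F f Y2 \<cdot> (x \<cdot> canon D C F f h Y1)"
    unfolding v 1(5)[symmetric]
    using D.comp_eq_precomp1[OF canon(5)[of f h Y2], of ?v] 1(1-4) assms(1-7) by simp
qed

text \<open>The lift of \<open>f \<cdot> h\<close> with target \<open>Y2\<close> is cartesian and
  all sections lie over identities, so a restriction is recognised by its composite with this
  lift.\<close>

lemma Res_iso_presheaf_eqI: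
  assumes "f \<in> Arr C" "Y1 \<in> Obj D" "Y2 \<in> Obj D" "OMap F Y1 = Cod C f" "OMap F Y2 = Cod C f"
    "h \<in> Arr C" "Cod C h = Dom C f" "x \<in> Sec (iso_presheaf D C F Y1 Y2) f"
    "v \<in> Sec (iso_presheaf D C F Y1 Y2) (f \<cdot>\<^bsub>C\<^esub> h)"
    "lift D F (f \<cdot>\<^bsub>C\<^esub> h) Y2 \<cdot> v = lift D F f Y2 \<cdot> (x \<cdot> canon D C F f h Y1)"
  shows "Res (iso_presheaf D C F Y1 Y2) (f', h, f) x = v"
proof (rule cart_cancel[of "lift D F (f \<cdot>\<^bsub>C\<^esub> h) Y2"])
  note r = Res_iso_presheaf[OF assms(1-8), of f']
  have fh: "f \<cdot>\<^bsub>C\<^esub> h \<in> Arr C" "OMap F Y1 = Cod C (f \<cdot>\<^bsub>C\<^esub> h)" "OMap F Y2 = Cod C (f \<cdot>\<^bsub>C\<^esub> h)"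
    using assms(1-7) by simp_all
  note S = Sec_iso_presheaf[OF fh(1) assms(2,3) fh(2,3)]
  show "lift D F (f \<cdot>\<^bsub>C\<^esub> h) Y2 \<cdot> Res (iso_presheaf D C F Y1 Y2) (f', h, f) x =
    lift D F (f \<cdot>\<^bsub>C\<^esub> h) Y2 \<cdot> v"
    using r(3) assms(10) by simp
qed (use Res_iso_presheaf(1)[OF assms(1-8), of f'] assms(1-7,9) in \<open>simp_all add: Sec_iso_presheaf\<close>)

text \<open>Chosen lifts are functorial only up to isomorphism, yet the presheaf laws hold strictly:
  by uniqueness of cartesian factorisations the comparison arrows \<open>canon\<close> satisfy an
  identity law and a composition law on the nose, and they determine the restriction maps.\<close>

lemma is_presheaf_iso_presheaf:
  assumes "X \<in> Obj C" "Y1 \<in> Obj D" "Y2 \<in> Obj D" "OMap F Y1 = X" "OMap F Y2 = X"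
  shows "is_presheaf (slice C X) (iso_presheaf D C F Y1 Y2)"
  unfolding is_presheaf_def
proof (intro conjI ballI impI)
  let ?P = "iso_presheaf D C F Y1 Y2"
  show "category (slice C X)"
    by (rule C.category_slice)
  show "Res ?P S x \<in> Sec ?P (Dom (slice C X) S)"
    if S: "S \<in> Arr (slice C X)" and x: "x \<in> Sec ?P (Cod (slice C X) S)" for S x
  proof -
    obtain f h where "S = (f \<cdot>\<^bsub>C\<^esub> h, h, f)" "f \<in> Arr C" "Cod C f = X" "h \<in> Arr C" "Cod C h = Dom C f"
      using S by (cases S) simp
    then show ?thesis
      using Res_iso_presheaf(1)[of f Y1 Y2 h x] assms x by simp
  qed
  show "Res ?P (Ident (slice C X) f) x = x" if "f \<in> Obj (slice C X)" and x: "x \<in> Sec ?P f" for f x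
  proof -
    have f: "f \<in> Arr C" "Cod C f = X"
      using that by simp_all
    have c: "canon D C F f (Ident C (Dom C f)) Y1 = Ident D (pb D F f Y1)"
      using f assms by - (rule cart_cancel[of "lift D F f Y1"], simp_all)
    have "Res ?P (f, Ident C (Dom C f), f) x = x"
      by (rule Res_iso_presheaf_eqI) (use f assms x c Sec_iso_presheaf[of f Y1 Y2 x] in simp_all)
    then show ?thesis
      by simp
  qed
  show "Res ?P (S \<cdot>\<^bsub>slice C X\<^esub> T) x = Res ?P T (Res ?P S x)"
    if T': "T \<in> Arr (slice C X)" and S': "S \<in> Arr (slice C X)" and d: "Dom (slice C X) S = Cod (slice C X) T"
      and x: "x \<in> Sec ?P (Cod (slice C X) S)" for S T x
  proof -
    obtain f h where S: "S = (f \<cdot>\<^bsub>C\<^esub> h, h, f)" "f \<in> Arr C" "Cod C f = X" "h \<in> Arr C" "Cod C h = Dom C f"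
      using S' by (cases S) simp
    obtain k where T: "T = (f \<cdot>\<^bsub>C\<^esub> h \<cdot>\<^bsub>C\<^esub> k, k, f \<cdot>\<^bsub>C\<^esub> h)" "k \<in> Arr C" "Cod C k = Dom C h"
      using T' d S by (cases T) auto
    have x: "x \<in> Sec ?P f"
      using x S by simp
    define y where "y = Res ?P (f \<cdot>\<^bsub>C\<^esub> h, h, f) x"
    define z where "z = Res ?P (f \<cdot>\<^bsub>C\<^esub> (h \<cdot>\<^bsub>C\<^esub> k), k, f \<cdot>\<^bsub>C\<^esub> h) y"
    have y: "y \<in> Sec ?P (f \<cdot>\<^bsub>C\<^esub> h)"
      "lift D F (f \<cdot>\<^bsub>C\<^esub> h) Y2 \<cdot> y = lift D F f Y2 \<cdot> (x \<cdot> canon D C F f h Y1)"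
      unfolding y_def using S assms x Res_iso_presheaf[of f Y1 Y2 h x] by auto
    have z: "z \<in> Sec ?P (f \<cdot>\<^bsub>C\<^esub> (h \<cdot>\<^bsub>C\<^esub> k))"
      "lift D F (f \<cdot>\<^bsub>C\<^esub> (h \<cdot>\<^bsub>C\<^esub> k)) Y2 \<cdot> z = lift D F (f \<cdot>\<^bsub>C\<^esub> h) Y2 \<cdot> (y \<cdot> canon D C F (f \<cdot>\<^bsub>C\<^esub> h) k Y1)"
      unfolding z_def using S T(2,3) assms y(1) Res_iso_presheaf(1,3)[of "f \<cdot>\<^bsub>C\<^esub> h" Y1 Y2 k y]
      by auto
    have c: "canon D C F f (h \<cdot>\<^bsub>C\<^esub> k) Y1 = canon D C F f h Y1 \<cdot> canon D C F (f \<cdot>\<^bsub>C\<^esub> h) k Y1"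
    proof (rule cart_cancel[of "lift D F f Y1"])
      show "lift D F f Y1 \<cdot> canon D C F f (h \<cdot>\<^bsub>C\<^esub> k) Y1 =
        lift D F f Y1 \<cdot> (canon D C F f h Y1 \<cdot> canon D C F (f \<cdot>\<^bsub>C\<^esub> h) k Y1)"
        using S T(2,3) assms by (subst D.comp_eq_precomp1[OF canon(5)]) simp_all
    qed (use S T(2,3) assms in simp_all)
    have "Res ?P (f \<cdot>\<^bsub>C\<^esub> (h \<cdot>\<^bsub>C\<^esub> k), h \<cdot>\<^bsub>C\<^esub> k, f) x = z"
    proof (rule Res_iso_presheaf_eqI)
      have "lift D F (f \<cdot>\<^bsub>C\<^esub> h) Y2 \<cdot> (y \<cdot> canon D C F (f \<cdot>\<^bsub>C\<^esub> h) k Y1) =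
        lift D F f Y2 \<cdot> (x \<cdot> canon D C F f h Y1) \<cdot> canon D C F (f \<cdot>\<^bsub>C\<^esub> h) k Y1"
        using S T(2,3) assms x y by - (rule D.comp_eq_precomp1, simp_all add: Sec_iso_presheaf)
      then show "lift D F (f \<cdot>\<^bsub>C\<^esub> (h \<cdot>\<^bsub>C\<^esub> k)) Y2 \<cdot> z =
        lift D F f Y2 \<cdot> (x \<cdot> canon D C F f (h \<cdot>\<^bsub>C\<^esub> k) Y1)"
        using S T(2,3) assms x z c by (simp add: Sec_iso_presheaf)
    qed (use S T(2,3) assms x z in simp_all)
    then show ?thesis
      using S T(2,3) by (simp add: T(1) y_def z_def)
  qed
qed

end

lemma arrows_glueD:
  assumes "arrows_glue D C J F" "Y1 \<in> Obj D" "Y2 \<in> Obj D" "R \<in> induced_topology D F J Y1"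
    "h \<in> Arr C" "Dom C h = OMap F Y1" "Cod C h = OMap F Y2"
    "\<And>a. a \<in> R \<Longrightarrow> u a \<in> Arr D \<and> Dom D (u a) = Dom D a \<and> Cod D (u a) = Y2 \<and>
           AMap F (u a) = h \<cdot>\<^bsub>C\<^esub> AMap F a"
    "\<And>a b s t. a \<in> R \<Longrightarrow> b \<in> R \<Longrightarrow> s \<in> Arr D \<Longrightarrow> t \<in> Arr D \<Longrightarrow> Dom D s = Dom D t \<Longrightarrow>
       Cod D s = Dom D a \<Longrightarrow> Cod D t = Dom D b \<Longrightarrow> a \<cdot>\<^bsub>D\<^esub> s = b \<cdot>\<^bsub>D\<^esub> t \<Longrightarrow> u a \<cdot>\<^bsub>D\<^esub> s = u b \<cdot>\<^bsub>D\<^esub> t"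
  shows "\<exists>!w. w \<in> Arr D \<and> Dom D w = Y1 \<and> Cod D w = Y2 \<and> AMap F w = h \<and> (\<forall>a \<in> R. w \<cdot>\<^bsub>D\<^esub> a = u a)"
proof -
  have 1: "\<forall>a \<in> R. u a \<in> Arr D \<and> Dom D (u a) = Dom D a \<and> Cod D (u a) = Y2 \<and>
           AMap F (u a) = h \<cdot>\<^bsub>C\<^esub> AMap F a"
    using assms(8) by blast
  have 2: "\<forall>a \<in> R. \<forall>b \<in> R. \<forall>s \<in> Arr D. \<forall>t \<in> Arr D. Dom D s = Dom D t \<longrightarrow> Cod D s = Dom D a \<longrightarrow>
           Cod D t = Dom D b \<longrightarrow> a \<cdot>\<^bsub>D\<^esub> s = b \<cdot>\<^bsub>D\<^esub> t \<longrightarrow> u a \<cdot>\<^bsub>D\<^esub> s = u b \<cdot>\<^bsub>D\<^esub> t"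
    using assms(9) by blast
  show ?thesis
    using assms(1)[unfolded arrows_glue_def, rule_format, OF assms(2-7)] 1 2 by blast
qed

text \<open>The family of all \<open>w \<cdot> a\<close> is compatible by associativity, and both
  \<open>w\<close> and \<open>w'\<close> glue it.\<close>

lemma arrows_glueD_unique:
  assumes "arrows_glue D C J F" "category D" "is_functor D C F"
    "R \<in> induced_topology D F J (Dom D w)"
    "w \<in> Arr D" "w' \<in> Arr D" "Dom D w' = Dom D w" "Cod D w' = Cod D w" "AMap F w = AMap F w'"
    "\<And>a. a \<in> R \<Longrightarrow> w \<cdot>\<^bsub>D\<^esub> a = w' \<cdot>\<^bsub>D\<^esub> a"
  shows "w = w'"
proof -
  interpret D: category D by fact
  have R: "a \<in> Arr D" "Cod D a = Dom D w" if "a \<in> R" for a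
    using that assms(4) unfolding induced_topology_def by auto
  have F: "AMap F w \<in> Arr C" "Dom C (AMap F w) = OMap F (Dom D w)" "Cod C (AMap F w) = OMap F (Cod D w)"
    using assms(3,5) unfolding is_functor_def hom_def by auto
  have Fa: "AMap F (w \<cdot>\<^bsub>D\<^esub> a) = AMap F w \<cdot>\<^bsub>C\<^esub> AMap F a" if "a \<in> R" for a
    using assms(3,5) R[OF that] unfolding is_functor_def by auto
  have "\<exists>!v. v \<in> Arr D \<and> Dom D v = Dom D w \<and> Cod D v = Cod D w \<and> AMap F v = AMap F w \<and>
      (\<forall>a \<in> R. v \<cdot>\<^bsub>D\<^esub> a = w \<cdot>\<^bsub>D\<^esub> a)"
  proof (rule arrows_glueD[OF assms(1)])
    fix a b s t
    assume *: "a \<in> R" "b \<in> R" "s \<in> Arr D" "t \<in> Arr D" "Cod D s = Dom D a" "Cod D t = Dom D b"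
      "a \<cdot>\<^bsub>D\<^esub> s = b \<cdot>\<^bsub>D\<^esub> t"
    then show "w \<cdot>\<^bsub>D\<^esub> a \<cdot>\<^bsub>D\<^esub> s = w \<cdot>\<^bsub>D\<^esub> b \<cdot>\<^bsub>D\<^esub> t"
      using R[OF *(1)] R[OF *(2)] assms(5) by simp
  qed (use assms(4,5) R F Fa in auto)
  then show ?thesis
    using assms(5-10) by metis
qed

section \<open>Prestacks and gluing of arrows\<close>

context fibration
begin

text \<open>Since the lift \<open>m\<close> of \<open>h\<close> is cartesian, gluing over
  \<open>h\<close> into \<open>Y2\<close> is gluing over an identity into the restriction
  \<open>Z\<close> of \<open>Y2\<close>, where the sheaf condition applies. The sheaf only sees
  chosen lifts of arrows of \<open>C\<close>, while members of \<open>R\<close> are arbitrary arrows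
  of \<open>D\<close>, several of which may lie over one \<open>f\<close>. The family is therefore
  carried to the chosen lifts by arrows over identities and carried back after gluing.\<close>

lemma prestack_arrows_glue:
  assumes "prestack D C J F"
  shows "arrows_glue D C J F"
  unfolding arrows_glue_def
proof (intro ballI allI impI)
  fix Y1 Y2 R h u
  assume Y1: "Y1 \<in> Obj D" and Y2: "Y2 \<in> Obj D" and R: "R \<in> induced_topology D F J Y1"
    and h: "h \<in> Arr C" "Dom C h = OMap F Y1" "Cod C h = OMap F Y2"
    and u: "\<forall>a \<in> R. u a \<in> Arr D \<and> Dom D (u a) = Dom D a \<and> Cod D (u a) = Y2 \<and>
           AMap F (u a) = h \<cdot>\<^bsub>C\<^esub> AMap F a"
    and compat: "\<forall>a \<in> R. \<forall>b \<in> R. \<forall>s \<in> Arr D. \<forall>t \<in> Arr D. Dom D s = Dom D t \<longrightarrow> Cod D s = Dom D a \<longrightarrow>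
           Cod D t = Dom D b \<longrightarrow> a \<cdot> s = b \<cdot> t \<longrightarrow> u a \<cdot> s = u b \<cdot> t"
  define X where "X = OMap F Y1"
  define i where "i = Ident C X"
  define Z where "Z = pb D F h Y2"
  define m where "m = lift D F h Y2"
  define P where "P = iso_presheaf D C F Y1 Z"
  have X: "X \<in> Obj C" "OMap F Y1 = X"
    using Y1 by (auto simp: X_def)
  have i: "i \<in> Arr C" "Dom C i = X" "Cod C i = X"
    using X by (auto simp: i_def)
  have Z: "Z \<in> Obj D" "OMap F Z = X"
    using h Y2 X by (auto simp: Z_def)
  have m: "m \<in> Arr D" "Dom D m = Z" "Cod D m = Y2" "AMap F m = h"
    using h Y2 X by (auto simp: Z_def m_def)
  have Ra: "a \<in> Arr D" "Cod D a = Y1" if "a \<in> R" for a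
    using R that by (auto simp: induced_topology_def)
  define R0 where "R0 = AMap F ` R"
  have R0: "R0 \<in> J X"
    using R X by (auto simp: induced_topology_def R0_def)
  have R0_arr: "f \<in> Arr C" "Cod C f = X" if "f \<in> R0" for f
    using that Ra X by (auto simp: R0_def)
  \<comment> \<open>One member of \<open>R\<close> is selected over each arrow of \<open>R0\<close>.
    The condition at the other members is recovered from compatibility at the end.\<close>
  have "\<exists>\<alpha>. \<forall>f \<in> R0. \<alpha> f \<in> R \<and> AMap F (\<alpha> f) = f"
    by (rule bchoice) (auto simp: R0_def)
  then obtain \<alpha> where \<alpha>R: "\<And>f. f \<in> R0 \<Longrightarrow> \<alpha> f \<in> R" and F\<alpha>: "\<And>f. f \<in> R0 \<Longrightarrow> AMap F (\<alpha> f) = f"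
    by blast
  have \<alpha>: "\<alpha> f \<in> Arr D" "Cod D (\<alpha> f) = Y1" "OMap F (Dom D (\<alpha> f)) = Dom C f" if "f \<in> R0" for f
    using Ra[OF \<alpha>R[OF that]] F\<alpha>[OF that] F_simps(3)[of "\<alpha> f"] by auto
  have u\<alpha>: "u (\<alpha> f) \<in> Arr D" "Dom D (u (\<alpha> f)) = Dom D (\<alpha> f)" "Cod D (u (\<alpha> f)) = Y2"
    "AMap F (u (\<alpha> f)) = h \<cdot>\<^bsub>C\<^esub> f" if "f \<in> R0" for f
    using u \<alpha>R[OF that] F\<alpha>[OF that] by auto
  have "\<exists>j. \<forall>f \<in> R0. j f \<in> Arr D \<and> Dom D (j f) = pb D F f Y1 \<and> Cod D (j f) = Dom D (\<alpha> f) \<and>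
      \<alpha> f \<cdot> j f = lift D F f Y1 \<and> AMap F (j f) = Ident C (Dom C f)"
    (is "\<exists>j. \<forall>f \<in> R0. ?j f (j f)")
  proof (rule bchoice, intro ballI)
    fix f assume f: "f \<in> R0"
    show "\<exists>j. ?j f j"
      by (rule cart_ex[of "lift D F f Y1" "\<alpha> f" "Ident C (Dom C f)"])
        (use \<alpha>[OF f] R0_arr[OF f] F\<alpha>[OF f] X Y1 in auto)
  qed
  then obtain j where j: "\<And>f. f \<in> R0 \<Longrightarrow> j f \<in> Arr D" "\<And>f. f \<in> R0 \<Longrightarrow> Dom D (j f) = pb D F f Y1"
      "\<And>f. f \<in> R0 \<Longrightarrow> Cod D (j f) = Dom D (\<alpha> f)"
      "\<And>f. f \<in> R0 \<Longrightarrow> \<alpha> f \<cdot> j f = lift D F f Y1"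
      "\<And>f. f \<in> R0 \<Longrightarrow> AMap F (j f) = Ident C (Dom C f)"
    by blast
  \<comment> \<open>The section over \<open>f\<close>: the arrow \<open>u (\<alpha> f)\<close>,
    moved to the chosen lift by \<open>j f\<close> and factored through the restriction of
    \<open>Z\<close>.\<close>
  have "\<exists>x. \<forall>f \<in> R0. x f \<in> Arr D \<and> Dom D (x f) = pb D F f Y1 \<and> Cod D (x f) = pb D F f Z \<and>
      m \<cdot> (lift D F f Z \<cdot> x f) = u (\<alpha> f) \<cdot> j f \<and> AMap F (x f) = Ident C (Dom C f)"
    (is "\<exists>x. \<forall>f \<in> R0. ?x f (x f)")
  proof (rule bchoice, intro ballI)
    fix f assume f: "f \<in> R0"
    show "\<exists>x. ?x f x"
      by (rule cart_ex[of "u (\<alpha> f) \<cdot> j f" "m \<cdot> lift D F f Z" "Ident C (Dom C f)"])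
        (use \<alpha>[OF f] R0_arr[OF f] u\<alpha>[OF f] F\<alpha>[OF f] j[OF f] X Y1 Z m h in auto)
  qed
  then obtain x where x: "\<And>f. f \<in> R0 \<Longrightarrow> x f \<in> Arr D" "\<And>f. f \<in> R0 \<Longrightarrow> Dom D (x f) = pb D F f Y1"
      "\<And>f. f \<in> R0 \<Longrightarrow> Cod D (x f) = pb D F f Z"
      "\<And>f. f \<in> R0 \<Longrightarrow> m \<cdot> (lift D F f Z \<cdot> x f) = u (\<alpha> f) \<cdot> j f"
      "\<And>f. f \<in> R0 \<Longrightarrow> AMap F (x f) = Ident C (Dom C f)"
    by blast
  have xS: "x f \<in> Sec P f" if "f \<in> R0" for f
    unfolding P_def using R0_arr[OF that] x[OF that] Y1 Z X by (simp add: Sec_iso_presheaf)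
  \<comment> \<open>The sheaf condition is used at the identity \<open>i\<close>, the terminal
    object of the slice. There \<open>f\<close> appears as the arrow from \<open>f\<close> to
    \<open>i\<close>, that is, as the triple \<open>(f, f, i)\<close>.\<close>
  define Rs where "Rs = (\<lambda>f. (f, f, i)) ` R0"
  have Rs: "Rs \<in> induced_topology (slice C X) (slice_forget C) J i"
  proof -
    have "AMap (slice_forget C) ` Rs = R0"
      by (force simp: Rs_def slice_forget_def)
    moreover have "Rs \<subseteq> {S \<in> Arr (slice C X). Cod (slice C X) S = i}"
      using R0_arr i X by (auto simp: Rs_def i_def)
    ultimately show ?thesis
      using R0 i by (auto simp: induced_topology_def slice_forget_def)
  qed
  have sheaf: "is_sheaf (slice C X) (induced_topology (slice C X) (slice_forget C) J) P"
    using assms X Y1 Z unfolding prestack_def P_def by (auto simp: fiber_def)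
  have ex1: "\<exists>!y. y \<in> Sec P i \<and> (\<forall>S \<in> Rs. Res P S y = (\<lambda>(_, f, _). x f) S)"
  proof (rule sheaf[unfolded is_sheaf_def, THEN conjunct2, rule_format])
    show "i \<in> Obj (slice C X)"
      using i by simp
    show "Rs \<in> induced_topology (slice C X) (slice_forget C) J i"
      by (rule Rs)
    show "(\<forall>S \<in> Rs. (\<lambda>(_, f, _). x f) S \<in> Sec P (Dom (slice C X) S)) \<and>
      (\<forall>S \<in> Rs. \<forall>S' \<in> Rs. \<forall>T. \<forall>s \<in> hom (slice C X) T (Dom (slice C X) S).
        \<forall>t \<in> hom (slice C X) T (Dom (slice C X) S').
           S \<cdot>\<^bsub>slice C X\<^esub> s = S' \<cdot>\<^bsub>slice C X\<^esub> t \<longrightarrow>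
           Res P s ((\<lambda>(_, f, _). x f) S) = Res P t ((\<lambda>(_, f, _). x f) S'))"
    proof (intro conjI ballI allI impI)
      fix S assume "S \<in> Rs"
      then show "(\<lambda>(_, f, _). x f) S \<in> Sec P (Dom (slice C X) S)"
        using xS by (auto simp: Rs_def)
    next
      fix S S' T s t
      assume S: "S \<in> Rs" and S': "S' \<in> Rs" and s: "s \<in> hom (slice C X) T (Dom (slice C X) S)"
        and t: "t \<in> hom (slice C X) T (Dom (slice C X) S')" and eq: "S \<cdot>\<^bsub>slice C X\<^esub> s = S' \<cdot>\<^bsub>slice C X\<^esub> t"
      obtain f where f: "S = (f, f, i)" "f \<in> R0"
        using S by (auto simp: Rs_def)
      obtain g where g: "S' = (g, g, i)" "g \<in> R0"
        using S' by (auto simp: Rs_def)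
      obtain s0 where s0: "s = (f \<cdot>\<^bsub>C\<^esub> s0, s0, f)" "s0 \<in> Arr C" "Cod C s0 = Dom C f"
        using s f by (cases s) (auto simp: C.slice_hom)
      obtain t0 where t0: "t = (g \<cdot>\<^bsub>C\<^esub> t0, t0, g)" "t0 \<in> Arr C" "Cod C t0 = Dom C g"
        using t g by (cases t) (auto simp: C.slice_hom)
      have e: "f \<cdot>\<^bsub>C\<^esub> s0 = g \<cdot>\<^bsub>C\<^esub> t0"
        using eq f g s0 t0 by simp
      note fa = R0_arr[OF f(2)] \<alpha>[OF f(2)] u\<alpha>[OF f(2)] j[OF f(2)] x[OF f(2)]
      note ga = R0_arr[OF g(2)] \<alpha>[OF g(2)] u\<alpha>[OF g(2)] j[OF g(2)] x[OF g(2)]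
      note r = Res_iso_presheaf[of g Y1 Z t0 "x g" "g \<cdot>\<^bsub>C\<^esub> t0"]
      let ?v = "Res P t (x g)"
      have v: "?v \<in> Sec P (f \<cdot>\<^bsub>C\<^esub> s0)" "lift D F (f \<cdot>\<^bsub>C\<^esub> s0) Z \<cdot> ?v = lift D F g Z \<cdot> (x g \<cdot> canon D C F g t0 Y1)"
        using r(1,3) ga(1,2) t0 xS[OF g(2)] Y1 Z X e by (auto simp: P_def)
      have c: "canon D C F f s0 Y1 \<in> Arr D" "Dom D (canon D C F f s0 Y1) = pb D F (f \<cdot>\<^bsub>C\<^esub> s0) Y1"
        "Cod D (canon D C F f s0 Y1) = pb D F f Y1" "AMap F (canon D C F f s0 Y1) = s0"
        "lift D F f Y1 \<cdot> canon D C F f s0 Y1 = lift D F (f \<cdot>\<^bsub>C\<^esub> s0) Y1"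
        using fa s0 Y1 X by simp_all
      have c': "canon D C F g t0 Y1 \<in> Arr D" "Dom D (canon D C F g t0 Y1) = pb D F (f \<cdot>\<^bsub>C\<^esub> s0) Y1"
        "Cod D (canon D C F g t0 Y1) = pb D F g Y1" "AMap F (canon D C F g t0 Y1) = t0"
        "lift D F g Y1 \<cdot> canon D C F g t0 Y1 = lift D F (f \<cdot>\<^bsub>C\<^esub> s0) Y1"
        using ga t0 Y1 X e by simp_all
      \<comment> \<open>After composition with \<open>\<alpha> f\<close> and
        \<open>\<alpha> g\<close> respectively, both arrows become the chosen lift of
        \<open>f \<cdot> s0 = g \<cdot> t0\<close>. Hence the compatibility of \<open>u\<close>
        applies to them.\<close>
      have 1: "\<alpha> f \<cdot> (j f \<cdot> canon D C F f s0 Y1) = lift D F (f \<cdot>\<^bsub>C\<^esub> s0) Y1"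
        using D.comp_eq_precomp1[OF fa(13), of "canon D C F f s0 Y1"] fa c by simp
      have 2: "\<alpha> g \<cdot> (j g \<cdot> canon D C F g t0 Y1) = lift D F (f \<cdot>\<^bsub>C\<^esub> s0) Y1"
        using D.comp_eq_precomp1[OF ga(13), of "canon D C F g t0 Y1"] ga c' by simp
      have 3: "u (\<alpha> f) \<cdot> (j f \<cdot> canon D C F f s0 Y1) = u (\<alpha> g) \<cdot> (j g \<cdot> canon D C F g t0 Y1)"
        using compat[rule_format, OF \<alpha>R[OF f(2)] \<alpha>R[OF g(2)], of "j f \<cdot> canon D C F f s0 Y1"
          "j g \<cdot> canon D C F g t0 Y1"] 1 2 fa ga c c' by simp
      have lZ: "lift D F f Z \<in> Arr D" "Dom D (lift D F f Z) = pb D F f Z" "Cod D (lift D F f Z) = Z"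
        "lift D F g Z \<in> Arr D" "Dom D (lift D F g Z) = pb D F g Z" "Cod D (lift D F g Z) = Z"
        "AMap F (lift D F f Z) = f" "AMap F (lift D F g Z) = g"
        using fa ga Z by simp_all
      have 4: "m \<cdot> (lift D F f Z \<cdot> (x f \<cdot> canon D C F f s0 Y1)) = u (\<alpha> f) \<cdot> (j f \<cdot> canon D C F f s0 Y1)"
        using D.comp_eq_precomp[OF fa(18), of "canon D C F f s0 Y1"] fa c lZ m by simp
      have 5: "m \<cdot> (lift D F g Z \<cdot> (x g \<cdot> canon D C F g t0 Y1)) = u (\<alpha> g) \<cdot> (j g \<cdot> canon D C F g t0 Y1)"
        using D.comp_eq_precomp[OF ga(18), of "canon D C F g t0 Y1"] ga c' lZ m by simp
      have 6: "lift D F g Z \<cdot> (x g \<cdot> canon D C F g t0 Y1) = lift D F f Z \<cdot> (x f \<cdot> canon D C F f s0 Y1)"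
        by (rule cart_cancel[of m]) (use 3 4 5 fa ga c c' lZ m e s0 t0 in simp_all)
      have "Res P s (x f) = ?v"
        unfolding s0(1) P_def
        by (rule Res_iso_presheaf_eqI)
          (use fa s0 Y1 Z X xS[OF f(2)] v 6 in \<open>simp_all add: P_def\<close>)
      then show "Res P s ((\<lambda>(_, f, _). x f) S) = Res P t ((\<lambda>(_, f, _). x f) S')"
        by (simp add: f g)
    qed
  qed
  \<comment> \<open>Read through the cartesian arrows into \<open>Y2\<close>, the restriction
    condition on sections becomes an equation with a composite of \<open>u (\<alpha> f)\<close>,
    usable for both existence and uniqueness.\<close>
  have Res_iff: "Res P (f, f, i) y = x f \<longleftrightarrow>
      m \<cdot> (lift D F i Z \<cdot> (y \<cdot> canon D C F i f Y1)) = u (\<alpha> f) \<cdot> j f"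
    if "f \<in> R0" "y \<in> Sec P i" for f y
  proof -
    note fa = R0_arr[OF that(1)] \<alpha>[OF that(1)] u\<alpha>[OF that(1)] j[OF that(1)] x[OF that(1)]
    have y: "y \<in> Arr D" "Dom D y = pb D F i Y1" "Cod D y = pb D F i Z" "AMap F y = i"
      using that(2) i Y1 Z X by (auto simp: P_def Sec_iso_presheaf i_def)
    have if': "i \<cdot>\<^bsub>C\<^esub> f = f"
      using fa by (simp add: i_def)
    have c: "canon D C F i f Y1 \<in> Arr D" "Dom D (canon D C F i f Y1) = pb D F f Y1"
        "Cod D (canon D C F i f Y1) = pb D F i Y1" "AMap F (canon D C F i f Y1) = f"
      using fa i Y1 X if' by simp_all
    have lZ: "lift D F f Z \<in> Arr D" "Dom D (lift D F f Z) = pb D F f Z" "Cod D (lift D F f Z) = Z"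
      "AMap F (lift D F f Z) = f"
      "lift D F i Z \<in> Arr D" "Dom D (lift D F i Z) = pb D F i Z" "Cod D (lift D F i Z) = Z"
      "AMap F (lift D F i Z) = i"
      using fa i Z by simp_all
    show ?thesis
    proof
      assume "Res P (f, f, i) y = x f"
      then have "lift D F f Z \<cdot> x f = lift D F i Z \<cdot> (y \<cdot> canon D C F i f Y1)"
        using Res_iso_presheaf(3)[of i Y1 Z f y f] i Y1 Z X fa that(2) if' by (simp add: P_def)
      then show "m \<cdot> (lift D F i Z \<cdot> (y \<cdot> canon D C F i f Y1)) = u (\<alpha> f) \<cdot> j f"
        using fa(18) by simp
    next
      assume a: "m \<cdot> (lift D F i Z \<cdot> (y \<cdot> canon D C F i f Y1)) = u (\<alpha> f) \<cdot> j f"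
      have "lift D F f Z \<cdot> x f = lift D F i Z \<cdot> (y \<cdot> canon D C F i f Y1)"
        by (rule cart_cancel[of m]) (use a fa y c lZ m i if' in simp_all)
      then show "Res P (f, f, i) y = x f"
        unfolding P_def
        by - (rule Res_iso_presheaf_eqI, use i Y1 Z X fa xS[OF that(1)] that(2) if' in \<open>simp_all add: P_def\<close>)
    qed
  qed
  note lY = lift[OF i(1) Y1, unfolded i(2,3), OF X(2)]
  note lZ = lift[OF i(1) Z(1), unfolded i(2,3), OF Z(2)]
  have c: "canon D C F i f Y1 \<in> Arr D" "Dom D (canon D C F i f Y1) = pb D F f Y1"
        "Cod D (canon D C F i f Y1) = pb D F i Y1" "AMap F (canon D C F i f Y1) = f"
        "lift D F i Y1 \<cdot> canon D C F i f Y1 = lift D F f Y1"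
    if "f \<in> R0" for f
    using i Y1 X R0_arr[OF that] canon[of i f Y1] C.comp_ident(2)[of f X] by (auto simp: i_def)
  have ex1: "\<exists>!y. y \<in> Sec P i \<and> (\<forall>f \<in> R0. Res P (f, f, i) y = x f)"
    using ex1 by (simp add: Rs_def)
  then obtain y where y: "y \<in> Sec P i" "\<And>f. f \<in> R0 \<Longrightarrow> Res P (f, f, i) y = x f"
    by blast
  have ya: "y \<in> Arr D" "Dom D y = pb D F i Y1" "Cod D y = pb D F i Z" "AMap F y = i"
    using y(1) i Y1 Z X by (auto simp: P_def Sec_iso_presheaf i_def)
  have y_unique: "y' = y" if "y' \<in> Sec P i" "\<And>f. f \<in> R0 \<Longrightarrow> Res P (f, f, i) y' = x f" for y'
    using ex1 y that by metis
  \<comment> \<open>The chosen lift of an identity need not be an identity. Its inverse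
    \<open>k\<close> moves the glued section from \<open>pb D F i Y1\<close> back to
    \<open>Y1\<close>.\<close>
  obtain k where k: "k \<in> Arr D" "Dom D k = Y1" "Cod D k = pb D F i Y1" "lift D F i Y1 \<cdot> k = Ident D Y1"
    "AMap F k = i" "k \<cdot> lift D F i Y1 = Ident D (pb D F i Y1)"
    using vertical_inverse[of "lift D F i Y1" X] lY X Y1 i by (auto simp: i_def)
  show "\<exists>!w. w \<in> Arr D \<and> Dom D w = Y1 \<and> Cod D w = Y2 \<and> AMap F w = h \<and> (\<forall>a \<in> R. w \<cdot> a = u a)"
  proof (rule ex_ex1I)
    define w where "w = m \<cdot> (lift D F i Z \<cdot> (y \<cdot> k))"
    have w: "w \<in> Arr D" "Dom D w = Y1" "Cod D w = Y2" "AMap F w = h"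
      using m lZ ya k i h X by (auto simp: w_def i_def)
    have "w \<cdot> a = u a" if a: "a \<in> R" for a
    proof -
      define f where "f = AMap F a"
      have f: "f \<in> R0"
        using a by (auto simp: f_def R0_def)
      note fa = R0_arr[OF f] \<alpha>[OF f] u\<alpha>[OF f] j[OF f] x[OF f] F\<alpha>[OF f]
      have Fa: "AMap F a = f" "OMap F (Dom D a) = Dom C f"
        using Ra[OF a] by (simp_all add: f_def)
      have lf: "lift D F f Y1 \<in> Arr D" "Dom D (lift D F f Y1) = pb D F f Y1" "Cod D (lift D F f Y1) = Y1"
        "AMap F (lift D F f Y1) = f" "OMap F (pb D F f Y1) = Dom C f" "OMap F (pb D F f Z) = Dom C f"
        using fa Y1 X Z by simp_all
      obtain b where b: "b \<in> Arr D" "Dom D b = Dom D a" "Cod D b = pb D F f Y1" "lift D F f Y1 \<cdot> b = a"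
        "AMap F b = Ident C (Dom C f)"
        by (rule cart_ex[of a "lift D F f Y1" "Ident C (Dom C f)"])
          (use Ra[OF a] lf fa Fa in auto)
      have 1: "k \<cdot> a = canon D C F i f Y1 \<cdot> b"
      proof (rule cart_cancel[of "lift D F i Y1"])
        show "lift D F i Y1 \<cdot> (k \<cdot> a) = lift D F i Y1 \<cdot> (canon D C F i f Y1 \<cdot> b)"
          using D.comp_eq_precomp1[OF k(4), of a] D.comp_eq_precomp1[OF c(5)[OF f], of b]
            lY k c[OF f] b Ra[OF a] by simp
        show "AMap F (k \<cdot> a) = AMap F (canon D C F i f Y1 \<cdot> b)"
          using k c[OF f] b Ra[OF a] Fa fa by (simp add: i_def)
      qed (use k c[OF f] b Ra[OF a] lY in auto)
      have 2: "m \<cdot> (lift D F i Z \<cdot> (y \<cdot> canon D C F i f Y1)) = u (\<alpha> f) \<cdot> j f"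
        using Res_iff[OF f y(1)] y(2)[OF f] by simp
      have 3: "w \<cdot> a = u (\<alpha> f) \<cdot> (j f \<cdot> b)"
        using D.comp_eq_precomp[OF 2, of b] m lZ ya c[OF f] b fa k Ra[OF a] 1 by (simp add: w_def)
      \<comment> \<open>A member \<open>a\<close> that need not be \<open>\<alpha> f\<close> is
        reached here: \<open>j f \<cdot> b\<close> after \<open>\<alpha> f\<close> equals the
        identity after \<open>a\<close>, so compatibility replaces \<open>u (\<alpha> f)\<close> by
        \<open>u a\<close>.\<close>
      have 4: "\<alpha> f \<cdot> (j f \<cdot> b) = a \<cdot> Ident D (Dom D a)"
        using D.comp_eq_precomp1[OF fa(13), of b] fa b Ra[OF a] by simp
      have "u (\<alpha> f) \<cdot> (j f \<cdot> b) = u a \<cdot> Ident D (Dom D a)"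
        using compat[rule_format, OF \<alpha>R[OF f] a, of "j f \<cdot> b" "Ident D (Dom D a)"] 4 fa b Ra[OF a] by simp
      then show ?thesis
        using 3 u a Ra[OF a] by simp
    qed
    with w show "\<exists>w. w \<in> Arr D \<and> Dom D w = Y1 \<and> Cod D w = Y2 \<and> AMap F w = h \<and> (\<forall>a \<in> R. w \<cdot> a = u a)"
      by blast
  next
    \<comment> \<open>Any solution, composed with the lift of the identity, factors through
      \<open>Z\<close> as a section with the prescribed restrictions. Uniqueness in the sheaf then
      forces this section to be \<open>y\<close>.\<close>
    have *: "w \<cdot> lift D F i Y1 = m \<cdot> (lift D F i Z \<cdot> y)"
      if w: "w \<in> Arr D" "Dom D w = Y1" "Cod D w = Y2" "AMap F w = h" "\<forall>a \<in> R. w \<cdot> a = u a" for w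
    proof -
      obtain v where v: "v \<in> Arr D" "Dom D v = pb D F i Y1" "Cod D v = pb D F i Z"
        "m \<cdot> (lift D F i Z \<cdot> v) = w \<cdot> lift D F i Y1" "AMap F v = i"
        by (rule cart_ex[of "w \<cdot> lift D F i Y1" "m \<cdot> lift D F i Z" i])
          (use w lY lZ m i h X in \<open>auto simp: i_def\<close>)
      have vS: "v \<in> Sec P i"
        using v i Y1 Z X by (auto simp: P_def Sec_iso_presheaf i_def)
      have "v = y"
      proof (rule y_unique[OF vS])
        fix f assume f: "f \<in> R0"
        note fa = R0_arr[OF f] \<alpha>[OF f] u\<alpha>[OF f] j[OF f] x[OF f] F\<alpha>[OF f]
        have "m \<cdot> (lift D F i Z \<cdot> (v \<cdot> canon D C F i f Y1)) = w \<cdot> (lift D F i Y1 \<cdot> canon D C F i f Y1)"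
          using D.comp_eq_precomp[OF v(4), of "canon D C F i f Y1"] m lZ lY v c[OF f] w by simp
        also have "\<dots> = w \<cdot> (\<alpha> f \<cdot> j f)"
          using c(5)[OF f] fa(13) by simp
        also have "\<dots> = u (\<alpha> f) \<cdot> j f"
          using D.comp_eq_precomp1[of w "\<alpha> f" "u (\<alpha> f)" "j f"] w \<alpha>R[OF f] fa by simp
        finally show "Res P (f, f, i) v = x f"
          using Res_iff[OF f vS] by simp
      qed
      then show ?thesis
        using v(4) by simp
    qed
    fix w w'
    assume w: "w \<in> Arr D \<and> Dom D w = Y1 \<and> Cod D w = Y2 \<and> AMap F w = h \<and> (\<forall>a \<in> R. w \<cdot> a = u a)"
      and w': "w' \<in> Arr D \<and> Dom D w' = Y1 \<and> Cod D w' = Y2 \<and> AMap F w' = h \<and> (\<forall>a \<in> R. w' \<cdot> a = u a)"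
    have "w \<cdot> lift D F i Y1 = w' \<cdot> lift D F i Y1"
      using *[of w] *[of w'] w w' by simp
    then show "w = w'"
      by (rule vertical_cancel[where X = X]) (use w w' lY X i in \<open>simp_all add: i_def\<close>)
  qed
qed

text \<open>The comparison arrows \<open>canon D C F f h Y1\<close> cover
  \<open>pb D F f Y1\<close>, and a matching family of sections, composed with the comparison arrows
  for \<open>Y2\<close>, is a family of arrows to glue. The glued arrow lies over an identity, so it
  is an isomorphism of the fiber without further proof.\<close>

lemma arrows_glue_prestack:
  assumes glue: "arrows_glue D C J F"
  shows "prestack D C J F"
  unfolding prestack_def
proof (intro conjI ballI)
  show "fibered D C F"
    by (rule fibered)
next
  fix X Y1 Y2
  assume X: "X \<in> Obj C" and Y1: "Y1 \<in> Obj (fiber D C F X)" and Y2: "Y2 \<in> Obj (fiber D C F X)"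
  have Y: "Y1 \<in> Obj D" "Y2 \<in> Obj D" "OMap F Y1 = X" "OMap F Y2 = X"
    using Y1 Y2 by (auto simp: fiber_def)
  define P where "P = iso_presheaf D C F Y1 Y2"
  show "is_sheaf (slice C X) (induced_topology (slice C X) (slice_forget C) J) P"
    unfolding is_sheaf_def
  proof (intro conjI ballI allI impI)
    show "is_presheaf (slice C X) P"
      unfolding P_def by (rule is_presheaf_iso_presheaf) (use X Y in auto)
  next
    fix f R x
    assume f': "f \<in> Obj (slice C X)"
      and R: "R \<in> induced_topology (slice C X) (slice_forget C) J f"
      and *: "(\<forall>S \<in> R. x S \<in> Sec P (Dom (slice C X) S)) \<and>
        (\<forall>S \<in> R. \<forall>S' \<in> R. \<forall>T. \<forall>s \<in> hom (slice C X) T (Dom (slice C X) S).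
          \<forall>t \<in> hom (slice C X) T (Dom (slice C X) S').
             S \<cdot>\<^bsub>slice C X\<^esub> s = S' \<cdot>\<^bsub>slice C X\<^esub> t \<longrightarrow> Res P s (x S) = Res P t (x S'))"
    have f: "f \<in> Arr C" "Cod C f = X"
      using f' by simp_all
    define H where "H = AMap (slice_forget C) ` R"
    have HJ: "H \<in> J (Dom C f)"
      using R by (auto simp: induced_topology_def H_def slice_forget_def)
    have R_sub: "R \<subseteq> {S \<in> Arr (slice C X). Cod (slice C X) S = f}"
      using R by (simp add: induced_topology_def)
    have HR: "R = (\<lambda>h. (f \<cdot>\<^bsub>C\<^esub> h, h, f)) ` H"
      using R_sub by (force simp: H_def slice_forget_def image_iff)
    have H: "h \<in> Arr C" "Cod C h = Dom C f" "f \<cdot>\<^bsub>C\<^esub> h \<in> Arr C" "Cod C (f \<cdot>\<^bsub>C\<^esub> h) = X"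
      "Dom C (f \<cdot>\<^bsub>C\<^esub> h) = Dom C h" if "h \<in> H" for h
    proof -
      have "(f \<cdot>\<^bsub>C\<^esub> h, h, f) \<in> Arr (slice C X)"
        using HR R_sub that by blast
      then show "h \<in> Arr C" "Cod C h = Dom C f"
        by simp_all
      then show "f \<cdot>\<^bsub>C\<^esub> h \<in> Arr C" "Cod C (f \<cdot>\<^bsub>C\<^esub> h) = X" "Dom C (f \<cdot>\<^bsub>C\<^esub> h) = Dom C h"
        using f by simp_all
    qed
    define z where "z h = x (f \<cdot>\<^bsub>C\<^esub> h, h, f)" for h
    have zS: "z h \<in> Sec P (f \<cdot>\<^bsub>C\<^esub> h)" if "h \<in> H" for h
      using * that unfolding z_def HR by simp
    have z: "z h \<in> Arr D" "Dom D (z h) = pb D F (f \<cdot>\<^bsub>C\<^esub> h) Y1" "Cod D (z h) = pb D F (f \<cdot>\<^bsub>C\<^esub> h) Y2"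
      "AMap F (z h) = Ident C (Dom C h)" if "h \<in> H" for h
      using zS[OF that] H[OF that] Y by (simp_all add: P_def Sec_iso_presheaf)
    note l1 = lift[OF f(1) Y(1), unfolded f(2), OF Y(3)]
    note l2 = lift[OF f(1) Y(2), unfolded f(2), OF Y(4)]
    have c1: "canon D C F f h Y1 \<in> Arr D" "Dom D (canon D C F f h Y1) = pb D F (f \<cdot>\<^bsub>C\<^esub> h) Y1"
      "Cod D (canon D C F f h Y1) = pb D F f Y1" "AMap F (canon D C F f h Y1) = h"
      "lift D F f Y1 \<cdot> canon D C F f h Y1 = lift D F (f \<cdot>\<^bsub>C\<^esub> h) Y1" if "h \<in> H" for h
      using H[OF that] Y f by simp_all
    have c2: "canon D C F f h Y2 \<in> Arr D" "Dom D (canon D C F f h Y2) = pb D F (f \<cdot>\<^bsub>C\<^esub> h) Y2"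
      "Cod D (canon D C F f h Y2) = pb D F f Y2" "AMap F (canon D C F f h Y2) = h"
      "lift D F f Y2 \<cdot> canon D C F f h Y2 = lift D F (f \<cdot>\<^bsub>C\<^esub> h) Y2" if "h \<in> H" for h
      using H[OF that] Y f by simp_all
    have o: "OMap F (pb D F (f \<cdot>\<^bsub>C\<^esub> h) Y1) = Dom C h" "OMap F (pb D F (f \<cdot>\<^bsub>C\<^esub> h) Y2) = Dom C h" if "h \<in> H" for h
      using H[OF that] Y f by simp_all
    define R' where "R' = (\<lambda>h. canon D C F f h Y1) ` H"
    define u where "u a = canon D C F f (AMap F a) Y2 \<cdot> z (AMap F a)" for a
    have u: "u (canon D C F f h Y1) = canon D C F f h Y2 \<cdot> z h" if "h \<in> H" for h
      using c1[OF that] by (simp add: u_def)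
    have R': "R' \<in> induced_topology D F J (pb D F f Y1)"
    proof -
      have "AMap F ` R' = H"
        using c1 by (force simp: R'_def image_image)
      then show ?thesis
        using c1 HJ l1 by (auto simp: induced_topology_def R'_def)
    qed
    \<comment> \<open>An arrow \<open>s\<close> factors as a comparison arrow after an arrow
      \<open>q\<close> over an identity. Hence the family composed with \<open>s\<close> depends
      only on the restriction of \<open>z h\<close> along the image of \<open>s\<close> and on
      \<open>q\<close>, which links agreement of sections to agreement of arrows.\<close>
    have restricted: "lift D F f Y2 \<cdot> (canon D C F f h Y2 \<cdot> (z h \<cdot> s)) =
        lift D F g Y2 \<cdot> (Res P (g, AMap F s, f \<cdot>\<^bsub>C\<^esub> h) (z h) \<cdot> q)"
      if h: "h \<in> H" and s: "s \<in> Arr D" "Cod D s = pb D F (f \<cdot>\<^bsub>C\<^esub> h) Y1"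
        and g: "f \<cdot>\<^bsub>C\<^esub> (h \<cdot>\<^bsub>C\<^esub> AMap F s) = g"
        and q: "q \<in> Arr D" "Dom D q = Dom D s" "Cod D q = pb D F g Y1"
          "lift D F g Y1 \<cdot> q = lift D F f Y1 \<cdot> (canon D C F f h Y1 \<cdot> s)"
          "AMap F q = Ident C (OMap F (Dom D s))"
      for h s q g
    proof -
      define s0 where "s0 = AMap F s"
      have s0: "s0 \<in> Arr C" "Dom C s0 = OMap F (Dom D s)" "Cod C s0 = Dom C h"
        using s o[OF h] by (simp_all add: s0_def)
      have g': "f \<cdot>\<^bsub>C\<^esub> h \<cdot>\<^bsub>C\<^esub> s0 = g" "g \<in> Arr C" "Cod C g = X"
        using g H[OF h] s0 f by (auto simp: s0_def)
      define v where "v = Res P (g, s0, f \<cdot>\<^bsub>C\<^esub> h) (z h)"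
      have v: "v \<in> Sec P g"
        "lift D F g Y2 \<cdot> v = lift D F (f \<cdot>\<^bsub>C\<^esub> h) Y2 \<cdot> (z h \<cdot> canon D C F (f \<cdot>\<^bsub>C\<^esub> h) s0 Y1)"
        using Res_iso_presheaf(1,3)[of "f \<cdot>\<^bsub>C\<^esub> h" Y1 Y2 s0 "z h"] H[OF h] s0 Y zS[OF h]
        unfolding v_def P_def g'(1) by auto
      have va: "v \<in> Arr D" "Dom D v = pb D F g Y1" "Cod D v = pb D F g Y2"
        using v(1) g' Y by (simp_all add: P_def Sec_iso_presheaf)
      let ?c = "canon D C F (f \<cdot>\<^bsub>C\<^esub> h) s0 Y1"
      have c: "?c \<in> Arr D" "Dom D ?c = pb D F g Y1" "Cod D ?c = pb D F (f \<cdot>\<^bsub>C\<^esub> h) Y1" "AMap F ?c = s0"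
        "lift D F (f \<cdot>\<^bsub>C\<^esub> h) Y1 \<cdot> ?c = lift D F g Y1"
        using canon[of "f \<cdot>\<^bsub>C\<^esub> h" s0 Y1] H[OF h] s0 Y g'(1) by simp_all
      have ll: "lift D F (f \<cdot>\<^bsub>C\<^esub> h) Y1 \<in> Arr D" "Dom D (lift D F (f \<cdot>\<^bsub>C\<^esub> h) Y1) = pb D F (f \<cdot>\<^bsub>C\<^esub> h) Y1"
        "lift D F (f \<cdot>\<^bsub>C\<^esub> h) Y2 \<in> Arr D" "Dom D (lift D F (f \<cdot>\<^bsub>C\<^esub> h) Y2) = pb D F (f \<cdot>\<^bsub>C\<^esub> h) Y2"
        "lift D F g Y2 \<in> Arr D" "Dom D (lift D F g Y2) = pb D F g Y2"
        using H[OF h] Y g' by simp_all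
      have "?c \<cdot> q = s"
      proof (rule cart_cancel[of "lift D F (f \<cdot>\<^bsub>C\<^esub> h) Y1"])
        show "lift D F (f \<cdot>\<^bsub>C\<^esub> h) Y1 \<cdot> (?c \<cdot> q) = lift D F (f \<cdot>\<^bsub>C\<^esub> h) Y1 \<cdot> s"
          using D.comp_eq_precomp1[OF c(5), of q] D.comp_eq_precomp1[OF c1(5)[OF h], of s]
            c ll q s c1[OF h] l1 by simp
        show "AMap F (?c \<cdot> q) = AMap F s"
          using c q s0 by (simp add: s0_def)
      qed (use c q s ll in auto)
      then have "lift D F (f \<cdot>\<^bsub>C\<^esub> h) Y2 \<cdot> (z h \<cdot> s) = lift D F g Y2 \<cdot> (v \<cdot> q)"
        using D.comp_eq_precomp[OF v(2), of q] c ll q va z[OF h] by simp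
      then show ?thesis
        using D.comp_eq_precomp1[OF c2(5)[OF h], of "z h \<cdot> s"] c2[OF h] l2 z[OF h] s
        by (simp add: v_def s0_def)
    qed
    have "\<exists>!w. w \<in> Arr D \<and> Dom D w = pb D F f Y1 \<and> Cod D w = pb D F f Y2 \<and> AMap F w = Ident C (Dom C f) \<and>
      (\<forall>a \<in> R'. w \<cdot> a = u a)"
    proof (rule arrows_glueD[OF glue l1(5) l2(5) R'])
      fix a assume "a \<in> R'"
      then obtain h where a: "a = canon D C F f h Y1" and h: "h \<in> H"
        by (auto simp: R'_def)
      show "u a \<in> Arr D \<and> Dom D (u a) = Dom D a \<and> Cod D (u a) = pb D F f Y2 \<and>
           AMap F (u a) = Ident C (Dom C f) \<cdot>\<^bsub>C\<^esub> AMap F a"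
        using c1[OF h] c2[OF h] z[OF h] H[OF h] f by (simp add: a u[OF h])
    next
      fix a b s t
      assume a': "a \<in> R'" and b': "b \<in> R'" and s: "s \<in> Arr D" "Cod D s = Dom D a"
        and t: "t \<in> Arr D" "Cod D t = Dom D b" and st: "Dom D s = Dom D t"
        and eq: "a \<cdot> s = b \<cdot> t"
      obtain h where a: "a = canon D C F f h Y1" and h: "h \<in> H"
        using a' by (auto simp: R'_def)
      obtain k where b: "b = canon D C F f k Y1" and k: "k \<in> H"
        using b' by (auto simp: R'_def)
      define s0 where "s0 = AMap F s"
      define t0 where "t0 = AMap F t"
      have s0: "s0 \<in> Arr C" "Dom C s0 = OMap F (Dom D s)" "Cod C s0 = Dom C h"
        using s c1[OF h] o[OF h] by (simp_all add: s0_def a)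
      have t0: "t0 \<in> Arr C" "Dom C t0 = OMap F (Dom D s)" "Cod C t0 = Dom C k"
        using t c1[OF k] o[OF k] st by (simp_all add: t0_def b)
      have e: "h \<cdot>\<^bsub>C\<^esub> s0 = k \<cdot>\<^bsub>C\<^esub> t0"
        using arg_cong[OF eq, of "AMap F"] s t c1[OF h] c1[OF k] by (simp add: a b s0_def t0_def)
      have "Res P (f \<cdot>\<^bsub>C\<^esub> h \<cdot>\<^bsub>C\<^esub> s0, s0, f \<cdot>\<^bsub>C\<^esub> h) (x (f \<cdot>\<^bsub>C\<^esub> h, h, f)) = Res P (f \<cdot>\<^bsub>C\<^esub> k \<cdot>\<^bsub>C\<^esub> t0, t0, f \<cdot>\<^bsub>C\<^esub> k) (x (f \<cdot>\<^bsub>C\<^esub> k, k, f))"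
        (is "Res P ?s _ = Res P ?t _")
      proof (rule *[THEN conjunct2, rule_format])
        show "?s \<in> hom (slice C X) (f \<cdot>\<^bsub>C\<^esub> h \<cdot>\<^bsub>C\<^esub> s0) (Dom (slice C X) (f \<cdot>\<^bsub>C\<^esub> h, h, f))"
          using H[OF h] s0 by (simp add: C.slice_hom)
        show "?t \<in> hom (slice C X) (f \<cdot>\<^bsub>C\<^esub> h \<cdot>\<^bsub>C\<^esub> s0) (Dom (slice C X) (f \<cdot>\<^bsub>C\<^esub> k, k, f))"
          using H[OF h] H[OF k] s0 t0 f e by (simp add: C.slice_hom)
        show "(f \<cdot>\<^bsub>C\<^esub> h, h, f) \<cdot>\<^bsub>slice C X\<^esub> ?s = (f \<cdot>\<^bsub>C\<^esub> k, k, f) \<cdot>\<^bsub>slice C X\<^esub> ?t"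
          using H[OF h] H[OF k] s0 t0 f e by simp
      qed (use h k HR in auto)
      then have r: "Res P ?s (z h) = Res P ?t (z k)"
        by (simp add: z_def)
      define g where "g = f \<cdot>\<^bsub>C\<^esub> (h \<cdot>\<^bsub>C\<^esub> s0)"
      have g: "g \<in> Arr C" "Cod C g = X" "Dom C g = OMap F (Dom D s)"
        using H[OF h] f s0 by (simp_all add: g_def)
      have lg: "lift D F g Y1 \<in> Arr D" "Dom D (lift D F g Y1) = pb D F g Y1" "Cod D (lift D F g Y1) = Y1"
        "AMap F (lift D F g Y1) = g" "OMap F (pb D F g Y1) = OMap F (Dom D s)"
        using g Y by simp_all
      \<comment> \<open>The same \<open>q\<close> serves for \<open>s\<close> and for
        \<open>t\<close>, because \<open>a \<cdot> s = b \<cdot> t\<close>.\<close>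
      obtain q where q: "q \<in> Arr D" "Dom D q = Dom D s" "Cod D q = pb D F g Y1"
        "lift D F g Y1 \<cdot> q = lift D F f Y1 \<cdot> (a \<cdot> s)"
        "AMap F q = Ident C (OMap F (Dom D s))"
      proof (rule cart_ex[of "lift D F f Y1 \<cdot> (a \<cdot> s)" "lift D F g Y1" "Ident C (OMap F (Dom D s))"])
        show "AMap F (lift D F g Y1) \<cdot>\<^bsub>C\<^esub> Ident C (OMap F (Dom D s)) = AMap F (lift D F f Y1 \<cdot> (a \<cdot> s))"
          using lg g s c1[OF h] l1 H[OF h] f s0 by (simp add: a s0_def[symmetric] g_def[symmetric])
      qed (use lg g s c1[OF h] l1 a in auto)
      have g': "f \<cdot>\<^bsub>C\<^esub> h \<cdot>\<^bsub>C\<^esub> s0 = g" "f \<cdot>\<^bsub>C\<^esub> k \<cdot>\<^bsub>C\<^esub> t0 = g" "f \<cdot>\<^bsub>C\<^esub> (k \<cdot>\<^bsub>C\<^esub> t0) = g"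
        using H[OF h] H[OF k] f s0 t0 e by (simp_all add: g_def)
      have r: "Res P (g, s0, f \<cdot>\<^bsub>C\<^esub> h) (z h) = Res P (g, t0, f \<cdot>\<^bsub>C\<^esub> k) (z k)"
        using r unfolding g'(1,2) .
      have "lift D F f Y2 \<cdot> (canon D C F f h Y2 \<cdot> (z h \<cdot> s)) =
          lift D F g Y2 \<cdot> (Res P (g, s0, f \<cdot>\<^bsub>C\<^esub> h) (z h) \<cdot> q)"
        unfolding s0_def by (rule restricted[OF h s(1)]) (use s c1[OF h] q g_def in \<open>auto simp: a s0_def\<close>)
      moreover have "lift D F f Y2 \<cdot> (canon D C F f k Y2 \<cdot> (z k \<cdot> t)) =
          lift D F g Y2 \<cdot> (Res P (g, t0, f \<cdot>\<^bsub>C\<^esub> k) (z k) \<cdot> q)"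
        unfolding t0_def by (rule restricted[OF k t(1)]) (use t c1[OF k] q g'(3) st eq in \<open>auto simp: b t0_def\<close>)
      ultimately have l: "lift D F f Y2 \<cdot> (canon D C F f h Y2 \<cdot> (z h \<cdot> s)) =
          lift D F f Y2 \<cdot> (canon D C F f k Y2 \<cdot> (z k \<cdot> t))"
        using r by simp
      have "canon D C F f h Y2 \<cdot> (z h \<cdot> s) = canon D C F f k Y2 \<cdot> (z k \<cdot> t)"
        by (rule cart_cancel[OF l])
          (use l2 c1[OF h] c1[OF k] c2[OF h] c2[OF k] z[OF h] z[OF k] s t s0 t0 e H[OF h] H[OF k]
            in \<open>simp_all add: a b s0_def[symmetric] t0_def[symmetric]\<close>)
      then show "u a \<cdot> s = u b \<cdot> t"
        using c1[OF h] c1[OF k] c2[OF h] c2[OF k] z[OF h] z[OF k] s t by (simp add: a b u h k)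
    qed (use l1 l2 f in auto)
    moreover have "Sec P f = {y \<in> Arr D. Dom D y = pb D F f Y1 \<and> Cod D y = pb D F f Y2 \<and> AMap F y = Ident C (Dom C f)}"
      using f Y by (auto simp: P_def Sec_iso_presheaf)
    moreover have "(\<forall>S \<in> R. Res P S y = x S) \<longleftrightarrow> (\<forall>a \<in> R'. y \<cdot> a = u a)" if y: "y \<in> Sec P f" for y
    proof -
      have "Res P (f \<cdot>\<^bsub>C\<^esub> h, h, f) y = z h \<longleftrightarrow> y \<cdot> canon D C F f h Y1 = canon D C F f h Y2 \<cdot> z h"
        if h: "h \<in> H" for h
      proof
        show "y \<cdot> canon D C F f h Y1 = canon D C F f h Y2 \<cdot> z h" if "Res P (f \<cdot>\<^bsub>C\<^esub> h, h, f) y = z h"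
          using Res_iso_presheaf(2)[of f Y1 Y2 h y "f \<cdot>\<^bsub>C\<^esub> h"] that f Y H[OF h] y by (simp add: P_def)
        show "Res P (f \<cdot>\<^bsub>C\<^esub> h, h, f) y = z h"
          if e: "y \<cdot> canon D C F f h Y1 = canon D C F f h Y2 \<cdot> z h"
          unfolding P_def
        proof (rule Res_iso_presheaf_eqI)
          show "lift D F (f \<cdot>\<^bsub>C\<^esub> h) Y2 \<cdot> z h = lift D F f Y2 \<cdot> (y \<cdot> canon D C F f h Y1)"
            using D.comp_eq_precomp1[OF c2(5)[OF h], of "z h"] c2[OF h] z[OF h] l2 by (simp add: e)
        qed (use f Y H[OF h] y zS[OF h] in \<open>auto simp: P_def\<close>)
      qed
      then show ?thesis
        by (simp add: HR R'_def u z_def)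
    qed
    ultimately show "\<exists>!y. y \<in> Sec P f \<and> (\<forall>S \<in> R. Res P S y = x S)"
      by (simp add: conj_assoc cong: conj_cong)
  qed
qed

end

section \<open>Gluing of objects\<close>

text \<open>The indices are kept apart from the arrows \<open>r i\<close>, since different members
  of a covering in \<open>D\<close> may have the same image in \<open>C\<close>. By
  \<open>rel_ex\<close> and \<open>rel_unique\<close>, a first arrow has exactly one partner over
  each admissible base arrow; this is how an isomorphism over the fiber product acts on arrows into
  the restrictions.\<close>

locale descent_relation = fibration D C F
  for D :: "('p, 'n) cat" (structure) and C :: "('o, 'm) cat" and F :: "('p, 'n, 'o, 'm) fctr" +
  fixes I :: "'i set" and r :: "'i \<Rightarrow> 'm" and Y :: "'i \<Rightarrow> 'p" and rel :: "'i \<Rightarrow> 'i \<Rightarrow> 'n \<Rightarrow> 'n \<Rightarrow> bool"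
  assumes r_arr: "i \<in> I \<Longrightarrow> r i \<in> Arr C"
    and Y_obj: "i \<in> I \<Longrightarrow> Y i \<in> Obj D" "i \<in> I \<Longrightarrow> OMap F (Y i) = Dom C (r i)"
    and rel_arr: "\<lbrakk>i \<in> I; j \<in> I; rel i j a b\<rbrakk> \<Longrightarrow> a \<in> Arr D \<and> b \<in> Arr D \<and> Dom D a = Dom D b \<and>
      Cod D a = Y i \<and> Cod D b = Y j \<and> r i \<cdot>\<^bsub>C\<^esub> AMap F a = r j \<cdot>\<^bsub>C\<^esub> AMap F b"
    and rel_refl: "\<lbrakk>i \<in> I; a \<in> Arr D; Cod D a = Y i\<rbrakk> \<Longrightarrow> rel i i a a"
    and rel_trans: "\<lbrakk>i \<in> I; j \<in> I; k \<in> I; rel i j a b; rel j k b c\<rbrakk> \<Longrightarrow> rel i k a c"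
    and rel_precomp: "\<lbrakk>i \<in> I; j \<in> I; rel i j a b; z \<in> Arr D; Cod D z = Dom D a\<rbrakk>
      \<Longrightarrow> rel i j (a \<cdot> z) (b \<cdot> z)"
    and rel_ex: "\<lbrakk>i \<in> I; j \<in> I; a \<in> Arr D; Cod D a = Y i; t \<in> Arr C; Dom C t = OMap F (Dom D a);
      Cod C t = Dom C (r j); r i \<cdot>\<^bsub>C\<^esub> AMap F a = r j \<cdot>\<^bsub>C\<^esub> t\<rbrakk> \<Longrightarrow> \<exists>b. rel i j a b \<and> AMap F b = t"
    and rel_unique: "\<lbrakk>i \<in> I; j \<in> I; rel i j a b; rel i j a b'; AMap F b = AMap F b'\<rbrakk> \<Longrightarrow> b = b'"
begin

text \<open>Taking the partner of \<open>b\<close> back over the image of \<open>a\<close> gives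
  some \<open>a'\<close>. Then \<open>a\<close> is related to \<open>a'\<close> by transitivity and
  to itself by reflexivity, and uniqueness forces \<open>a' = a\<close>.\<close>

lemma rel_sym:
  assumes "i \<in> I" "j \<in> I" "rel i j a b"
  shows "rel j i b a"
proof -
  have ab: "a \<in> Arr D" "b \<in> Arr D" "Dom D a = Dom D b" "Cod D a = Y i" "Cod D b = Y j"
    "r i \<cdot>\<^bsub>C\<^esub> AMap F a = r j \<cdot>\<^bsub>C\<^esub> AMap F b"
    using rel_arr[OF assms] by auto
  then obtain a' where a': "rel j i b a'" "AMap F a' = AMap F a"
    using rel_ex[of j i b "AMap F a"] assms Y_obj by auto
  have "a' = a"
    using rel_unique[OF assms(1,1) rel_trans[OF assms(1,2,1,3) a'(1)] rel_refl] assms(1) ab a' by blast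
  with a' show ?thesis
    by simp
qed

lemma rel_cong:
  assumes "\<And>i j a b. i \<in> I \<Longrightarrow> j \<in> I \<Longrightarrow> rel' i j a b \<longleftrightarrow> rel i j a b"
  shows "descent_relation D C F I r Y rel'"
proof
  show "rel' i j a b \<Longrightarrow> i \<in> I \<Longrightarrow> j \<in> I \<Longrightarrow> a \<in> Arr D \<and> b \<in> Arr D \<and> Dom D a = Dom D b \<and>
      Cod D a = Y i \<and> Cod D b = Y j \<and> r i \<cdot>\<^bsub>C\<^esub> AMap F a = r j \<cdot>\<^bsub>C\<^esub> AMap F b" for i j a b
    using rel_arr assms by blast
  show "rel' i i a a" if "i \<in> I" "a \<in> Arr D" "Cod D a = Y i" for i a
    using rel_refl assms that by blast
  show "rel' i k a c" if "i \<in> I" "j \<in> I" "k \<in> I" "rel' i j a b" "rel' j k b c" for i j k a b c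
    using rel_trans assms that by blast
  show "rel' i j (a \<cdot> z) (b \<cdot> z)"
    if "i \<in> I" "j \<in> I" "rel' i j a b" "z \<in> Arr D" "Cod D z = Dom D a" for i j a b z
    using rel_precomp assms that by blast
  show "\<exists>b. rel' i j a b \<and> AMap F b = t"
    if "i \<in> I" "j \<in> I" "a \<in> Arr D" "Cod D a = Y i" "t \<in> Arr C" "Dom C t = OMap F (Dom D a)"
      "Cod C t = Dom C (r j)" "r i \<cdot>\<^bsub>C\<^esub> AMap F a = r j \<cdot>\<^bsub>C\<^esub> t" for i j a t
    using rel_ex[OF that] assms that by blast
  show "b = b'" if "i \<in> I" "j \<in> I" "rel' i j a b" "rel' i j a b'" "AMap F b = AMap F b'" for i j a b b'
    using rel_unique assms that by blast
qed (use r_arr Y_obj in auto)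

end

text \<open>Arrows out of the \<open>Y i\<close> replace isomorphisms from restrictions of
  \<open>Z\<close>: as every arrow is cartesian, an arrow over \<open>r i\<close> into
  \<open>Z\<close> already exhibits \<open>Y i\<close> as such a restriction.\<close>

definition glued_by ::
  "('p, 'n) cat \<Rightarrow> ('p, 'n, 'o, 'm) fctr \<Rightarrow> 'i set \<Rightarrow> ('i \<Rightarrow> 'm) \<Rightarrow> ('i \<Rightarrow> 'p) \<Rightarrow> ('i \<Rightarrow> 'i \<Rightarrow> 'n \<Rightarrow> 'n \<Rightarrow> bool)
   \<Rightarrow> 'p \<Rightarrow> ('i \<Rightarrow> 'n) \<Rightarrow> bool" where
  "glued_by D F I r Y rel Z c \<longleftrightarrow> Z \<in> Obj D \<and>
     (\<forall>i \<in> I. c i \<in> Arr D \<and> Dom D (c i) = Y i \<and> Cod D (c i) = Z \<and> AMap F (c i) = r i) \<and>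
     (\<forall>i \<in> I. \<forall>j \<in> I. \<forall>a b. rel i j a b \<longrightarrow> c i \<cdot>\<^bsub>D\<^esub> a = c j \<cdot>\<^bsub>D\<^esub> b)"

definition objects_glue ::
  "('p, 'n) cat \<Rightarrow> ('o, 'm) cat \<Rightarrow> ('o \<Rightarrow> 'm set set) \<Rightarrow> ('p, 'n, 'o, 'm) fctr \<Rightarrow> bool" where
  "objects_glue D C J F \<longleftrightarrow> (\<forall>X \<in> Obj C. \<forall>R \<in> J X. \<forall>Y rel.
     descent_relation D C F R (\<lambda>f. f) Y rel \<longrightarrow>
     (\<exists>Z c. OMap F Z = X \<and> glued_by D F R (\<lambda>f. f) Y rel Z c))"

section \<open>Translation between gluing data and their relations\<close>

text \<open>A descent datum without normalisation and cocycle condition, so that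
  \<open>datum_rel\<close> is available before these are known, as is needed to prove them
  equivalent to properties of the relation.\<close>

locale gluing_data = fibration D C F
  for D :: "('p, 'n) cat" (structure) and C :: "('o, 'm) cat" and F :: "('p, 'n, 'o, 'm) fctr" +
  fixes X :: 'o and R :: "'m set" and Y :: "'m \<Rightarrow> 'p" and \<phi> :: "'m \<Rightarrow> 'm \<Rightarrow> 'n"
  assumes X_obj: "X \<in> Obj C"
    and R_arr [simp]: "f \<in> R \<Longrightarrow> f \<in> Arr C" "f \<in> R \<Longrightarrow> Cod C f = X"
    and R_pullback: "\<lbrakk>f \<in> R; g \<in> Arr C; Cod C g = X\<rbrakk> \<Longrightarrow> \<exists>p q. is_pullback C g f p q"
    and Y_obj [simp]: "f \<in> R \<Longrightarrow> Y f \<in> Obj D" "f \<in> R \<Longrightarrow> OMap F (Y f) = Dom C f"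
    and \<phi> [simp]: "\<lbrakk>f \<in> R; g \<in> R\<rbrakk> \<Longrightarrow> \<phi> g f \<in> Arr D"
      "\<lbrakk>f \<in> R; g \<in> R\<rbrakk> \<Longrightarrow> Dom D (\<phi> g f) = pb D F (pr1 C f g) (Y f)"
      "\<lbrakk>f \<in> R; g \<in> R\<rbrakk> \<Longrightarrow> Cod D (\<phi> g f) = pb D F (pr2 C f g) (Y g)"
      "\<lbrakk>f \<in> R; g \<in> R\<rbrakk> \<Longrightarrow> AMap F (\<phi> g f) = Ident C (Dom C (pr1 C f g))"
begin

lemma pullback: "\<lbrakk>f \<in> Arr C; Cod C f = X; g \<in> R\<rbrakk> \<Longrightarrow> is_pullback C f g (pr1 C f g) (pr2 C f g)"
  by (rule C.pullback_chosen) (rule R_pullback)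

lemma pr [simp]:
  assumes "f \<in> R" "g \<in> R"
  shows "pr1 C f g \<in> Arr C" "pr2 C f g \<in> Arr C" "Dom C (pr2 C f g) = Dom C (pr1 C f g)"
    "Cod C (pr1 C f g) = Dom C f" "Cod C (pr2 C f g) = Dom C g"
  using C.pullback_arr[OF pullback[of f g]] assms by simp_all

lemma pr_square: "\<lbrakk>f \<in> R; g \<in> R\<rbrakk> \<Longrightarrow> f \<cdot>\<^bsub>C\<^esub> pr1 C f g = g \<cdot>\<^bsub>C\<^esub> pr2 C f g"
  using C.pullback_arr[OF pullback[of f g]] by simp

definition datum_rel :: "'m \<Rightarrow> 'm \<Rightarrow> 'n \<Rightarrow> 'n \<Rightarrow> bool" where
  "datum_rel f g a b \<longleftrightarrow> (\<exists>a' \<in> Arr D. Cod D a' = pb D F (pr1 C f g) (Y f) \<and>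
     a = lift D F (pr1 C f g) (Y f) \<cdot> a' \<and> b = lift D F (pr2 C f g) (Y g) \<cdot> (\<phi> g f \<cdot> a'))"

lemma datum_relI:
  assumes "a' \<in> Arr D" "Cod D a' = pb D F (pr1 C f g) (Y f)"
     "a = lift D F (pr1 C f g) (Y f) \<cdot> a'" "b = lift D F (pr2 C f g) (Y g) \<cdot> (\<phi> g f \<cdot> a')"
  shows "datum_rel f g a b"
  using assms unfolding datum_rel_def by blast

lemma datum_relE:
  assumes "datum_rel f g a b" "f \<in> R" "g \<in> R"
  obtains a' where "a' \<in> Arr D" "Cod D a' = pb D F (pr1 C f g) (Y f)" "Dom D a' = Dom D a"
     "a = lift D F (pr1 C f g) (Y f) \<cdot> a'" "b = lift D F (pr2 C f g) (Y g) \<cdot> (\<phi> g f \<cdot> a')"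
     "AMap F a = pr1 C f g \<cdot>\<^bsub>C\<^esub> AMap F a'" "AMap F b = pr2 C f g \<cdot>\<^bsub>C\<^esub> AMap F a'"
proof -
  obtain a' where a': "a' \<in> Arr D" "Cod D a' = pb D F (pr1 C f g) (Y f)"
     "a = lift D F (pr1 C f g) (Y f) \<cdot> a'" "b = lift D F (pr2 C f g) (Y g) \<cdot> (\<phi> g f \<cdot> a')"
    using assms(1) unfolding datum_rel_def by blast
  show thesis
    by (rule that[OF a'(1,2) _ a'(3,4)]) (use a' assms(2,3) in simp_all)
qed

lemma datum_rel_arr:
  assumes "f \<in> R" "g \<in> R" "datum_rel f g a b"
  shows "a \<in> Arr D \<and> b \<in> Arr D \<and> Dom D a = Dom D b \<and> Cod D a = Y f \<and> Cod D b = Y g \<and>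
    f \<cdot>\<^bsub>C\<^esub> AMap F a = g \<cdot>\<^bsub>C\<^esub> AMap F b"
proof -
  obtain a' where a': "a' \<in> Arr D" "Cod D a' = pb D F (pr1 C f g) (Y f)"
     "a = lift D F (pr1 C f g) (Y f) \<cdot> a'" "b = lift D F (pr2 C f g) (Y g) \<cdot> (\<phi> g f \<cdot> a')"
    using datum_relE[OF assms(3,1,2)] by metis
  then show ?thesis
    using assms(1,2) C.comp_eq_precomp[OF pr_square[OF assms(1,2)], of "AMap F a'"] by simp
qed

lemma datum_rel_precomp:
  assumes "f \<in> R" "g \<in> R" "datum_rel f g a b" "z \<in> Arr D" "Cod D z = Dom D a"
  shows "datum_rel f g (a \<cdot> z) (b \<cdot> z)"
proof -
  obtain a' where a': "a' \<in> Arr D" "Cod D a' = pb D F (pr1 C f g) (Y f)"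
     "Dom D a' = Dom D a" "a = lift D F (pr1 C f g) (Y f) \<cdot> a'" "b = lift D F (pr2 C f g) (Y g) \<cdot> (\<phi> g f \<cdot> a')"
    using datum_relE[OF assms(3,1,2)] by metis
  show ?thesis
    by (rule datum_relI[of "a' \<cdot> z"]) (use a'(1-3) assms in \<open>simp_all add: a'(4,5)\<close>)
qed

text \<open>The images of \<open>a\<close> and of its future partner form a pair that factors
  through the fiber product, and \<open>a\<close> lifts along this factorisation.\<close>

lemma datum_rel_ex:
  assumes "f \<in> R" "g \<in> R" "a \<in> Arr D" "Cod D a = Y f" "t \<in> Arr C" "Dom C t = OMap F (Dom D a)"
      "Cod C t = Dom C g" "f \<cdot>\<^bsub>C\<^esub> AMap F a = g \<cdot>\<^bsub>C\<^esub> t"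
  shows "\<exists>b. datum_rel f g a b \<and> AMap F b = t"
proof -
  have m: "fpair C f g (AMap F a) t \<in> Arr C" "Dom C (fpair C f g (AMap F a) t) = OMap F (Dom D a)"
    "Cod C (fpair C f g (AMap F a) t) = Dom C (pr1 C f g)"
    "pr1 C f g \<cdot>\<^bsub>C\<^esub> fpair C f g (AMap F a) t = AMap F a" "pr2 C f g \<cdot>\<^bsub>C\<^esub> fpair C f g (AMap F a) t = t"
    using C.fpair[OF pullback, of f g "AMap F a" t] assms by simp_all
  obtain a' where a': "a' \<in> Arr D" "Dom D a' = Dom D a" "Cod D a' = pb D F (pr1 C f g) (Y f)"
    "lift D F (pr1 C f g) (Y f) \<cdot> a' = a" "AMap F a' = fpair C f g (AMap F a) t"
    using cart_ex[of a "lift D F (pr1 C f g) (Y f)" "fpair C f g (AMap F a) t"] assms(1-4) m by auto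
  have "datum_rel f g a (lift D F (pr2 C f g) (Y g) \<cdot> (\<phi> g f \<cdot> a'))"
    by (rule datum_relI[of a']) (use a' in auto)
  moreover have "AMap F (lift D F (pr2 C f g) (Y g) \<cdot> (\<phi> g f \<cdot> a')) = t"
    using a' m assms(1,2) by simp
  ultimately show ?thesis
    by blast
qed

lemma datum_rel_unique:
  assumes "f \<in> R" "g \<in> R" "datum_rel f g a b" "datum_rel f g a b'" "AMap F b = AMap F b'"
  shows "b = b'"
proof -
  obtain a1 where a1: "a1 \<in> Arr D" "Cod D a1 = pb D F (pr1 C f g) (Y f)"
     "Dom D a1 = Dom D a" "a = lift D F (pr1 C f g) (Y f) \<cdot> a1" "b = lift D F (pr2 C f g) (Y g) \<cdot> (\<phi> g f \<cdot> a1)"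
     "AMap F a = pr1 C f g \<cdot>\<^bsub>C\<^esub> AMap F a1" "AMap F b = pr2 C f g \<cdot>\<^bsub>C\<^esub> AMap F a1"
    using datum_relE[OF assms(3,1,2)] by metis
  obtain a2 where a2: "a2 \<in> Arr D" "Cod D a2 = pb D F (pr1 C f g) (Y f)"
     "Dom D a2 = Dom D a" "a = lift D F (pr1 C f g) (Y f) \<cdot> a2" "b' = lift D F (pr2 C f g) (Y g) \<cdot> (\<phi> g f \<cdot> a2)"
     "AMap F a = pr1 C f g \<cdot>\<^bsub>C\<^esub> AMap F a2" "AMap F b' = pr2 C f g \<cdot>\<^bsub>C\<^esub> AMap F a2"
    using datum_relE[OF assms(4,1,2)] by metis
  have "AMap F a1 = AMap F a2"
    by (rule C.pullback_unique[OF pullback[of f g]])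
      (use assms(1,2,5) a1(1,2,6,7) a2(1,2,6,7) in simp_all)
  then have "a1 = a2"
    by - (rule cart_cancel[of "lift D F (pr1 C f g) (Y f)"], use a1(1,2,4) a2(1,2,4) assms(1,2) in simp_all)
  then show ?thesis
    using a1(5) a2(5) by simp
qed

text \<open>The last claim, with \<open>restr_datum_eqI\<close>, characterises a restricted
  isomorphism as the arrow over an identity that produces the partner of the lift of
  \<open>s\<close> over \<open>t\<close>. Equations between restrictions can thus be checked on the
  relation.\<close>

lemma restr_datum:
  assumes "f \<in> R" "g \<in> R" "s \<in> Arr C" "t \<in> Arr C" "Dom C s = Dom C t" "Cod C s = Dom C f" "Cod C t = Dom C g"
    "f \<cdot>\<^bsub>C\<^esub> s = g \<cdot>\<^bsub>C\<^esub> t"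
  shows "restr_datum D C F Y \<phi> g f s t \<in> Arr D"
    "Dom D (restr_datum D C F Y \<phi> g f s t) = pb D F s (Y f)"
    "Cod D (restr_datum D C F Y \<phi> g f s t) = pb D F t (Y g)"
    "AMap F (restr_datum D C F Y \<phi> g f s t) = Ident C (Dom C t)"
    "datum_rel f g (lift D F s (Y f)) (lift D F t (Y g) \<cdot> restr_datum D C F Y \<phi> g f s t)"
proof -
  define m where "m = fpair C f g s t"
  have m: "m \<in> Arr C" "Dom C m = Dom C t" "Cod C m = Dom C (pr1 C f g)" "pr1 C f g \<cdot>\<^bsub>C\<^esub> m = s"
    "pr2 C f g \<cdot>\<^bsub>C\<^esub> m = t"
    using C.fpair[OF pullback, of f g s t] assms by (simp_all add: m_def)
  let ?a = "canon D C F (pr1 C f g) m (Y f)" and ?b = "canon D C F (pr2 C f g) m (Y g)"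
  let ?r = "base_change D C F ?a ?b (\<phi> g f)"
  have r: "restr_datum D C F Y \<phi> g f s t = ?r"
    by (simp add: restr_datum_def m_def)
  have a: "?a \<in> Arr D" "Dom D ?a = pb D F s (Y f)" "Cod D ?a = pb D F (pr1 C f g) (Y f)" "AMap F ?a = m"
    "lift D F (pr1 C f g) (Y f) \<cdot> ?a = lift D F s (Y f)"
    using m assms(1,2) by simp_all
  have b: "?b \<in> Arr D" "Dom D ?b = pb D F t (Y g)" "Cod D ?b = pb D F (pr2 C f g) (Y g)" "AMap F ?b = m"
    "lift D F (pr2 C f g) (Y g) \<cdot> ?b = lift D F t (Y g)"
    using m assms(1,2) by simp_all
  have c: "?r \<in> Arr D" "Dom D ?r = pb D F s (Y f)" "Cod D ?r = pb D F t (Y g)" "AMap F ?r = Ident C (Dom C t)"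
    "?b \<cdot> ?r = \<phi> g f \<cdot> ?a"
    using a b base_change[of ?a ?b "\<phi> g f"] assms by simp_all
  show "restr_datum D C F Y \<phi> g f s t \<in> Arr D"
    "Dom D (restr_datum D C F Y \<phi> g f s t) = pb D F s (Y f)"
    "Cod D (restr_datum D C F Y \<phi> g f s t) = pb D F t (Y g)"
    "AMap F (restr_datum D C F Y \<phi> g f s t) = Ident C (Dom C t)"
    unfolding r by (fact c)+
  show "datum_rel f g (lift D F s (Y f)) (lift D F t (Y g) \<cdot> restr_datum D C F Y \<phi> g f s t)"
    unfolding r
  proof (rule datum_relI[of ?a])
    show "lift D F t (Y g) \<cdot> ?r = lift D F (pr2 C f g) (Y g) \<cdot> (\<phi> g f \<cdot> ?a)"
      unfolding c(5)[symmetric] using D.comp_eq_precomp1[OF b(5), of ?r] b c(1-4) assms by simp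
  qed (use a in simp_all)
qed

lemma restr_datum_eqI:
  assumes "f \<in> R" "g \<in> R" "s \<in> Arr C" "t \<in> Arr C" "Dom C s = Dom C t" "Cod C s = Dom C f" "Cod C t = Dom C g"
    "f \<cdot>\<^bsub>C\<^esub> s = g \<cdot>\<^bsub>C\<^esub> t"
    "v \<in> Arr D" "Cod D v = pb D F t (Y g)" "AMap F v = Ident C (Dom C t)"
    "datum_rel f g (lift D F s (Y f)) (lift D F t (Y g) \<cdot> v)"
  shows "restr_datum D C F Y \<phi> g f s t = v"
proof -
  note r = restr_datum[OF assms(1-8)]
  have "lift D F t (Y g) \<cdot> restr_datum D C F Y \<phi> g f s t = lift D F t (Y g) \<cdot> v"
    by (rule datum_rel_unique[OF assms(1,2) r(5) assms(12)]) (use r assms(1-11) in simp)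
  then show ?thesis
    by (rule cart_cancel) (use r assms(1-11) in simp_all)
qed

end

context gluing_data
begin

text \<open>The cocycle condition lives on an iterated fiber product, formed asymmetrically from
  \<open>f \<cdot> pr1 C f g\<close> and \<open>h\<close>. The last claim gives the symmetric form
  used afterwards: arrows to the three sources with a common composite factor through it.\<close>

lemma triple:
  assumes "f \<in> R" "g \<in> R" "h \<in> R"
  defines "w \<equiv> pr1 C (f \<cdot>\<^bsub>C\<^esub> pr1 C f g) h" and "r \<equiv> pr2 C (f \<cdot>\<^bsub>C\<^esub> pr1 C f g) h"
  defines "s \<equiv> pr1 C f g \<cdot>\<^bsub>C\<^esub> w" and "t \<equiv> pr2 C f g \<cdot>\<^bsub>C\<^esub> w"
  shows "r \<in> Arr C" "s \<in> Arr C" "t \<in> Arr C" "Dom C s = Dom C r" "Dom C t = Dom C r"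
    "Cod C s = Dom C f" "Cod C t = Dom C g" "Cod C r = Dom C h" "f \<cdot>\<^bsub>C\<^esub> s = h \<cdot>\<^bsub>C\<^esub> r" "g \<cdot>\<^bsub>C\<^esub> t = h \<cdot>\<^bsub>C\<^esub> r"
    "\<And>s' t' r'. s' \<in> Arr C \<Longrightarrow> t' \<in> Arr C \<Longrightarrow> r' \<in> Arr C \<Longrightarrow> Dom C s' = Dom C r' \<Longrightarrow> Dom C t' = Dom C r' \<Longrightarrow>
       Cod C s' = Dom C f \<Longrightarrow> Cod C t' = Dom C g \<Longrightarrow> Cod C r' = Dom C h \<Longrightarrow>
       f \<cdot>\<^bsub>C\<^esub> s' = h \<cdot>\<^bsub>C\<^esub> r' \<Longrightarrow> g \<cdot>\<^bsub>C\<^esub> t' = h \<cdot>\<^bsub>C\<^esub> r' \<Longrightarrow>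
       \<exists>m \<in> Arr C. Dom C m = Dom C r' \<and> Cod C m = Dom C r \<and> s \<cdot>\<^bsub>C\<^esub> m = s' \<and> t \<cdot>\<^bsub>C\<^esub> m = t' \<and> r \<cdot>\<^bsub>C\<^esub> m = r'"
proof -
  have p: "is_pullback C (f \<cdot>\<^bsub>C\<^esub> pr1 C f g) h w r"
    unfolding w_def r_def by (rule pullback) (use assms(1-3) in simp_all)
  have wr: "w \<in> Arr C" "r \<in> Arr C" "Dom C r = Dom C w" "Cod C w = Dom C (pr1 C f g)" "Cod C r = Dom C h"
    "f \<cdot>\<^bsub>C\<^esub> pr1 C f g \<cdot>\<^bsub>C\<^esub> w = h \<cdot>\<^bsub>C\<^esub> r"
    using C.pullback_arr[OF p] assms(1-3) by simp_all
  show r: "r \<in> Arr C" "s \<in> Arr C" "t \<in> Arr C" "Dom C s = Dom C r" "Dom C t = Dom C r"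
    "Cod C s = Dom C f" "Cod C t = Dom C g" "Cod C r = Dom C h"
    using wr(1-5) assms(1-3) by (simp_all add: s_def t_def)
  show fs: "f \<cdot>\<^bsub>C\<^esub> s = h \<cdot>\<^bsub>C\<^esub> r"
    using wr assms(1-3) by (simp add: s_def)
  show gt: "g \<cdot>\<^bsub>C\<^esub> t = h \<cdot>\<^bsub>C\<^esub> r"
    unfolding fs[symmetric] s_def t_def
    by (rule sym, rule C.comp_eq_precomp[OF pr_square]) (use wr assms(1-3) in simp_all)
  fix s' t' r'
  assume s': "s' \<in> Arr C" "Dom C s' = Dom C r'" "Cod C s' = Dom C f" "f \<cdot>\<^bsub>C\<^esub> s' = h \<cdot>\<^bsub>C\<^esub> r'"
    and t': "t' \<in> Arr C" "Dom C t' = Dom C r'" "Cod C t' = Dom C g" "g \<cdot>\<^bsub>C\<^esub> t' = h \<cdot>\<^bsub>C\<^esub> r'"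
    and r': "r' \<in> Arr C" "Cod C r' = Dom C h"
  define n where "n = fpair C f g s' t'"
  have n: "n \<in> Arr C" "Dom C n = Dom C r'" "Cod C n = Dom C (pr1 C f g)" "pr1 C f g \<cdot>\<^bsub>C\<^esub> n = s'"
    "pr2 C f g \<cdot>\<^bsub>C\<^esub> n = t'"
    using C.fpair[OF pullback, of f g s' t'] assms(1-3) s' t' by (simp_all add: n_def)
  have "f \<cdot>\<^bsub>C\<^esub> pr1 C f g \<cdot>\<^bsub>C\<^esub> n = h \<cdot>\<^bsub>C\<^esub> r'"
    using n(1-4) s' assms(1-3) by simp
  then obtain m where m: "m \<in> Arr C" "Dom C m = Dom C r'" "Cod C m = Dom C w" "w \<cdot>\<^bsub>C\<^esub> m = n" "r \<cdot>\<^bsub>C\<^esub> m = r'"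
    using C.pullback_univ[OF p, of n r'] n r' assms(1-3) by auto
  have "s \<cdot>\<^bsub>C\<^esub> m = s'" "t \<cdot>\<^bsub>C\<^esub> m = t'"
    using m wr(1-5) n assms(1-3) by (simp_all add: s_def t_def)
  with m wr(3) show "\<exists>m \<in> Arr C. Dom C m = Dom C r' \<and> Cod C m = Dom C r \<and> s \<cdot>\<^bsub>C\<^esub> m = s' \<and> t \<cdot>\<^bsub>C\<^esub> m = t' \<and> r \<cdot>\<^bsub>C\<^esub> m = r'"
    by auto
qed

text \<open>Normalisation and cocycle condition are the relation axioms at universal arrows, namely
  at chosen lifts over the diagonal and over the triple fiber product. Every other instance arises
  from these by precomposition, since arrows into \<open>Y f\<close> factor through cartesian
  lifts.\<close>

lemma descent_datum_iff:
  "descent_datum D C F R Y \<phi> \<longleftrightarrow> descent_relation D C F R (\<lambda>f. f) Y datum_rel"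
proof
  assume datum: "descent_datum D C F R Y \<phi>"
  show "descent_relation D C F R (\<lambda>f. f) Y datum_rel"
  proof
    show "datum_rel f f a a" if f: "f \<in> R" and a: "a \<in> Arr D" "Cod D a = Y f" for f a
    proof -
      let ?i = "Ident C (Dom C f)"
      have i: "?i \<in> Arr C" "Dom C ?i = Dom C f" "Cod C ?i = Dom C f"
        using f by simp_all
      have l: "lift D F ?i (Y f) \<in> Arr D" "Cod D (lift D F ?i (Y f)) = Y f" "AMap F (lift D F ?i (Y f)) = ?i"
        "Dom D (lift D F ?i (Y f)) = pb D F ?i (Y f)" "OMap F (pb D F ?i (Y f)) = Dom C f"
        using i f by simp_all
      have "restr_datum D C F Y \<phi> f f ?i ?i = Ident D (pb D F ?i (Y f))"
        using datum f unfolding descent_datum_def Let_def by blast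
      then have "datum_rel f f (lift D F ?i (Y f)) (lift D F ?i (Y f))"
        using restr_datum(5)[of f f ?i ?i] f l by simp
      moreover obtain b where "b \<in> Arr D" "Cod D b = pb D F ?i (Y f)" "lift D F ?i (Y f) \<cdot> b = a"
        by (rule cart_ex[of a "lift D F ?i (Y f)" "AMap F a"]) (use l a f in auto)
      ultimately show ?thesis
        using datum_rel_precomp[OF f f, of _ _ b] l by metis
    qed
    show "datum_rel h f a c"
      if h: "h \<in> R" and g: "g \<in> R" and f: "f \<in> R" and ab: "datum_rel h g a b" and bc: "datum_rel g f b c"
      for h g f a b c
    proof -
      define w where "w = pr1 C (f \<cdot>\<^bsub>C\<^esub> pr1 C f g) h"
      define r where "r = pr2 C (f \<cdot>\<^bsub>C\<^esub> pr1 C f g) h"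
      define s where "s = pr1 C f g \<cdot>\<^bsub>C\<^esub> w"
      define t where "t = pr2 C f g \<cdot>\<^bsub>C\<^esub> w"
      note triple = triple[OF f g h, folded w_def r_def, folded s_def t_def]
      define x where "x = restr_datum D C F Y \<phi> g h r t"
      define y where "y = restr_datum D C F Y \<phi> f g t s"
      define z where "z = restr_datum D C F Y \<phi> f h r s"
      have x: "x \<in> Arr D" "Dom D x = pb D F r (Y h)" "Cod D x = pb D F t (Y g)" "AMap F x = Ident C (Dom C r)"
        "datum_rel h g (lift D F r (Y h)) (lift D F t (Y g) \<cdot> x)"
        using restr_datum[of h g r t] triple(1-10) f g h by (simp_all add: x_def)
      have y: "y \<in> Arr D" "Dom D y = pb D F t (Y g)" "Cod D y = pb D F s (Y f)" "AMap F y = Ident C (Dom C r)"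
        "datum_rel g f (lift D F t (Y g)) (lift D F s (Y f) \<cdot> y)"
        using restr_datum[of g f t s] triple(1-10) f g h by (simp_all add: y_def)
      have z: "z \<in> Arr D" "Dom D z = pb D F r (Y h)" "Cod D z = pb D F s (Y f)" "AMap F z = Ident C (Dom C r)"
        "datum_rel h f (lift D F r (Y h)) (lift D F s (Y f) \<cdot> z)"
        using restr_datum[of h f r s] triple(1-10) f g h by (simp_all add: z_def)
      have yx: "y \<cdot> x = z"
        using datum f g h unfolding descent_datum_def Let_def x_def y_def z_def w_def r_def s_def t_def by blast
      have lr: "lift D F r (Y h) \<in> Arr D" "Dom D (lift D F r (Y h)) = pb D F r (Y h)"
        "Cod D (lift D F r (Y h)) = Y h" "AMap F (lift D F r (Y h)) = r" "OMap F (pb D F r (Y h)) = Dom C r"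
        using triple(1-10) h by simp_all
      have lt: "lift D F t (Y g) \<in> Arr D" "Dom D (lift D F t (Y g)) = pb D F t (Y g)"
        "AMap F (lift D F t (Y g)) = t" "OMap F (pb D F t (Y g)) = Dom C r"
        using triple(1-10) g by simp_all
      have ls: "lift D F s (Y f) \<in> Arr D" "Dom D (lift D F s (Y f)) = pb D F s (Y f)"
        "AMap F (lift D F s (Y f)) = s" "OMap F (pb D F s (Y f)) = Dom C r"
        using triple(1-10) f by simp_all
      have abc: "a \<in> Arr D" "b \<in> Arr D" "c \<in> Arr D" "Dom D b = Dom D a" "Dom D c = Dom D a"
        "Cod D a = Y h" "Cod D b = Y g" "Cod D c = Y f" "h \<cdot>\<^bsub>C\<^esub> AMap F a = g \<cdot>\<^bsub>C\<^esub> AMap F b"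
        "g \<cdot>\<^bsub>C\<^esub> AMap F b = f \<cdot>\<^bsub>C\<^esub> AMap F c"
        using datum_rel_arr[OF h g ab] datum_rel_arr[OF g f bc] by auto
      \<comment> \<open>The images of \<open>a\<close>, \<open>b\<close> and \<open>c\<close> define
        one arrow \<open>m\<close> into the triple fiber product. Lifting it to \<open>a1\<close>
        makes \<open>a\<close> a restriction of the universal arrow; uniqueness of partners then
        computes \<open>b\<close> and \<open>c\<close>.\<close>
      obtain m where m: "m \<in> Arr C" "Dom C m = OMap F (Dom D a)" "Cod C m = Dom C r"
        "s \<cdot>\<^bsub>C\<^esub> m = AMap F c" "t \<cdot>\<^bsub>C\<^esub> m = AMap F b" "r \<cdot>\<^bsub>C\<^esub> m = AMap F a"
        using triple(11)[of "AMap F c" "AMap F b" "AMap F a"] abc f g h by auto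
      obtain a1 where a1: "a1 \<in> Arr D" "Dom D a1 = Dom D a" "Cod D a1 = pb D F r (Y h)"
        "lift D F r (Y h) \<cdot> a1 = a" "AMap F a1 = m"
        by (rule cart_ex[of a "lift D F r (Y h)" m]) (use abc lr m in auto)
      have "datum_rel h g a (lift D F t (Y g) \<cdot> x \<cdot> a1)"
        using datum_rel_precomp[OF h g x(5), of a1] a1 lr by simp
      then have b: "b = lift D F t (Y g) \<cdot> (x \<cdot> a1)"
        using datum_rel_unique[OF h g ab] a1 x lt m by simp
      have "datum_rel g f b (lift D F s (Y f) \<cdot> y \<cdot> (x \<cdot> a1))"
        using datum_rel_precomp[OF g f y(5), of "x \<cdot> a1"] a1 x lt by (simp add: b)
      then have c: "c = lift D F s (Y f) \<cdot> (y \<cdot> (x \<cdot> a1))"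
        using datum_rel_unique[OF g f bc] a1 x y ls m by simp
      have "c = lift D F s (Y f) \<cdot> z \<cdot> a1"
        unfolding c yx[symmetric] using x y z ls a1 by simp
      then show ?thesis
        using datum_rel_precomp[OF h f z(5), of a1] a1 lr by simp
    qed
  qed (use datum_rel_arr datum_rel_precomp datum_rel_ex datum_rel_unique in auto)
next
  assume "descent_relation D C F R (\<lambda>f. f) Y datum_rel"
  then interpret descent_relation D C F R "\<lambda>f. f" Y datum_rel .
  show "descent_datum D C F R Y \<phi>"
    unfolding descent_datum_def Let_def
  proof (intro conjI ballI)
    show "Y f \<in> Obj (fiber D C F (Dom C f))" if "f \<in> R" for f
      using that by (simp add: fiber_def)
    show "\<phi> g f \<in> isos (fiber D C F (Dom C (pr1 C f g))) (pb D F (pr1 C f g) (Y f)) (pb D F (pr2 C f g) (Y g))"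
      if "f \<in> R" "g \<in> R" for f g
      using that by (simp add: isos_fiber)
    show "restr_datum D C F Y \<phi> f f (Ident C (Dom C f)) (Ident C (Dom C f)) =
      Ident D (pb D F (Ident C (Dom C f)) (Y f))" if "f \<in> R" for f
      by (rule restr_datum_eqI) (use that rel_refl in simp_all)
    fix f g h assume f: "f \<in> R" and g: "g \<in> R" and h: "h \<in> R"
    define w where "w = pr1 C (f \<cdot>\<^bsub>C\<^esub> pr1 C f g) h"
    define r where "r = pr2 C (f \<cdot>\<^bsub>C\<^esub> pr1 C f g) h"
    define s where "s = pr1 C f g \<cdot>\<^bsub>C\<^esub> w"
    define t where "t = pr2 C f g \<cdot>\<^bsub>C\<^esub> w"
    note triple = triple[OF f g h, folded w_def r_def, folded s_def t_def]
    define x where "x = restr_datum D C F Y \<phi> g h r t"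
    define y where "y = restr_datum D C F Y \<phi> f g t s"
    have x: "x \<in> Arr D" "Dom D x = pb D F r (Y h)" "Cod D x = pb D F t (Y g)" "AMap F x = Ident C (Dom C r)"
      "datum_rel h g (lift D F r (Y h)) (lift D F t (Y g) \<cdot> x)"
      using restr_datum[of h g r t] triple(1-10) f g h by (simp_all add: x_def)
    have y: "y \<in> Arr D" "Dom D y = pb D F t (Y g)" "Cod D y = pb D F s (Y f)" "AMap F y = Ident C (Dom C r)"
      "datum_rel g f (lift D F t (Y g)) (lift D F s (Y f) \<cdot> y)"
      using restr_datum[of g f t s] triple(1-10) f g h by (simp_all add: y_def)
    have lt: "lift D F t (Y g) \<in> Arr D" "Dom D (lift D F t (Y g)) = pb D F t (Y g)"
      "lift D F s (Y f) \<in> Arr D" "Dom D (lift D F s (Y f)) = pb D F s (Y f)"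
      using triple(1-10) f g by simp_all
    have "datum_rel g f (lift D F t (Y g) \<cdot> x) (lift D F s (Y f) \<cdot> (y \<cdot> x))"
      using datum_rel_precomp[OF g f y(5) x(1)] lt x y by simp
    then have "datum_rel h f (lift D F r (Y h)) (lift D F s (Y f) \<cdot> (y \<cdot> x))"
      using rel_trans[OF h g f x(5)] by blast
    then have "restr_datum D C F Y \<phi> f h r s = y \<cdot> x"
      by - (rule restr_datum_eqI, use f h x y triple(1-10) in simp_all)
    then show "restr_datum D C F Y \<phi> f g (pr2 C f g \<cdot>\<^bsub>C\<^esub> pr1 C (f \<cdot>\<^bsub>C\<^esub> pr1 C f g) h)
         (pr1 C f g \<cdot>\<^bsub>C\<^esub> pr1 C (f \<cdot>\<^bsub>C\<^esub> pr1 C f g) h) \<cdot>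
        restr_datum D C F Y \<phi> g h (pr2 C (f \<cdot>\<^bsub>C\<^esub> pr1 C f g) h) (pr2 C f g \<cdot>\<^bsub>C\<^esub> pr1 C (f \<cdot>\<^bsub>C\<^esub> pr1 C f g) h) =
        restr_datum D C F Y \<phi> f h (pr2 C (f \<cdot>\<^bsub>C\<^esub> pr1 C f g) h) (pr1 C f g \<cdot>\<^bsub>C\<^esub> pr1 C (f \<cdot>\<^bsub>C\<^esub> pr1 C f g) h)"
      unfolding x_def y_def s_def t_def r_def w_def by (rule sym)
  qed
qed

text \<open>An arrow \<open>a'\<close> that witnesses the relation has an image whose composites
  with the two projections are the projections themselves, so it lies over an identity. It must
  therefore be the base change of \<open>\<psi> f\<close>.\<close>

lemma effective_square_iff:
  assumes Z: "Z \<in> Obj D" "OMap F Z = X" and f: "f \<in> R" and g: "g \<in> R"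
    and \<psi>f: "\<psi> f \<in> Arr D" "Dom D (\<psi> f) = pb D F f Z" "Cod D (\<psi> f) = Y f" "AMap F (\<psi> f) = Ident C (Dom C f)"
    and \<psi>g: "\<psi> g \<in> Arr D" "Dom D (\<psi> g) = pb D F g Z" "Cod D (\<psi> g) = Y g" "AMap F (\<psi> g) = Ident C (Dom C g)"
  shows "base_change D C F (canon D C F g (pr2 C f g) Z) (lift D F (pr2 C f g) (Y g)) (\<psi> g)
           = \<phi> g f \<cdot> base_change D C F
               (canon D C F f (pr1 C f g) Z) (lift D F (pr1 C f g) (Y f)) (\<psi> f) \<longleftrightarrow>
     datum_rel f g (\<psi> f \<cdot> canon D C F f (pr1 C f g) Z) (\<psi> g \<cdot> canon D C F g (pr2 C f g) Z)"
    (is "?vg = \<phi> g f \<cdot> ?vf \<longleftrightarrow> datum_rel f g (\<psi> f \<cdot> ?cf) (\<psi> g \<cdot> ?cg)")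
proof -
  let ?lf = "lift D F (pr1 C f g) (Y f)" and ?lg = "lift D F (pr2 C f g) (Y g)"
  have l: "?lf \<in> Arr D" "Dom D ?lf = pb D F (pr1 C f g) (Y f)" "Cod D ?lf = Y f" "AMap F ?lf = pr1 C f g"
    "?lg \<in> Arr D" "Dom D ?lg = pb D F (pr2 C f g) (Y g)" "Cod D ?lg = Y g" "AMap F ?lg = pr2 C f g"
    using f g by simp_all
  have c: "?cf \<in> Arr D" "Cod D ?cf = pb D F f Z" "AMap F ?cf = pr1 C f g" "OMap F (Dom D ?cf) = Dom C (pr1 C f g)"
    "?cg \<in> Arr D" "Cod D ?cg = pb D F g Z" "AMap F ?cg = pr2 C f g" "OMap F (Dom D ?cg) = Dom C (pr1 C f g)"
    "OMap F (pb D F f Z) = Dom C f" "OMap F (pb D F g Z) = Dom C g"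
    using f g Z by simp_all
  have vf: "?vf \<in> Arr D" "Dom D ?vf = Dom D ?cf" "Cod D ?vf = pb D F (pr1 C f g) (Y f)"
    "AMap F ?vf = Ident C (Dom C (pr1 C f g))" "?lf \<cdot> ?vf = \<psi> f \<cdot> ?cf"
    using base_change[of ?cf ?lf "\<psi> f"] c l \<psi>f by simp_all
  have vg: "?vg \<in> Arr D" "Dom D ?vg = Dom D ?cg" "Cod D ?vg = pb D F (pr2 C f g) (Y g)"
    "AMap F ?vg = Ident C (Dom C (pr1 C f g))" "?lg \<cdot> ?vg = \<psi> g \<cdot> ?cg"
    using base_change[of ?cg ?lg "\<psi> g"] c l \<psi>g by simp_all
  show ?thesis
  proof
    assume "?vg = \<phi> g f \<cdot> ?vf"
    then show "datum_rel f g (\<psi> f \<cdot> ?cf) (\<psi> g \<cdot> ?cg)"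
      using vf vg by (metis datum_relI)
  next
    assume "datum_rel f g (\<psi> f \<cdot> ?cf) (\<psi> g \<cdot> ?cg)"
    then obtain a' where a': "a' \<in> Arr D" "Cod D a' = pb D F (pr1 C f g) (Y f)" "Dom D a' = Dom D (\<psi> f \<cdot> ?cf)"
      "\<psi> f \<cdot> ?cf = ?lf \<cdot> a'" "\<psi> g \<cdot> ?cg = ?lg \<cdot> (\<phi> g f \<cdot> a')"
      "AMap F (\<psi> f \<cdot> ?cf) = pr1 C f g \<cdot>\<^bsub>C\<^esub> AMap F a'" "AMap F (\<psi> g \<cdot> ?cg) = pr2 C f g \<cdot>\<^bsub>C\<^esub> AMap F a'"
      using datum_relE[OF _ f g] by metis
    have Fa: "AMap F a' = Ident C (Dom C (pr1 C f g))"
      by (rule C.pullback_unique[OF pullback[of f g]])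
        (use f g a'(1,2,6,7) \<psi>f \<psi>g c in simp_all)
    have "?vf = a'"
      by (rule cart_cancel[of ?lf]) (use vf a'(1,2,4) Fa l in simp_all)
    moreover have "?vg = \<phi> g f \<cdot> a'"
      by (rule cart_cancel[of ?lg]) (use vg a'(1,2,5) Fa l f g in simp_all)
    ultimately show "?vg = \<phi> g f \<cdot> ?vf"
      by simp
  qed
qed

text \<open>The families \<open>c\<close> and \<open>\<psi>\<close> determine each other through
  \<open>c f \<cdot> \<psi> f = lift D F f Z\<close>: one direction inverts \<open>\<psi> f\<close>,
  the other factors the lift through \<open>c f\<close>.\<close>

lemma effective_iff:
  "effective D C F X R Y \<phi> \<longleftrightarrow> (\<exists>Z c. OMap F Z = X \<and> glued_by D F R (\<lambda>f. f) Y datum_rel Z c)"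
proof
  assume "effective D C F X R Y \<phi>"
  then obtain Z \<psi> where Z: "Z \<in> Obj (fiber D C F X)"
    and \<psi>: "\<And>f. f \<in> R \<Longrightarrow> \<psi> f \<in> isos (fiber D C F (Dom C f)) (pb D F f Z) (Y f)"
    and sq: "\<And>f g. f \<in> R \<Longrightarrow> g \<in> R \<Longrightarrow> base_change D C F
             (canon D C F g (pr2 C f g) Z) (lift D F (pr2 C f g) (Y g)) (\<psi> g)
           = \<phi> g f \<cdot> base_change D C F
               (canon D C F f (pr1 C f g) Z) (lift D F (pr1 C f g) (Y f)) (\<psi> f)"
    unfolding effective_def by blast
  have Z: "Z \<in> Obj D" "OMap F Z = X"
    using Z by (auto simp: fiber_def)
  have \<psi>: "\<psi> f \<in> Arr D" "Dom D (\<psi> f) = pb D F f Z" "Cod D (\<psi> f) = Y f" "AMap F (\<psi> f) = Ident C (Dom C f)"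
    if "f \<in> R" for f
    using \<psi>[OF that] by (simp_all add: isos_fiber)
  have lZ: "lift D F f Z \<in> Arr D" "Dom D (lift D F f Z) = pb D F f Z" "Cod D (lift D F f Z) = Z"
    "AMap F (lift D F f Z) = f" "OMap F (pb D F f Z) = Dom C f" if "f \<in> R" for f
    using that Z by simp_all
  have "\<exists>c. \<forall>f \<in> R. c f \<in> Arr D \<and> Dom D (c f) = Y f \<and> Cod D (c f) = Z \<and> AMap F (c f) = f \<and>
      c f \<cdot> \<psi> f = lift D F f Z" (is "\<exists>c. \<forall>f \<in> R. ?c f (c f)")
  proof (rule bchoice, intro ballI)
    fix f assume f: "f \<in> R"
    obtain k where k: "k \<in> Arr D" "Dom D k = Y f" "Cod D k = pb D F f Z" "AMap F k = Ident C (Dom C f)"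
      "k \<cdot> \<psi> f = Ident D (pb D F f Z)"
      by (rule vertical_inverse[of "\<psi> f" "Dom C f"]) (use \<psi>[OF f] lZ[OF f] f in simp_all)
    have "?c f (lift D F f Z \<cdot> k)"
      using k lZ[OF f] \<psi>[OF f] f by simp
    then show "\<exists>c. ?c f c" ..
  qed
  then obtain c where c: "\<And>f. f \<in> R \<Longrightarrow> c f \<in> Arr D" "\<And>f. f \<in> R \<Longrightarrow> Dom D (c f) = Y f"
    "\<And>f. f \<in> R \<Longrightarrow> Cod D (c f) = Z" "\<And>f. f \<in> R \<Longrightarrow> AMap F (c f) = f"
    "\<And>f. f \<in> R \<Longrightarrow> c f \<cdot> \<psi> f = lift D F f Z"
    by blast
  have "c f \<cdot> a = c g \<cdot> b" if f: "f \<in> R" and g: "g \<in> R" and ab: "datum_rel f g a b" for f g a b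
  proof -
    let ?lf = "lift D F (pr1 C f g) (Y f)" and ?lg = "lift D F (pr2 C f g) (Y g)"
    let ?cf = "canon D C F f (pr1 C f g) Z" and ?cg = "canon D C F g (pr2 C f g) Z"
    define v where "v = base_change D C F ?cf ?lf (\<psi> f)"
    have l: "?lf \<in> Arr D" "Dom D ?lf = pb D F (pr1 C f g) (Y f)" "Cod D ?lf = Y f" "AMap F ?lf = pr1 C f g"
      "?lg \<in> Arr D" "Dom D ?lg = pb D F (pr2 C f g) (Y g)" "Cod D ?lg = Y g" "AMap F ?lg = pr2 C f g"
      "OMap F (pb D F (pr1 C f g) (Y f)) = Dom C (pr1 C f g)"
      using f g by simp_all
    have cn: "?cf \<in> Arr D" "Cod D ?cf = pb D F f Z" "AMap F ?cf = pr1 C f g" "OMap F (Dom D ?cf) = Dom C (pr1 C f g)"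
      "?cg \<in> Arr D" "Cod D ?cg = pb D F g Z" "AMap F ?cg = pr2 C f g" "OMap F (Dom D ?cg) = Dom C (pr1 C f g)"
      "lift D F f Z \<cdot> ?cf = lift D F (f \<cdot>\<^bsub>C\<^esub> pr1 C f g) Z" "lift D F g Z \<cdot> ?cg = lift D F (f \<cdot>\<^bsub>C\<^esub> pr1 C f g) Z"
      using f g Z pr_square[OF f g] by simp_all
    have v: "v \<in> Arr D" "Cod D v = pb D F (pr1 C f g) (Y f)" "OMap F (Dom D v) = Dom C (pr1 C f g)"
      "AMap F v = Ident C (Dom C (pr1 C f g))" "?lf \<cdot> v = \<psi> f \<cdot> ?cf"
      using base_change[of ?cf ?lf "\<psi> f"] cn l \<psi>[OF f] lZ[OF f] unfolding v_def by simp_all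
    have vg: "?lg \<cdot> (\<phi> g f \<cdot> v) = \<psi> g \<cdot> ?cg"
      using base_change(5)[of ?cg ?lg "\<psi> g"] cn l \<psi>[OF g] lZ[OF g] unfolding sq[OF f g] v_def by simp
    have "c f \<cdot> (?lf \<cdot> v) = c g \<cdot> (?lg \<cdot> (\<phi> g f \<cdot> v))"
      unfolding vg v(5)
      using D.comp_eq_precomp1[OF c(5)[OF f], of ?cf] D.comp_eq_precomp1[OF c(5)[OF g], of ?cg]
        cn c f g \<psi>[OF f] \<psi>[OF g] by simp
    moreover have "c f \<cdot> ?lf \<cdot> v = c f \<cdot> (?lf \<cdot> v)"
      by (rule D.comp_assoc) (use c[OF f] l v in simp_all)
    moreover have "c g \<cdot> (?lg \<cdot> \<phi> g f) \<cdot> v = c g \<cdot> (?lg \<cdot> (\<phi> g f \<cdot> v))"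
      using c[OF g] l v(1-4) f g by simp
    ultimately have "c f \<cdot> ?lf \<cdot> v = c g \<cdot> (?lg \<cdot> \<phi> g f) \<cdot> v"
      by simp
    \<comment> \<open>The square gives the equation only after precomposition with \<open>v\<close>.
      As \<open>v\<close> lies over an identity it can be cancelled, and the equation then holds for
      every \<open>a'\<close>.\<close>
    then have *: "c f \<cdot> ?lf = c g \<cdot> (?lg \<cdot> \<phi> g f)"
      by (rule vertical_cancel) (use v l c[OF f] c[OF g] f g in simp_all)
    obtain a' where a': "a' \<in> Arr D" "Cod D a' = pb D F (pr1 C f g) (Y f)" "a = ?lf \<cdot> a'"
        "b = ?lg \<cdot> (\<phi> g f \<cdot> a')"
      using datum_relE[OF ab f g] by metis
    show ?thesis
      unfolding a'(3,4) using D.comp_eq_precomp[OF *, of a'] a'(1,2) l c[OF f] c[OF g] f g by simp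
  qed
  then have "glued_by D F R (\<lambda>f. f) Y datum_rel Z c"
    using Z c unfolding glued_by_def by auto
  with Z show "\<exists>Z c. OMap F Z = X \<and> glued_by D F R (\<lambda>f. f) Y datum_rel Z c"
    by blast
next
  assume "\<exists>Z c. OMap F Z = X \<and> glued_by D F R (\<lambda>f. f) Y datum_rel Z c"
  then obtain Z c where Z: "Z \<in> Obj D" "OMap F Z = X" and "glued_by D F R (\<lambda>f. f) Y datum_rel Z c"
    unfolding glued_by_def by blast
  then have c: "\<And>f. f \<in> R \<Longrightarrow> c f \<in> Arr D" "\<And>f. f \<in> R \<Longrightarrow> Dom D (c f) = Y f"
    "\<And>f. f \<in> R \<Longrightarrow> Cod D (c f) = Z" "\<And>f. f \<in> R \<Longrightarrow> AMap F (c f) = f"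
    and glue: "\<And>f g a b. f \<in> R \<Longrightarrow> g \<in> R \<Longrightarrow> datum_rel f g a b \<Longrightarrow> c f \<cdot> a = c g \<cdot> b"
    unfolding glued_by_def by auto
  have lZ: "lift D F f Z \<in> Arr D" "Dom D (lift D F f Z) = pb D F f Z" "Cod D (lift D F f Z) = Z"
    "AMap F (lift D F f Z) = f" "OMap F (pb D F f Z) = Dom C f" if "f \<in> R" for f
    using that Z by simp_all
  define \<psi> where "\<psi> f = cart_fact D F (c f) (Ident C (Dom C f)) (lift D F f Z)" for f
  have \<psi>: "\<psi> f \<in> Arr D" "Dom D (\<psi> f) = pb D F f Z" "Cod D (\<psi> f) = Y f" "AMap F (\<psi> f) = Ident C (Dom C f)"
    "c f \<cdot> \<psi> f = lift D F f Z" if "f \<in> R" for f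
    using cart_fact[of "lift D F f Z" "c f" "Ident C (Dom C f)"] lZ[OF that] c that by (simp_all add: \<psi>_def)
  have "datum_rel f g (\<psi> f \<cdot> canon D C F f (pr1 C f g) Z) (\<psi> g \<cdot> canon D C F g (pr2 C f g) Z)"
    if f: "f \<in> R" and g: "g \<in> R" for f g
  proof -
    let ?cf = "canon D C F f (pr1 C f g) Z" and ?cg = "canon D C F g (pr2 C f g) Z"
    have cn: "?cf \<in> Arr D" "Cod D ?cf = pb D F f Z" "AMap F ?cf = pr1 C f g" "Dom D ?cf = pb D F (f \<cdot>\<^bsub>C\<^esub> pr1 C f g) Z"
      "?cg \<in> Arr D" "Cod D ?cg = pb D F g Z" "AMap F ?cg = pr2 C f g" "Dom D ?cg = pb D F (f \<cdot>\<^bsub>C\<^esub> pr1 C f g) Z"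
      "lift D F f Z \<cdot> ?cf = lift D F (f \<cdot>\<^bsub>C\<^esub> pr1 C f g) Z" "lift D F g Z \<cdot> ?cg = lift D F (f \<cdot>\<^bsub>C\<^esub> pr1 C f g) Z"
      "OMap F (pb D F (f \<cdot>\<^bsub>C\<^esub> pr1 C f g) Z) = Dom C (pr1 C f g)"
      using f g Z pr_square[OF f g] by simp_all
    \<comment> \<open>The partner \<open>b\<close> of the first arrow has the same composite with
      \<open>c g\<close> as the second arrow has. Cancelling the cartesian arrow \<open>c g\<close>
      identifies the two.\<close>
    have "\<exists>b. datum_rel f g (\<psi> f \<cdot> ?cf) b \<and> AMap F b = pr2 C f g"
      by (rule datum_rel_ex) (use f g \<psi>[OF f] cn pr_square[OF f g] in simp_all)
    then obtain b where b: "datum_rel f g (\<psi> f \<cdot> ?cf) b" "AMap F b = pr2 C f g"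
      by blast
    note ba = datum_rel_arr[OF f g b(1)]
    have "c g \<cdot> b = c f \<cdot> (\<psi> f \<cdot> ?cf)"
      using glue[OF f g b(1)] by simp
    also have "\<dots> = c g \<cdot> (\<psi> g \<cdot> ?cg)"
      using D.comp_eq_precomp1[OF \<psi>(5)[OF f], of ?cf] D.comp_eq_precomp1[OF \<psi>(5)[OF g], of ?cg]
        cn c f g \<psi>[OF f] \<psi>[OF g] by simp
    finally have "b = \<psi> g \<cdot> ?cg"
      by (rule cart_cancel) (use ba b(2) c f g \<psi>[OF g] cn in simp_all)
    with b(1) show ?thesis
      by simp
  qed
  then have "\<forall>f \<in> R. \<forall>g \<in> R. base_change D C F
             (canon D C F g (pr2 C f g) Z) (lift D F (pr2 C f g) (Y g)) (\<psi> g)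
           = \<phi> g f \<cdot> base_change D C F
               (canon D C F f (pr1 C f g) Z) (lift D F (pr1 C f g) (Y f)) (\<psi> f)"
    using effective_square_iff[OF Z] \<psi> by simp
  moreover have "\<forall>f \<in> R. \<psi> f \<in> isos (fiber D C F (Dom C f)) (pb D F f Z) (Y f)"
    using \<psi> lZ by (simp add: isos_fiber)
  moreover have "Z \<in> Obj (fiber D C F X)"
    using Z by (simp add: fiber_def)
  ultimately show "effective D C F X R Y \<phi>"
    unfolding effective_def by blast
qed

end

section \<open>Stacks in terms of gluing\<close>

lemma stack_iff:
  assumes "fibration D C F" "pretopology C J"
  shows "stack D C J F \<longleftrightarrow> arrows_glue D C J F \<and> objects_glue D C J F"
proof -
  interpret fibration D C F by fact
  interpret J: pretopology C J by fact
  have gd: "gluing_data D C F X R Y \<phi>"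
    if X: "X \<in> Obj C" "R \<in> J X" and Y: "\<And>f. f \<in> R \<Longrightarrow> Y f \<in> Obj D" "\<And>f. f \<in> R \<Longrightarrow> OMap F (Y f) = Dom C f"
      and \<phi>: "\<And>f g. f \<in> R \<Longrightarrow> g \<in> R \<Longrightarrow> \<phi> g f \<in> Arr D \<and> Dom D (\<phi> g f) = pb D F (pr1 C f g) (Y f) \<and>
         Cod D (\<phi> g f) = pb D F (pr2 C f g) (Y g) \<and> AMap F (\<phi> g f) = Ident C (Dom C (pr1 C f g))"
    for X R Y \<phi>
  proof
    show "\<exists>p q. is_pullback C g f p q" if "f \<in> R" "g \<in> Arr C" "Cod C g = X" for f g
      using J.cover_pullback[OF X that] .
  qed (use X Y \<phi> J.cover_arr in auto)
  have "objects_glue D C J F" if stack: "stack D C J F"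
    unfolding objects_glue_def
  proof (intro ballI allI impI)
    fix X R Y rel
    assume X: "X \<in> Obj C" "R \<in> J X" and "descent_relation D C F R (\<lambda>f. f) Y rel"
    then interpret R: descent_relation D C F R "\<lambda>f. f" Y rel by simp
    have Ra: "f \<in> Arr C" "Cod C f = X" if "f \<in> R" for f
      using J.cover_arr[OF X that] by auto
    have "is_pullback C f g (pr1 C f g) (pr2 C f g)" if "f \<in> R" "g \<in> R" for f g
      by (rule C.pullback_chosen, rule J.cover_pullback[OF X]) (use that Ra in auto)
    note pr = C.pullback_arr[OF this]
    \<comment> \<open>A datum is read off from an abstract relation at its universal instance:
      \<open>B (f, g)\<close> is the partner of the lift along the first projection, over the second
      projection. Factored through the lift along the second projection it yields
      \<open>\<phi> g f\<close>.\<close>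
    have "\<exists>B. \<forall>fg \<in> R \<times> R. (case fg of (f, g) \<Rightarrow> \<lambda>b.
        rel f g (lift D F (pr1 C f g) (Y f)) b \<and> AMap F b = pr2 C f g) (B fg)"
    proof (rule bchoice, clarify)
      fix f g assume fg: "f \<in> R" "g \<in> R"
      show "\<exists>b. rel f g (lift D F (pr1 C f g) (Y f)) b \<and> AMap F b = pr2 C f g"
        by (rule R.rel_ex) (use fg pr[OF fg] R.Y_obj in simp_all)
    qed
    then obtain B where B: "rel f g (lift D F (pr1 C f g) (Y f)) (B (f, g))" "AMap F (B (f, g)) = pr2 C f g"
      if "f \<in> R" "g \<in> R" for f g
      by fastforce
    define \<phi> where "\<phi> g f = cart_fact D F (lift D F (pr2 C f g) (Y g)) (Ident C (Dom C (pr1 C f g))) (B (f, g))"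
      for f g
    have \<phi>: "\<phi> g f \<in> Arr D" "Dom D (\<phi> g f) = pb D F (pr1 C f g) (Y f)"
      "Cod D (\<phi> g f) = pb D F (pr2 C f g) (Y g)" "AMap F (\<phi> g f) = Ident C (Dom C (pr1 C f g))"
      "lift D F (pr2 C f g) (Y g) \<cdot>\<^bsub>D\<^esub> \<phi> g f = B (f, g)" if fg: "f \<in> R" "g \<in> R" for f g
    proof -
      have lf: "Dom D (lift D F (pr1 C f g) (Y f)) = pb D F (pr1 C f g) (Y f)"
        "OMap F (pb D F (pr1 C f g) (Y f)) = Dom C (pr1 C f g)"
        using fg pr[OF fg] R.Y_obj by simp_all
      have lg: "lift D F (pr2 C f g) (Y g) \<in> Arr D" "Dom D (lift D F (pr2 C f g) (Y g)) = pb D F (pr2 C f g) (Y g)"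
        "Cod D (lift D F (pr2 C f g) (Y g)) = Y g" "AMap F (lift D F (pr2 C f g) (Y g)) = pr2 C f g"
        "OMap F (pb D F (pr2 C f g) (Y g)) = Dom C (pr1 C f g)"
        using fg pr[OF fg] R.Y_obj by simp_all
      have b: "B (f, g) \<in> Arr D" "Dom D (B (f, g)) = pb D F (pr1 C f g) (Y f)" "Cod D (B (f, g)) = Y g"
        using R.rel_arr[OF fg B(1)[OF fg]] lf by simp_all
      show "\<phi> g f \<in> Arr D" "Dom D (\<phi> g f) = pb D F (pr1 C f g) (Y f)"
        "Cod D (\<phi> g f) = pb D F (pr2 C f g) (Y g)" "AMap F (\<phi> g f) = Ident C (Dom C (pr1 C f g))"
        "lift D F (pr2 C f g) (Y g) \<cdot>\<^bsub>D\<^esub> \<phi> g f = B (f, g)"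
        unfolding \<phi>_def
        using cart_fact[of "B (f, g)" "lift D F (pr2 C f g) (Y g)" "Ident C (Dom C (pr1 C f g))"] lf lg b
          B(2)[OF fg] pr[OF fg] by simp_all
    qed
    interpret G: gluing_data D C F X R Y \<phi>
      by (rule gd[OF X]) (use R.Y_obj \<phi> in auto)
    \<comment> \<open>The datum's relation consists of restrictions of the universal pair, all of
      which lie in \<open>rel\<close>. For the converse, a pair in \<open>rel\<close> is compared
      with the datum's partner of \<open>a\<close> over the same base arrow, and uniqueness
      applies.\<close>
    have datum_rel: "G.datum_rel f g a b \<longleftrightarrow> rel f g a b" if fg: "f \<in> R" "g \<in> R" for f g a b
    proof
      let ?lf = "lift D F (pr1 C f g) (Y f)" and ?lg = "lift D F (pr2 C f g) (Y g)"
      have *: "?lg \<cdot>\<^bsub>D\<^esub> (\<phi> g f \<cdot>\<^bsub>D\<^esub> a') = B (f, g) \<cdot>\<^bsub>D\<^esub> a'"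
        if "a' \<in> Arr D" "Cod D a' = pb D F (pr1 C f g) (Y f)" for a'
        by (rule D.comp_eq_precomp1[OF \<phi>(5)[OF fg]]) (use fg that in simp_all)
      show "rel f g a b" if ab: "G.datum_rel f g a b"
      proof -
        obtain a' where a': "a' \<in> Arr D" "Cod D a' = pb D F (pr1 C f g) (Y f)" "a = ?lf \<cdot>\<^bsub>D\<^esub> a'"
          "b = ?lg \<cdot>\<^bsub>D\<^esub> (\<phi> g f \<cdot>\<^bsub>D\<^esub> a')"
          using G.datum_relE[OF ab fg] by metis
        show ?thesis
          unfolding a'(3,4) *[OF a'(1,2)]
          by (rule R.rel_precomp[OF fg B(1)[OF fg]]) (use fg a' in simp_all)
      qed
      show "G.datum_rel f g a b" if ab: "rel f g a b"
      proof -
        note ar = R.rel_arr[OF fg ab]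
        obtain b' where b': "G.datum_rel f g a b'" "AMap F b' = AMap F b"
          using G.datum_rel_ex[OF fg, of a "AMap F b"] ar fg by auto
        obtain a' where a': "a' \<in> Arr D" "Cod D a' = pb D F (pr1 C f g) (Y f)" "a = ?lf \<cdot>\<^bsub>D\<^esub> a'"
          "b' = ?lg \<cdot>\<^bsub>D\<^esub> (\<phi> g f \<cdot>\<^bsub>D\<^esub> a')"
          using G.datum_relE[OF b'(1) fg] by metis
        have "rel f g a b'"
          unfolding a'(3,4) *[OF a'(1,2)]
          by (rule R.rel_precomp[OF fg B(1)[OF fg]]) (use fg a' in simp_all)
        then have "b' = b"
          by (rule R.rel_unique[OF fg _ ab b'(2)])
        with b' show ?thesis
          by simp
      qed
    qed
    have "effective D C F X R Y \<phi>"
      using stack X R.rel_cong[OF datum_rel] unfolding stack_def G.descent_datum_iff[symmetric] by blast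
    then show "\<exists>Z c. OMap F Z = X \<and> glued_by D F R (\<lambda>f. f) Y rel Z c"
      unfolding G.effective_iff glued_by_def using datum_rel by blast
  qed
  moreover have "stack D C J F" if "arrows_glue D C J F" and glue: "objects_glue D C J F"
    unfolding stack_def
  proof (intro conjI ballI allI impI)
    show "prestack D C J F"
      by (rule arrows_glue_prestack) fact
    fix X R Y \<phi>
    assume X: "X \<in> Obj C" "R \<in> J X" and datum: "descent_datum D C F R Y \<phi>"
    interpret G: gluing_data D C F X R Y \<phi>
    proof (rule gd[OF X])
      show "Y f \<in> Obj D" "OMap F (Y f) = Dom C f" if "f \<in> R" for f
        using datum that unfolding descent_datum_def by (auto simp: fiber_def)
      show "\<phi> g f \<in> Arr D \<and> Dom D (\<phi> g f) = pb D F (pr1 C f g) (Y f) \<and>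
         Cod D (\<phi> g f) = pb D F (pr2 C f g) (Y g) \<and> AMap F (\<phi> g f) = Ident C (Dom C (pr1 C f g))"
        if "f \<in> R" "g \<in> R" for f g
        using datum that unfolding descent_datum_def isos_fiber by blast
    qed
    show "effective D C F X R Y \<phi>"
      using glue X datum unfolding objects_glue_def G.effective_iff G.descent_datum_iff by blast
  qed
  moreover have "arrows_glue D C J F" if "stack D C J F"
    using that prestack_arrows_glue unfolding stack_def by blast
  ultimately show ?thesis
    by blast
qed

section \<open>Composites of fibered categories\<close>

text \<open>As \<open>r\<close> may repeat arrows, one index \<open>\<sigma> f\<close> is selected
  for each arrow \<open>f\<close> and the objects at these indices are glued. Any other
  \<open>Y i\<close> is attached through \<open>\<beta> i\<close>, the partner of its identity at
  the selected index, so the gluing arrow is \<open>d (r i)\<close> after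
  \<open>\<beta> i\<close>.\<close>

lemma (in descent_relation) objects_glue_indexed:
  assumes glue: "objects_glue D C J F" and X: "X \<in> Obj C" "r ` I \<in> J X"
  shows "\<exists>Z c. OMap F Z = X \<and> glued_by D F I r Y rel Z c"
proof -
  define \<sigma> where "\<sigma> = inv_into I r"
  have \<sigma>: "\<sigma> f \<in> I" "r (\<sigma> f) = f" if "f \<in> r ` I" for f
    using that by (auto simp: \<sigma>_def inv_into_into f_inv_into_f)
  have "descent_relation D C F (r ` I) (\<lambda>f. f) (\<lambda>f. Y (\<sigma> f)) (\<lambda>f g. rel (\<sigma> f) (\<sigma> g))"
  proof
    show "f \<in> Arr C" "Y (\<sigma> f) \<in> Obj D" "OMap F (Y (\<sigma> f)) = Dom C f" if "f \<in> r ` I" for f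
      using r_arr Y_obj[OF \<sigma>(1)[OF that]] that \<sigma>(2)[OF that] by auto
    show "a \<in> Arr D \<and> b \<in> Arr D \<and> Dom D a = Dom D b \<and> Cod D a = Y (\<sigma> f) \<and> Cod D b = Y (\<sigma> g) \<and>
      f \<cdot>\<^bsub>C\<^esub> AMap F a = g \<cdot>\<^bsub>C\<^esub> AMap F b"
      if "f \<in> r ` I" "g \<in> r ` I" "rel (\<sigma> f) (\<sigma> g) a b" for f g a b
      using rel_arr[OF \<sigma>(1)[OF that(1)] \<sigma>(1)[OF that(2)] that(3)]
      unfolding \<sigma>(2)[OF that(1)] \<sigma>(2)[OF that(2)] .
    show "\<exists>b. rel (\<sigma> f) (\<sigma> g) a b \<and> AMap F b = t"
      if "f \<in> r ` I" "g \<in> r ` I" "a \<in> Arr D" "Cod D a = Y (\<sigma> f)" "t \<in> Arr C"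
        "Dom C t = OMap F (Dom D a)" "Cod C t = Dom C g" "f \<cdot>\<^bsub>C\<^esub> AMap F a = g \<cdot>\<^bsub>C\<^esub> t" for f g a t
      by (rule rel_ex) (use that \<sigma>[OF that(1)] \<sigma>[OF that(2)] in simp_all)
    show "rel (\<sigma> f) (\<sigma> k) a c"
      if "f \<in> r ` I" "g \<in> r ` I" "k \<in> r ` I" "rel (\<sigma> f) (\<sigma> g) a b" "rel (\<sigma> g) (\<sigma> k) b c" for f g k a b c
      by (rule rel_trans[OF \<sigma>(1)[OF that(1)] \<sigma>(1)[OF that(2)] \<sigma>(1)[OF that(3)] that(4,5)])
    show "b = b'"
      if "f \<in> r ` I" "g \<in> r ` I" "rel (\<sigma> f) (\<sigma> g) a b" "rel (\<sigma> f) (\<sigma> g) a b'" "AMap F b = AMap F b'"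
      for f g a b b'
      by (rule rel_unique[OF \<sigma>(1)[OF that(1)] \<sigma>(1)[OF that(2)] that(3-5)])
  qed (auto intro: rel_refl rel_precomp \<sigma>(1))
  then obtain Z d where Z: "OMap F Z = X"
    and "glued_by D F (r ` I) (\<lambda>f. f) (\<lambda>f. Y (\<sigma> f)) (\<lambda>f g. rel (\<sigma> f) (\<sigma> g)) Z d"
    using glue X unfolding objects_glue_def by metis
  then have Z_obj: "Z \<in> Obj D"
    and d: "\<And>i. i \<in> I \<Longrightarrow> d (r i) \<in> Arr D \<and> Dom D (d (r i)) = Y (\<sigma> (r i)) \<and> Cod D (d (r i)) = Z \<and> AMap F (d (r i)) = r i"
    and d_eq: "\<And>i j a b. i \<in> I \<Longrightarrow> j \<in> I \<Longrightarrow> rel (\<sigma> (r i)) (\<sigma> (r j)) a b \<Longrightarrow> d (r i) \<cdot>\<^bsub>D\<^esub> a = d (r j) \<cdot>\<^bsub>D\<^esub> b"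
    unfolding glued_by_def by auto
  have \<sigma>r: "\<sigma> (r i) \<in> I" "r (\<sigma> (r i)) = r i" if "i \<in> I" for i
    using \<sigma>[of "r i"] that by auto
  have "\<exists>\<beta>. \<forall>i \<in> I. rel i (\<sigma> (r i)) (Ident D (Y i)) (\<beta> i) \<and> AMap F (\<beta> i) = Ident C (Dom C (r i))"
    by (rule bchoice, intro ballI, rule rel_ex) (use Y_obj r_arr \<sigma>r in simp_all)
  then obtain \<beta> where \<beta>: "\<And>i. i \<in> I \<Longrightarrow> rel i (\<sigma> (r i)) (Ident D (Y i)) (\<beta> i)"
    and F\<beta>: "\<And>i. i \<in> I \<Longrightarrow> AMap F (\<beta> i) = Ident C (Dom C (r i))"
    by blast
  have \<beta>_arr: "\<beta> i \<in> Arr D" "Dom D (\<beta> i) = Y i" "Cod D (\<beta> i) = Y (\<sigma> (r i))" if "i \<in> I" for i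
    using rel_arr[OF that \<sigma>r(1)[OF that] \<beta>[OF that]] Y_obj[OF that] by auto
  have \<beta>_rel: "rel (\<sigma> (r i)) i (\<beta> i \<cdot>\<^bsub>D\<^esub> a) a" if i: "i \<in> I" and a: "a \<in> Arr D" "Cod D a = Y i" for i a
    using rel_precomp[OF \<sigma>r(1)[OF i] i rel_sym[OF i \<sigma>r(1)[OF i] \<beta>[OF i]], of a] a \<beta>_arr[OF i] by simp
  have "d (r i) \<cdot>\<^bsub>D\<^esub> \<beta> i \<cdot>\<^bsub>D\<^esub> a = d (r j) \<cdot>\<^bsub>D\<^esub> \<beta> j \<cdot>\<^bsub>D\<^esub> b"
    if i: "i \<in> I" and j: "j \<in> I" and ab: "rel i j a b" for i j a b
  proof -
    note ar = rel_arr[OF i j ab]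
    have "rel (\<sigma> (r i)) j (\<beta> i \<cdot>\<^bsub>D\<^esub> a) b"
      by (rule rel_trans[OF \<sigma>r(1)[OF i] i j \<beta>_rel[OF i] ab]) (use ar in auto)
    moreover have "rel j (\<sigma> (r j)) b (\<beta> j \<cdot>\<^bsub>D\<^esub> b)"
      by (rule rel_sym[OF \<sigma>r(1)[OF j] j \<beta>_rel[OF j]]) (use ar in auto)
    ultimately have "rel (\<sigma> (r i)) (\<sigma> (r j)) (\<beta> i \<cdot>\<^bsub>D\<^esub> a) (\<beta> j \<cdot>\<^bsub>D\<^esub> b)"
      by (rule rel_trans[OF \<sigma>r(1)[OF i] j \<sigma>r(1)[OF j]])
    from d_eq[OF i j this] show ?thesis
      using d[OF i] d[OF j] \<beta>_arr[OF i] \<beta>_arr[OF j] ar by simp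
  qed
  then have "glued_by D F I r Y rel Z (\<lambda>i. d (r i) \<cdot>\<^bsub>D\<^esub> \<beta> i)"
    using Z_obj d \<beta>_arr F\<beta> r_arr unfolding glued_by_def by simp
  with Z show ?thesis
    by blast
qed

text \<open>A fiber product in \<open>D\<close> is found above one in \<open>C\<close>:
  \<open>p\<close> is lifted, and \<open>q'\<close> is the cartesian factorisation of
  \<open>g \<cdot> p'\<close> through \<open>f\<close> over \<open>q\<close>. Its universal property
  follows from that in \<open>C\<close>, because arrows of \<open>D\<close> are cartesian.\<close>

lemma pretopology_induced:
  assumes "fibration D C F" "pretopology C J"
  shows "pretopology D (induced_topology D F J)"
proof -
  interpret fibration D C F by fact
  interpret J: pretopology C J by fact
  show ?thesis
  proof
    show "f \<in> Arr D \<and> Cod D f = X" if "R \<in> induced_topology D F J X" "f \<in> R" for X R f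
      using that by (auto simp: induced_topology_def)
    fix X R f g
    assume X: "X \<in> Obj D" and R: "R \<in> induced_topology D F J X" "f \<in> R" and g: "g \<in> Arr D" "Cod D g = X"
    have f: "f \<in> Arr D" "Cod D f = X"
      using R by (auto simp: induced_topology_def)
    have "AMap F ` R \<in> J (OMap F X)"
      using R by (simp add: induced_topology_def)
    then obtain p q where pq: "is_pullback C (AMap F g) (AMap F f) p q"
      using J.cover_pullback[of "OMap F X" "AMap F ` R" "AMap F f" "AMap F g"] X R(2) g by auto
    note a = C.pullback_arr[OF pq]
    obtain p' where p': "p' \<in> Arr D" "Cod D p' = Dom D g" "AMap F p' = p"
      by (rule lift_ex[of p "Dom D g"]) (use a g in auto)
    have Fp: "OMap F (Dom D p') = Dom C p"
      using F_simps(3)[OF p'(1)] p'(3) by simp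
    obtain q' where q': "q' \<in> Arr D" "Dom D q' = Dom D p'" "Cod D q' = Dom D f" "f \<cdot>\<^bsub>D\<^esub> q' = g \<cdot>\<^bsub>D\<^esub> p'" "AMap F q' = q"
      by (rule cart_ex[of "g \<cdot>\<^bsub>D\<^esub> p'" f q]) (use a f g p' Fp in auto)
    have "is_pullback D g f p' q'"
      unfolding is_pullback_def
    proof (intro conjI allI ballI impI)
      fix T s t assume "s \<in> hom D T (Dom D g)" "t \<in> hom D T (Dom D f)" and eq: "g \<cdot>\<^bsub>D\<^esub> s = f \<cdot>\<^bsub>D\<^esub> t"
      then have s: "s \<in> Arr D" "Dom D s = T" "Cod D s = Dom D g" and t: "t \<in> Arr D" "Dom D t = T" "Cod D t = Dom D f"
        by (auto simp: hom_def)
      have "AMap F g \<cdot>\<^bsub>C\<^esub> AMap F s = AMap F f \<cdot>\<^bsub>C\<^esub> AMap F t"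
        using arg_cong[OF eq, of "AMap F"] s t f g by simp
      then obtain m0 where m0: "m0 \<in> Arr C" "Dom C m0 = OMap F T" "Cod C m0 = Dom C p"
        "p \<cdot>\<^bsub>C\<^esub> m0 = AMap F s" "q \<cdot>\<^bsub>C\<^esub> m0 = AMap F t"
        using C.pullback_univ[OF pq, of "AMap F s" "AMap F t"] s t f g by auto
      obtain m where m: "m \<in> Arr D" "Dom D m = T" "Cod D m = Dom D p'" "p' \<cdot>\<^bsub>D\<^esub> m = s" "AMap F m = m0"
        by (rule cart_ex[of s p' m0]) (use s p' m0 Fp in auto)
      have "f \<cdot>\<^bsub>D\<^esub> (q' \<cdot>\<^bsub>D\<^esub> m) = g \<cdot>\<^bsub>D\<^esub> (p' \<cdot>\<^bsub>D\<^esub> m)"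
        by (rule D.comp_eq_precomp[OF q'(4)]) (use m p' q' f g in simp_all)
      then have qm: "q' \<cdot>\<^bsub>D\<^esub> m = t"
        by - (rule cart_cancel[of f], use m q' m0 t f eq in simp_all)
      show "\<exists>!m. m \<in> hom D T (Dom D p') \<and> p' \<cdot>\<^bsub>D\<^esub> m = s \<and> q' \<cdot>\<^bsub>D\<^esub> m = t"
      proof (rule ex1I[of _ m])
        show "m \<in> hom D T (Dom D p') \<and> p' \<cdot>\<^bsub>D\<^esub> m = s \<and> q' \<cdot>\<^bsub>D\<^esub> m = t"
          using m qm by (simp add: hom_def)
        fix n assume "n \<in> hom D T (Dom D p') \<and> p' \<cdot>\<^bsub>D\<^esub> n = s \<and> q' \<cdot>\<^bsub>D\<^esub> n = t"
        then have n: "n \<in> Arr D" "Dom D n = T" "Cod D n = Dom D p'" "p' \<cdot>\<^bsub>D\<^esub> n = s" "q' \<cdot>\<^bsub>D\<^esub> n = t"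
          by (auto simp: hom_def)
        have "AMap F n = AMap F m"
        proof (rule C.pullback_unique[OF pq])
          show "p \<cdot>\<^bsub>C\<^esub> AMap F n = p \<cdot>\<^bsub>C\<^esub> AMap F m"
            using arg_cong[OF trans[OF n(4) m(4)[symmetric]], of "AMap F"] n(1-3) m(1-3) p' by simp
          show "q \<cdot>\<^bsub>C\<^esub> AMap F n = q \<cdot>\<^bsub>C\<^esub> AMap F m"
            using arg_cong[OF trans[OF n(5) qm[symmetric]], of "AMap F"] n(1-3) m(1-3) q' by simp
        qed (use n m m0 Fp in simp_all)
        then show "n = m"
          by - (rule cart_cancel[of p'], use n m p' in simp_all)
      qed
    qed (use f g p' q' in \<open>auto simp: hom_def\<close>)
    then show "\<exists>p q. is_pullback D g f p q"
      by blast
  qed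
qed

section \<open>Commuting triangles of functors to the base\<close>

text \<open>The functor is called \<open>H\<close> because the triangle is used three times: with
  the given \<open>A\<close>, and with each of the two functors out of the iso-comma
  category.\<close>

locale triangle = F: fibration D C F
  for D :: "('p, 'n) cat" and C :: "('o, 'm) cat" and F :: "('p, 'n, 'o, 'm) fctr" +
  fixes E :: "('q, 'k) cat" and H :: "('q, 'k, 'p, 'n) fctr" and G :: "('q, 'k, 'o, 'm) fctr"
  assumes H_functor: "is_functor E D H" and G_functor: "is_functor E C G"
    and FH: "functor_eq E (F \<odot> H) G"
begin

sublocale E: category E
  using H_functor by (simp add: is_functor_def)

lemmas H_simps [simp] = functor_simps[OF H_functor]

lemmas G_simps [simp] = functor_simps[OF G_functor]

lemma FH_simps [simp]:
  "Y \<in> Obj E \<Longrightarrow> OMap F (OMap H Y) = OMap G Y"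
  "a \<in> Arr E \<Longrightarrow> AMap F (AMap H a) = AMap G a"
  using FH by (auto simp: functor_eq_def comp_functor_def)

text \<open>Being a covering depends only on the images in \<open>C\<close>, and \<open>F\<close>
  after \<open>H\<close> gives the same images as \<open>G\<close>. One set \<open>R\<close> can
  thus be glued for either functor.\<close>

lemma induced_comp:
  assumes "Y \<in> Obj E"
  shows "R \<in> induced_topology E G J Y \<longleftrightarrow> R \<in> induced_topology E H (induced_topology D F J) Y"
proof (cases "R \<subseteq> {a \<in> Arr E. Cod E a = Y}")
  case True
  then have "AMap F ` AMap H ` R = AMap G ` R"
    by (force simp: image_image)
  moreover have "AMap H ` R \<subseteq> {a \<in> Arr D. Cod D a = OMap H Y}"
    using True by auto
  ultimately show ?thesis
    using True assms by (simp add: induced_topology_def)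
qed (simp add: induced_topology_def)

lemma fibered_comp:
  assumes "fibered E D H"
  shows "fibered E C G"
proof -
  interpret H: fibration E D H
    by standard fact
  show ?thesis
    unfolding fibered_def
  proof (intro conjI ballI impI)
    show "is_functor E C G"
      by (rule G_functor)
    fix f Y assume f: "f \<in> Arr C" and Y: "Y \<in> Obj E" "OMap G Y = Cod C f"
    obtain g where g: "g \<in> Arr D" "Cod D g = OMap H Y" "AMap F g = f"
      by (rule F.lift_ex[of f "OMap H Y"]) (use f Y in auto)
    obtain k where "k \<in> Arr E" "Cod E k = Y" "AMap H k = g"
      by (rule H.lift_ex[of g Y]) (use g Y in auto)
    then show "\<exists>k \<in> Arr E. Cod E k = Y \<and> AMap G k = f"
      using g FH_simps(2)[of k] by auto
  next
    fix a b f
    assume a: "a \<in> Arr E" and b: "b \<in> Arr E" "Cod E a = Cod E b"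
      and "f \<in> hom C (OMap G (Dom E a)) (OMap G (Dom E b))"
      and eq: "AMap G b \<cdot>\<^bsub>C\<^esub> f = AMap G a"
    then have f: "f \<in> Arr C" "Dom C f = OMap G (Dom E a)" "Cod C f = OMap G (Dom E b)"
      by (auto simp: hom_def)
    obtain g where g: "g \<in> Arr D" "Dom D g = OMap H (Dom E a)" "Cod D g = OMap H (Dom E b)"
      "AMap H b \<cdot>\<^bsub>D\<^esub> g = AMap H a" "AMap F g = f"
      by (rule F.cart_ex[of "AMap H a" "AMap H b" f]) (use a b f eq in auto)
    obtain k where k: "k \<in> Arr E" "Dom E k = Dom E a" "Cod E k = Dom E b" "b \<cdot>\<^bsub>E\<^esub> k = a" "AMap H k = g"
      by (rule H.cart_ex[of a b g]) (use a b g in auto)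
    show "\<exists>!k. k \<in> hom E (Dom E a) (Dom E b) \<and> b \<cdot>\<^bsub>E\<^esub> k = a \<and> AMap G k = f"
    proof (rule ex1I[of _ k])
      show "k \<in> hom E (Dom E a) (Dom E b) \<and> b \<cdot>\<^bsub>E\<^esub> k = a \<and> AMap G k = f"
        using k g FH_simps(2)[of k] by (simp add: hom_def)
      fix l assume "l \<in> hom E (Dom E a) (Dom E b) \<and> b \<cdot>\<^bsub>E\<^esub> l = a \<and> AMap G l = f"
      then have l: "l \<in> Arr E" "Dom E l = Dom E a" "Cod E l = Dom E b" "b \<cdot>\<^bsub>E\<^esub> l = a" "AMap G l = f"
        by (auto simp: hom_def)
      have bl: "AMap H b \<cdot>\<^bsub>D\<^esub> AMap H l = AMap H b \<cdot>\<^bsub>D\<^esub> AMap H k"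
        using H_simps(6)[of l b] H_simps(6)[of k b] l k b(1) by simp
      have "AMap H l = AMap H k"
        by (rule F.cart_cancel[OF bl]) (use l k b(1) FH_simps(2)[of k] g in simp_all)
      then show "l = k"
        by - (rule H.cart_cancel[of b], use l k b(1) in simp_all)
    qed
  qed
qed

text \<open>Cartesian factorisation is inherited from \<open>G\<close>: the factor found over
  \<open>AMap F f\<close> is sent by \<open>H\<close> to an arrow with the same composite and the
  same image in \<open>C\<close> as \<open>f\<close>, hence to \<open>f\<close>. Only strict lifts
  have to be supplied.\<close>

lemma fibered_upper:
  assumes "fibered E C G"
    and lifts: "\<And>g Y. g \<in> Arr D \<Longrightarrow> Y \<in> Obj E \<Longrightarrow> OMap H Y = Cod D g \<Longrightarrow>
      \<exists>k \<in> Arr E. Cod E k = Y \<and> AMap H k = g"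
  shows "fibered E D H"
proof -
  interpret G: fibration E C G
    by standard fact
  show ?thesis
    unfolding fibered_def
  proof (intro conjI ballI impI)
    show "is_functor E D H"
      by (rule H_functor)
    show "\<exists>k \<in> Arr E. Cod E k = Y \<and> AMap H k = g" if "g \<in> Arr D" "Y \<in> Obj E" "OMap H Y = Cod D g" for g Y
      using lifts that .
  next
    fix a b f
    assume a: "a \<in> Arr E" and b: "b \<in> Arr E" "Cod E a = Cod E b"
      and "f \<in> hom D (OMap H (Dom E a)) (OMap H (Dom E b))"
      and eq: "AMap H b \<cdot>\<^bsub>D\<^esub> f = AMap H a"
    then have f: "f \<in> Arr D" "Dom D f = OMap H (Dom E a)" "Cod D f = OMap H (Dom E b)"
      by (auto simp: hom_def)
    have Feq: "AMap G b \<cdot>\<^bsub>C\<^esub> AMap F f = AMap G a"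
      using arg_cong[OF eq, of "AMap F"] a b f by simp
    obtain k where k: "k \<in> Arr E" "Dom E k = Dom E a" "Cod E k = Dom E b" "b \<cdot>\<^bsub>E\<^esub> k = a" "AMap G k = AMap F f"
      by (rule G.cart_ex[of a b "AMap F f"]) (use a b f Feq in auto)
    have bk: "AMap H b \<cdot>\<^bsub>D\<^esub> AMap H k = AMap H b \<cdot>\<^bsub>D\<^esub> f"
      using H_simps(6)[of k b] k b(1) eq by simp
    have Hk: "AMap H k = f"
      by (rule F.cart_cancel[OF bk]) (use k b(1) f in simp_all)
    show "\<exists>!k. k \<in> hom E (Dom E a) (Dom E b) \<and> b \<cdot>\<^bsub>E\<^esub> k = a \<and> AMap H k = f"
    proof (rule ex1I[of _ k])
      show "k \<in> hom E (Dom E a) (Dom E b) \<and> b \<cdot>\<^bsub>E\<^esub> k = a \<and> AMap H k = f"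
        using k Hk by (simp add: hom_def)
      fix l assume "l \<in> hom E (Dom E a) (Dom E b) \<and> b \<cdot>\<^bsub>E\<^esub> l = a \<and> AMap H l = f"
      then have l: "l \<in> Arr E" "Dom E l = Dom E a" "Cod E l = Dom E b" "b \<cdot>\<^bsub>E\<^esub> l = a" "AMap H l = f"
        by (auto simp: hom_def)
      have "AMap G l = AMap G k"
        using FH_simps(2)[of l] FH_simps(2)[of k] l k Hk by simp
      then show "l = k"
        by - (rule G.cart_cancel[of b], use l k b(1) in simp_all)
    qed
  qed
qed

end

locale fibered_triangle = triangle +
  assumes H_fibered: "fibered E D H"
begin

sublocale H: fibration E D H
  by standard (rule H_fibered)

sublocale G: fibration E C G
  by standard (rule fibered_comp[OF H_fibered])

section \<open>Gluing for the composite functor\<close>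

lemma arrows_glue_comp:
  assumes F: "arrows_glue D C J F" and H: "arrows_glue E D (induced_topology D F J) H"
  shows "arrows_glue E C J G"
  unfolding arrows_glue_def
proof (intro ballI allI impI)
  fix Y1 Y2 R h u
  assume Y1: "Y1 \<in> Obj E" and Y2: "Y2 \<in> Obj E" and R: "R \<in> induced_topology E G J Y1"
    and h: "h \<in> Arr C" "Dom C h = OMap G Y1" "Cod C h = OMap G Y2"
    and u': "\<forall>a \<in> R. u a \<in> Arr E \<and> Dom E (u a) = Dom E a \<and> Cod E (u a) = Y2 \<and>
           AMap G (u a) = h \<cdot>\<^bsub>C\<^esub> AMap G a"
    and compat: "\<forall>a \<in> R. \<forall>b \<in> R. \<forall>s \<in> Arr E. \<forall>t \<in> Arr E. Dom E s = Dom E t \<longrightarrow> Cod E s = Dom E a \<longrightarrow>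
           Cod E t = Dom E b \<longrightarrow> a \<cdot>\<^bsub>E\<^esub> s = b \<cdot>\<^bsub>E\<^esub> t \<longrightarrow> u a \<cdot>\<^bsub>E\<^esub> s = u b \<cdot>\<^bsub>E\<^esub> t"
  have Ra: "a \<in> Arr E" "Cod E a = Y1" if "a \<in> R" for a
    using R that by (auto simp: induced_topology_def)
  have u: "u a \<in> Arr E" "Dom E (u a) = Dom E a" "Cod E (u a) = Y2" "AMap G (u a) = h \<cdot>\<^bsub>C\<^esub> AMap G a"
    if "a \<in> R" for a
    using u' that by auto
  have R': "R \<in> induced_topology E H (induced_topology D F J) Y1"
    using R induced_comp[OF Y1] by blast
  then have HR: "AMap H ` R \<in> induced_topology D F J (OMap H Y1)"
    by (simp add: induced_topology_def)
  \<comment> \<open>Compatibility is known in \<open>E\<close> but has to be tested in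
    \<open>D\<close>. The arrow \<open>s\<close> is lifted to \<open>s'\<close>, and
    \<open>t\<close> is lifted by factoring \<open>a \<cdot> s'\<close> through \<open>b\<close>,
    which gives a test pair in \<open>E\<close>.\<close>
  have key: "AMap H (u a) \<cdot>\<^bsub>D\<^esub> s = AMap H (u b) \<cdot>\<^bsub>D\<^esub> t"
    if a: "a \<in> R" and b: "b \<in> R" and s: "s \<in> Arr D" "Cod D s = OMap H (Dom E a)"
      and t: "t \<in> Arr D" "Cod D t = OMap H (Dom E b)" and st: "Dom D s = Dom D t"
      and eq: "AMap H a \<cdot>\<^bsub>D\<^esub> s = AMap H b \<cdot>\<^bsub>D\<^esub> t" for a b s t
  proof -
    obtain s' where s': "s' \<in> Arr E" "Cod E s' = Dom E a" "AMap H s' = s"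
      by (rule H.lift_ex[of s "Dom E a"]) (use s Ra[OF a] in auto)
    have Ds: "OMap H (Dom E s') = Dom D t"
      using H_simps(3)[OF s'(1)] s' st by simp
    obtain t' where t': "t' \<in> Arr E" "Dom E t' = Dom E s'" "Cod E t' = Dom E b" "b \<cdot>\<^bsub>E\<^esub> t' = a \<cdot>\<^bsub>E\<^esub> s'" "AMap H t' = t"
      by (rule H.cart_ex[of "a \<cdot>\<^bsub>E\<^esub> s'" b t]) (use s' t Ra[OF a] Ra[OF b] Ds eq in auto)
    have "u a \<cdot>\<^bsub>E\<^esub> s' = u b \<cdot>\<^bsub>E\<^esub> t'"
      by (rule compat[rule_format, OF a b]) (use s' t' in simp_all)
    then have "AMap H (u a \<cdot>\<^bsub>E\<^esub> s') = AMap H (u b \<cdot>\<^bsub>E\<^esub> t')"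
      by simp
    then show ?thesis
      using s' t' u[OF a] u[OF b] by simp
  qed
  \<comment> \<open>Members of \<open>R\<close> may have the same image under \<open>H\<close>. The
    family \<open>v\<close> on images is well defined by \<open>key\<close> at identities.\<close>
  have "\<exists>v. \<forall>x \<in> AMap H ` R. \<exists>a \<in> R. x = AMap H a \<and> v x = AMap H (u a)"
    by (rule bchoice) auto
  then obtain v where v: "\<And>a. a \<in> R \<Longrightarrow> \<exists>b \<in> R. AMap H a = AMap H b \<and> v (AMap H a) = AMap H (u b)"
    by blast
  have v: "v (AMap H a) = AMap H (u a)" if a: "a \<in> R" for a
  proof -
    obtain b where b: "b \<in> R" "AMap H a = AMap H b" "v (AMap H a) = AMap H (u b)"
      using v[OF a] by blast
    have d: "OMap H (Dom E b) = OMap H (Dom E a)"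
      using H_simps(3)[OF Ra(1)[OF a]] H_simps(3)[OF Ra(1)[OF b(1)]] b(2) by simp
    have "AMap H (u b) \<cdot>\<^bsub>D\<^esub> Ident D (OMap H (Dom E a)) = AMap H (u a) \<cdot>\<^bsub>D\<^esub> Ident D (OMap H (Dom E a))"
      by (rule key) (use a b d Ra in simp_all)
    then show ?thesis
      using b(3) u[OF a] u[OF b(1)] d by simp
  qed
  have "\<exists>!w. w \<in> Arr D \<and> Dom D w = OMap H Y1 \<and> Cod D w = OMap H Y2 \<and> AMap F w = h \<and>
    (\<forall>x \<in> AMap H ` R. w \<cdot>\<^bsub>D\<^esub> x = v x)"
  proof (rule arrows_glueD[OF F _ _ HR])
    show "v x \<in> Arr D \<and> Dom D (v x) = Dom D x \<and> Cod D (v x) = OMap H Y2 \<and> AMap F (v x) = h \<cdot>\<^bsub>C\<^esub> AMap F x"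
      if "x \<in> AMap H ` R" for x
      using that u Ra by (auto simp: v)
    show "v x \<cdot>\<^bsub>D\<^esub> s = v y \<cdot>\<^bsub>D\<^esub> t"
      if x: "x \<in> AMap H ` R" and y: "y \<in> AMap H ` R"
        and st: "s \<in> Arr D" "t \<in> Arr D" "Dom D s = Dom D t" "Cod D s = Dom D x" "Cod D t = Dom D y" "x \<cdot>\<^bsub>D\<^esub> s = y \<cdot>\<^bsub>D\<^esub> t"
      for x y s t
    proof -
      obtain a b where ab: "a \<in> R" "b \<in> R" "x = AMap H a" "y = AMap H b"
        using x y by blast
      show ?thesis
        unfolding ab(3,4) v[OF ab(1)] v[OF ab(2)]
        by (rule key[OF ab(1,2)]) (use st Ra[OF ab(1)] Ra[OF ab(2)] in \<open>simp_all add: ab(3,4)\<close>)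
    qed
  qed (use Y1 Y2 h in auto)
  then have "\<exists>!w. w \<in> Arr D \<and> Dom D w = OMap H Y1 \<and> Cod D w = OMap H Y2 \<and> AMap F w = h \<and>
    (\<forall>a \<in> R. w \<cdot>\<^bsub>D\<^esub> AMap H a = AMap H (u a))" (is "\<exists>!w. ?w w")
    by (simp add: v)
  then obtain w0 where "?w w0" and unique: "\<And>w. ?w w \<Longrightarrow> w = w0"
    by (elim ex1E) blast
  then have w0: "w0 \<in> Arr D" "Dom D w0 = OMap H Y1" "Cod D w0 = OMap H Y2" "AMap F w0 = h"
    and w0R: "\<And>a. a \<in> R \<Longrightarrow> w0 \<cdot>\<^bsub>D\<^esub> AMap H a = AMap H (u a)"
    by blast+
  have w0_unique: "w = w0" if "w \<in> Arr D" "Dom D w = OMap H Y1" "Cod D w = OMap H Y2" "AMap F w = h"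
     "\<And>a. a \<in> R \<Longrightarrow> w \<cdot>\<^bsub>D\<^esub> AMap H a = AMap H (u a)" for w
    using unique that by blast
  have "\<exists>!w. w \<in> Arr E \<and> Dom E w = Y1 \<and> Cod E w = Y2 \<and> AMap H w = w0 \<and> (\<forall>a \<in> R. w \<cdot>\<^bsub>E\<^esub> a = u a)"
  proof (rule arrows_glueD[OF H Y1 Y2 R' w0(1-3)])
    show "u a \<in> Arr E \<and> Dom E (u a) = Dom E a \<and> Cod E (u a) = Y2 \<and> AMap H (u a) = w0 \<cdot>\<^bsub>D\<^esub> AMap H a"
      if "a \<in> R" for a
      using u[OF that] w0R[OF that] by simp
  qed (rule compat[rule_format])
  \<comment> \<open>An arrow of \<open>E\<close> that glues \<open>u\<close> over \<open>h\<close>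
    has an image in \<open>D\<close> that glues \<open>v\<close>, so it lies over \<open>w0\<close>.
    Hence unique gluing over \<open>w0\<close> is unique gluing over \<open>h\<close>.\<close>
  moreover have "AMap H w = w0 \<longleftrightarrow> AMap G w = h"
    if w: "w \<in> Arr E" "Dom E w = Y1" "Cod E w = Y2" "\<forall>a \<in> R. w \<cdot>\<^bsub>E\<^esub> a = u a" for w
  proof
    show "AMap G w = h" if "AMap H w = w0"
      using FH_simps(2)[OF w(1)] that w0 by simp
    show "AMap H w = w0" if "AMap G w = h"
    proof (rule w0_unique)
      show "AMap H w \<cdot>\<^bsub>D\<^esub> AMap H a = AMap H (u a)" if "a \<in> R" for a
        using H_simps(6)[of a w] Ra[OF that] w that by simp
    qed (use w that in simp_all)
  qed
  ultimately show "\<exists>!w. w \<in> Arr E \<and> Dom E w = Y1 \<and> Cod E w = Y2 \<and> AMap G w = h \<and> (\<forall>a \<in> R. w \<cdot>\<^bsub>E\<^esub> a = u a)"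
    by (metis (no_types, lifting))
qed

end

context fibered_triangle
begin

text \<open>Cartesianness of \<open>a\<close> for \<open>H\<close> produces the comparison of two
  lifts. It serves to move a statement about one lift of an arrow of \<open>D\<close> to any other
  lift.\<close>

lemma vertical_comparison:
  assumes "a \<in> Arr E" "a' \<in> Arr E" "Cod E a = Cod E a'" "AMap H a = AMap H a'"
  obtains i where "i \<in> Arr E" "Dom E i = Dom E a'" "Cod E i = Dom E a" "a \<cdot>\<^bsub>E\<^esub> i = a'"
    "AMap H i = Ident D (OMap H (Dom E a))" "AMap G i = Ident C (OMap G (Dom E a))"
    "OMap H (Dom E a') = OMap H (Dom E a)"
proof -
  have d: "OMap H (Dom E a') = OMap H (Dom E a)"
    using H_simps(3)[of a] H_simps(3)[of a'] assms by simp
  obtain i where i: "i \<in> Arr E" "Dom E i = Dom E a'" "Cod E i = Dom E a" "a \<cdot>\<^bsub>E\<^esub> i = a'"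
    "AMap H i = Ident D (OMap H (Dom E a))"
    by (rule H.cart_ex[of a' a "Ident D (OMap H (Dom E a))"]) (use assms d in auto)
  have "AMap G i = Ident C (OMap G (Dom E a))"
    using FH_simps(2)[of i] i assms(1) by simp
  with i d show thesis
    by (rule_tac that) auto
qed

text \<open>The image \<open>relD\<close> of the relation is again a descent relation because
  \<open>rel\<close> can be moved to any lift of the first arrow (\<open>relD_lift\<close>). It
  glues the images in \<open>D\<close> by arrows \<open>c f\<close>. The unchanged
  \<open>rel\<close>, read over \<open>c f\<close> instead of \<open>f\<close>, is then a descent
  relation for \<open>H\<close>.\<close>

lemma objects_glue_comp:
  assumes glueF: "objects_glue D C J F" and glueH: "objects_glue E D (induced_topology D F J) H"
  shows "objects_glue E C J G"
  unfolding objects_glue_def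
proof (intro ballI allI impI)
  fix X R Y rel
  assume X: "X \<in> Obj C" "R \<in> J X" and "descent_relation E C G R (\<lambda>f. f) Y rel"
  then interpret R: descent_relation E C G R "\<lambda>f. f" Y rel by simp
  define relD where "relD f g x y \<longleftrightarrow> (\<exists>a b. rel f g a b \<and> AMap H a = x \<and> AMap H b = y)" for f g x y
  have relD_lift: "\<exists>b. rel f g a b \<and> AMap H b = y"
    if f: "f \<in> R" and g: "g \<in> R" and xy: "relD f g (AMap H a) y" and a: "a \<in> Arr E" "Cod E a = Y f" for f g a y
  proof -
    obtain a' b' where ab': "rel f g a' b'" "AMap H a' = AMap H a" "AMap H b' = y"
      using xy unfolding relD_def by blast
    note ar = R.rel_arr[OF f g ab'(1)]
    obtain i where i: "i \<in> Arr E" "Cod E i = Dom E a'" "a' \<cdot>\<^bsub>E\<^esub> i = a" "AMap H i = Ident D (OMap H (Dom E a'))"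
      by (rule vertical_comparison[of a' a]) (use ar a ab' in auto)
    have "rel f g a (b' \<cdot>\<^bsub>E\<^esub> i)"
      using R.rel_precomp[OF f g ab'(1) i(1,2)] i by simp
    moreover have "AMap H (b' \<cdot>\<^bsub>E\<^esub> i) = y"
      using ar i ab' H_simps(3,4)[of b'] by auto
    ultimately show ?thesis
      by blast
  qed
  have lift: "\<exists>a. a \<in> Arr E \<and> Cod E a = Y f \<and> AMap H a = x"
    if "f \<in> R" "x \<in> Arr D" "Cod D x = OMap H (Y f)" for f x
    using H.lift_ex[of x "Y f"] R.Y_obj[OF that(1)] that(2,3) by metis
  have "descent_relation D C F R (\<lambda>f. f) (\<lambda>f. OMap H (Y f)) relD"
  proof
    show "f \<in> Arr C" "OMap H (Y f) \<in> Obj D" "OMap F (OMap H (Y f)) = Dom C f" if "f \<in> R" for f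
      using R.r_arr R.Y_obj that by auto
    show relD_arr: "x \<in> Arr D \<and> y \<in> Arr D \<and> Dom D x = Dom D y \<and> Cod D x = OMap H (Y f) \<and> Cod D y = OMap H (Y g) \<and>
      f \<cdot>\<^bsub>C\<^esub> AMap F x = g \<cdot>\<^bsub>C\<^esub> AMap F y"
      if f: "f \<in> R" and g: "g \<in> R" and xy: "relD f g x y" for f g x y
    proof -
      obtain a b where ab: "rel f g a b" "x = AMap H a" "y = AMap H b"
        using xy unfolding relD_def by blast
      show ?thesis
        using R.rel_arr[OF f g ab(1)] by (simp add: ab(2,3))
    qed
    show "relD f f x x" if "f \<in> R" "x \<in> Arr D" "Cod D x = OMap H (Y f)" for f x
      using lift[OF that] R.rel_refl[OF that(1)] unfolding relD_def by blast
    show "relD f k x z" if f: "f \<in> R" and g: "g \<in> R" and k: "k \<in> R" and xy: "relD f g x y" and yz: "relD g k y z"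
      for f g k x y z
    proof -
      obtain a b where ab: "rel f g a b" "AMap H a = x" "AMap H b = y"
        using xy unfolding relD_def by blast
      obtain c where c: "rel g k b c" "AMap H c = z"
        using relD_lift[OF g k, of b z] yz ab R.rel_arr[OF f g ab(1)] by blast
      show ?thesis
        using R.rel_trans[OF f g k ab(1) c(1)] ab(2) c(2) unfolding relD_def by blast
    qed
    show "relD f g (x \<cdot>\<^bsub>D\<^esub> z) (y \<cdot>\<^bsub>D\<^esub> z)"
      if f: "f \<in> R" and g: "g \<in> R" and xy: "relD f g x y" and z: "z \<in> Arr D" "Cod D z = Dom D x" for f g x y z
    proof -
      obtain a b where ab: "rel f g a b" "x = AMap H a" "y = AMap H b"
        using xy unfolding relD_def by blast
      note ar = R.rel_arr[OF f g ab(1)]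
      obtain z' where z': "z' \<in> Arr E" "Cod E z' = Dom E a" "AMap H z' = z"
        by (rule H.lift_ex[of z "Dom E a"]) (use z ar ab in auto)
      show ?thesis
        using R.rel_precomp[OF f g ab(1) z'(1,2)] ar z' unfolding relD_def ab(2,3)
        by (intro exI[of _ "a \<cdot>\<^bsub>E\<^esub> z'"] exI[of _ "b \<cdot>\<^bsub>E\<^esub> z'"]) simp
    qed
    show "\<exists>y. relD f g x y \<and> AMap F y = t"
      if f: "f \<in> R" and g: "g \<in> R" and x: "x \<in> Arr D" "Cod D x = OMap H (Y f)"
        and t: "t \<in> Arr C" "Dom C t = OMap F (Dom D x)" "Cod C t = Dom C g" "f \<cdot>\<^bsub>C\<^esub> AMap F x = g \<cdot>\<^bsub>C\<^esub> t" for f g x t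
    proof -
      obtain a where a: "a \<in> Arr E" "Cod E a = Y f" "AMap H a = x"
        using lift[OF f x] by blast
      have "OMap G (Dom E a) = OMap F (Dom D x)" "AMap G a = AMap F x"
        using a H_simps(3)[of a] FH_simps(1)[of "Dom E a"] FH_simps(2)[of a] by simp_all
      then obtain b where b: "rel f g a b" "AMap G b = t"
        using R.rel_ex[OF f g a(1,2), of t] t by auto
      have "AMap F (AMap H b) = t"
        using R.rel_arr[OF f g b(1)] b(2) by simp
      with b a show ?thesis
        unfolding relD_def by blast
    qed
    show "y = y'"
      if f: "f \<in> R" and g: "g \<in> R" and xy: "relD f g x y" and xy': "relD f g x y'" and Fy: "AMap F y = AMap F y'"
      for f g x y y'
    proof -
      obtain a b where ab: "rel f g a b" "AMap H a = x" "AMap H b = y"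
        using xy unfolding relD_def by blast
      note ar = R.rel_arr[OF f g ab(1)]
      obtain b' where b': "rel f g a b'" "AMap H b' = y'"
        using relD_lift[OF f g, of a y'] xy' ab ar by blast
      have "AMap G b = AMap G b'"
        using FH_simps(2)[of b] FH_simps(2)[of b'] ar R.rel_arr[OF f g b'(1)] Fy ab(3) b'(2) by simp
      then have "b = b'"
        by (rule R.rel_unique[OF f g ab(1) b'(1)])
      with ab b' show ?thesis
        by simp
    qed
  qed
  then obtain Z0 c where Z0: "OMap F Z0 = X"
    and c': "glued_by D F R (\<lambda>f. f) (\<lambda>f. OMap H (Y f)) relD Z0 c"
    using glueF X unfolding objects_glue_def by blast
  have Z0_obj: "Z0 \<in> Obj D"
    and c: "\<And>f. f \<in> R \<Longrightarrow> c f \<in> Arr D" "\<And>f. f \<in> R \<Longrightarrow> Dom D (c f) = OMap H (Y f)" "\<And>f. f \<in> R \<Longrightarrow> Cod D (c f) = Z0"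
      "\<And>f. f \<in> R \<Longrightarrow> AMap F (c f) = f"
    and c_eq: "\<And>f g x y. f \<in> R \<Longrightarrow> g \<in> R \<Longrightarrow> relD f g x y \<Longrightarrow> c f \<cdot>\<^bsub>D\<^esub> x = c g \<cdot>\<^bsub>D\<^esub> y"
    using c' unfolding glued_by_def by blast+
  have c_cover: "c ` R \<in> induced_topology D F J Z0"
  proof -
    have "AMap F ` c ` R = R"
      using c(4) by (force simp: image_image)
    then show ?thesis
      using c X Z0 by (auto simp: induced_topology_def)
  qed
  \<comment> \<open>For the partner over a given arrow \<open>t\<close> of \<open>D\<close>, the
    partner \<open>b\<close> over the image of \<open>t\<close> in \<open>C\<close> is taken:
    \<open>c g \<cdot> AMap H b = c g \<cdot> t\<close>, and cancelling \<open>c g\<close> shows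
    that \<open>b\<close> lies over \<open>t\<close>.\<close>
  interpret cR: descent_relation E D H R c Y rel
  proof
    show "c f \<in> Arr D" "Y f \<in> Obj E" "OMap H (Y f) = Dom D (c f)" if "f \<in> R" for f
      using c R.Y_obj that by auto
    show "a \<in> Arr E \<and> b \<in> Arr E \<and> Dom E a = Dom E b \<and> Cod E a = Y f \<and> Cod E b = Y g \<and>
      c f \<cdot>\<^bsub>D\<^esub> AMap H a = c g \<cdot>\<^bsub>D\<^esub> AMap H b" if "f \<in> R" "g \<in> R" "rel f g a b" for f g a b
      using R.rel_arr[OF that] c_eq[OF that(1,2)] that(3) unfolding relD_def by blast
    show "\<exists>b. rel f g a b \<and> AMap H b = t"
      if f: "f \<in> R" and g: "g \<in> R" and a: "a \<in> Arr E" "Cod E a = Y f"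
        and t: "t \<in> Arr D" "Dom D t = OMap H (Dom E a)" "Cod D t = Dom D (c g)" "c f \<cdot>\<^bsub>D\<^esub> AMap H a = c g \<cdot>\<^bsub>D\<^esub> t"
      for f g a t
    proof -
      have Ff: "f \<cdot>\<^bsub>C\<^esub> AMap G a = g \<cdot>\<^bsub>C\<^esub> AMap F t"
        using arg_cong[OF t(4), of "AMap F"] c[OF f] c[OF g] a t(1-3) by simp
      obtain b where b: "rel f g a b" "AMap G b = AMap F t"
        using R.rel_ex[OF f g a, of "AMap F t"] t a Ff c[OF g] R.Y_obj[OF g] by auto
      note ar = R.rel_arr[OF f g b(1)]
      have "relD f g (AMap H a) (AMap H b)"
        using b(1) unfolding relD_def by blast
      then have "c g \<cdot>\<^bsub>D\<^esub> AMap H b = c g \<cdot>\<^bsub>D\<^esub> t"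
        using c_eq[OF f g] t(4) by simp
      then have "AMap H b = t"
        by (rule F.cart_cancel) (use ar b c[OF g] t in simp_all)
      with b show ?thesis
        by blast
    qed
    show "b = b'" if "f \<in> R" "g \<in> R" "rel f g a b" "rel f g a b'" "AMap H b = AMap H b'" for f g a b b'
    proof (rule R.rel_unique[OF that(1-4)])
      show "AMap G b = AMap G b'"
        using FH_simps(2)[of b] FH_simps(2)[of b'] R.rel_arr[OF that(1-3)] R.rel_arr[OF that(1,2,4)] that(5) by simp
    qed
    show "rel f h a d" if "f \<in> R" "g \<in> R" "h \<in> R" "rel f g a b" "rel g h b d" for f g h a b d
      by (rule R.rel_trans[OF that])
  qed (auto intro: R.rel_refl R.rel_precomp)
  obtain Z d where Z: "OMap H Z = Z0" and d: "glued_by E H R c Y rel Z d"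
    using cR.objects_glue_indexed[OF glueH Z0_obj c_cover] by blast
  have "AMap G (d f) = f" if "f \<in> R" for f
  proof -
    have "d f \<in> Arr E" "AMap H (d f) = c f"
      using d that unfolding glued_by_def by auto
    then show ?thesis
      using FH_simps(2)[of "d f"] c(4)[OF that] by simp
  qed
  then have "glued_by E G R (\<lambda>f. f) Y rel Z d"
    using d unfolding glued_by_def by blast
  moreover have "OMap G Z = X"
    using FH_simps(1)[of Z] d Z Z0 unfolding glued_by_def by simp
  ultimately show "\<exists>Z c. OMap G Z = X \<and> glued_by E G R (\<lambda>f. f) Y rel Z c"
    by blast
qed

section \<open>Gluing for the functor to the intermediate category\<close>

text \<open>An arrow glued for \<open>G\<close> over \<open>AMap F h\<close> is sent by
  \<open>H\<close> to an arrow that agrees with \<open>h\<close> on the covering and over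
  \<open>C\<close>. Uniqueness of gluing for \<open>F\<close> makes the two equal.\<close>

lemma arrows_glue_upper:
  assumes G: "arrows_glue E C J G" and F: "arrows_glue D C J F"
  shows "arrows_glue E D (induced_topology D F J) H"
  unfolding arrows_glue_def
proof (intro ballI allI impI)
  fix Y1 Y2 R h u
  assume Y1: "Y1 \<in> Obj E" and Y2: "Y2 \<in> Obj E" and R: "R \<in> induced_topology E H (induced_topology D F J) Y1"
    and h: "h \<in> Arr D" "Dom D h = OMap H Y1" "Cod D h = OMap H Y2"
    and u': "\<forall>a \<in> R. u a \<in> Arr E \<and> Dom E (u a) = Dom E a \<and> Cod E (u a) = Y2 \<and>
           AMap H (u a) = h \<cdot>\<^bsub>D\<^esub> AMap H a"
    and compat: "\<forall>a \<in> R. \<forall>b \<in> R. \<forall>s \<in> Arr E. \<forall>t \<in> Arr E. Dom E s = Dom E t \<longrightarrow> Cod E s = Dom E a \<longrightarrow>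
           Cod E t = Dom E b \<longrightarrow> a \<cdot>\<^bsub>E\<^esub> s = b \<cdot>\<^bsub>E\<^esub> t \<longrightarrow> u a \<cdot>\<^bsub>E\<^esub> s = u b \<cdot>\<^bsub>E\<^esub> t"
  have Ra: "a \<in> Arr E" "Cod E a = Y1" if "a \<in> R" for a
    using R that by (auto simp: induced_topology_def)
  have u: "u a \<in> Arr E" "Dom E (u a) = Dom E a" "Cod E (u a) = Y2" "AMap H (u a) = h \<cdot>\<^bsub>D\<^esub> AMap H a"
    if "a \<in> R" for a
    using u' that by auto
  have R': "R \<in> induced_topology E G J Y1"
    using R induced_comp[OF Y1] by blast
  have HR: "AMap H ` R \<in> induced_topology D F J (OMap H Y1)"
    using R by (simp add: induced_topology_def)
  have "\<exists>!w. w \<in> Arr E \<and> Dom E w = Y1 \<and> Cod E w = Y2 \<and> AMap G w = AMap F h \<and> (\<forall>a \<in> R. w \<cdot>\<^bsub>E\<^esub> a = u a)"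
  proof (rule arrows_glueD[OF G Y1 Y2 R'])
    show "u a \<in> Arr E \<and> Dom E (u a) = Dom E a \<and> Cod E (u a) = Y2 \<and> AMap G (u a) = AMap F h \<cdot>\<^bsub>C\<^esub> AMap G a"
      if a: "a \<in> R" for a
      using u[OF a] FH_simps(2)[of "u a"] Ra[OF a] h by simp
    show "AMap F h \<in> Arr C" "Dom C (AMap F h) = OMap G Y1" "Cod C (AMap F h) = OMap G Y2"
      using h Y1 Y2 by simp_all
  qed (rule compat[rule_format])
  moreover have "AMap H w = h \<longleftrightarrow> AMap G w = AMap F h"
    if w: "w \<in> Arr E" "Dom E w = Y1" "Cod E w = Y2" "\<forall>a \<in> R. w \<cdot>\<^bsub>E\<^esub> a = u a" for w
  proof
    show "AMap G w = AMap F h" if "AMap H w = h"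
      using FH_simps(2)[OF w(1)] that by simp
    show "AMap H w = h" if Gw: "AMap G w = AMap F h"
    proof (rule arrows_glueD_unique[OF F])
      show "AMap H ` R \<in> induced_topology D F J (Dom D (AMap H w))"
        using HR w by simp
      show "AMap H w \<cdot>\<^bsub>D\<^esub> x = h \<cdot>\<^bsub>D\<^esub> x" if x: "x \<in> AMap H ` R" for x
      proof -
        obtain a where a: "a \<in> R" "x = AMap H a"
          using x by blast
        show ?thesis
          using H_simps(6)[of a w] Ra[OF a(1)] w a u(4)[OF a(1)] by simp
      qed
    qed (use w h Gw F.is_functor F.D.category_axioms in simp_all)
  qed
  ultimately show "\<exists>!w. w \<in> Arr E \<and> Dom E w = Y1 \<and> Cod E w = Y2 \<and> AMap H w = h \<and> (\<forall>a \<in> R. w \<cdot>\<^bsub>E\<^esub> a = u a)"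
    by (metis (no_types, lifting))
qed

lemma objects_glue_upper:
  assumes G: "objects_glue E C J G" and F: "arrows_glue D C J F"
  shows "objects_glue E D (induced_topology D F J) H"
  unfolding objects_glue_def
proof (intro ballI allI impI)
  fix X R Y rel
  assume X: "X \<in> Obj D" and R: "R \<in> induced_topology D F J X" and "descent_relation E D H R (\<lambda>f. f) Y rel"
  then interpret R: descent_relation E D H R "\<lambda>f. f" Y rel by simp
  have Ra: "f \<in> Arr D" "Cod D f = X" if "f \<in> R" for f
    using R that by (auto simp: induced_topology_def)
  have FR: "AMap F ` R \<in> J (OMap F X)"
    using R by (simp add: induced_topology_def)
  have Y: "Y f \<in> Obj E" "OMap H (Y f) = Dom D f" "OMap G (Y f) = OMap F (Dom D f)" if "f \<in> R" for f
    using R.Y_obj[OF that] FH_simps(1)[of "Y f"] by auto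
  \<comment> \<open>\<open>R\<close> itself remains the index set, as \<open>F\<close> may identify
    some of its members.\<close>
  interpret GR: descent_relation E C G R "AMap F" Y rel
  proof
    show "AMap F f \<in> Arr C" "Y f \<in> Obj E" "OMap G (Y f) = Dom C (AMap F f)" if "f \<in> R" for f
      using Ra[OF that] Y[OF that] by simp_all
    have ar: "a \<in> Arr E \<and> b \<in> Arr E \<and> Dom E a = Dom E b \<and> Cod E a = Y f \<and> Cod E b = Y g \<and>
      f \<cdot>\<^bsub>D\<^esub> AMap H a = g \<cdot>\<^bsub>D\<^esub> AMap H b" if "f \<in> R" "g \<in> R" "rel f g a b" for f g a b
      using R.rel_arr[OF that] .
    show "a \<in> Arr E \<and> b \<in> Arr E \<and> Dom E a = Dom E b \<and> Cod E a = Y f \<and> Cod E b = Y g \<and>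
      AMap F f \<cdot>\<^bsub>C\<^esub> AMap G a = AMap F g \<cdot>\<^bsub>C\<^esub> AMap G b"
      if f: "f \<in> R" and g: "g \<in> R" and ab: "rel f g a b" for f g a b
    proof -
      have *: "a \<in> Arr E" "b \<in> Arr E" "Dom E a = Dom E b" "Cod E a = Y f" "Cod E b = Y g"
        and eq: "f \<cdot>\<^bsub>D\<^esub> AMap H a = g \<cdot>\<^bsub>D\<^esub> AMap H b"
        using ar[OF f g ab] by blast+
      show ?thesis
        using arg_cong[OF eq, of "AMap F"] * Ra[OF f] Ra[OF g] Y[OF f] Y[OF g] by simp
    qed
    show "\<exists>b. rel f g a b \<and> AMap G b = t"
      if f: "f \<in> R" and g: "g \<in> R" and a: "a \<in> Arr E" "Cod E a = Y f"
        and t: "t \<in> Arr C" "Dom C t = OMap G (Dom E a)" "Cod C t = Dom C (AMap F g)"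
          "AMap F f \<cdot>\<^bsub>C\<^esub> AMap G a = AMap F g \<cdot>\<^bsub>C\<^esub> t"
      for f g a t
    proof -
      obtain t' where t': "t' \<in> Arr D" "Dom D t' = OMap H (Dom E a)" "Cod D t' = Dom D g"
        "g \<cdot>\<^bsub>D\<^esub> t' = f \<cdot>\<^bsub>D\<^esub> AMap H a" "AMap F t' = t"
        by (rule F.cart_ex[of "f \<cdot>\<^bsub>D\<^esub> AMap H a" g t]) (use a t Ra[OF f] Ra[OF g] Y[OF f] in auto)
      obtain b where b: "rel f g a b" "AMap H b = t'"
        using R.rel_ex[OF f g a, of t'] t' by auto
      have "AMap G b = t"
        using ar[OF f g b(1)] FH_simps(2)[of b] b(2) t'(5) by simp
      with b show ?thesis
        by blast
    qed
    show "b = b'" if f: "f \<in> R" and g: "g \<in> R" and ab: "rel f g a b" and ab': "rel f g a b'"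
      and Gb: "AMap G b = AMap G b'" for f g a b b'
    proof (rule R.rel_unique[OF f g ab ab'])
      note * = ar[OF f g ab] ar[OF f g ab']
      have e: "g \<cdot>\<^bsub>D\<^esub> AMap H b = g \<cdot>\<^bsub>D\<^esub> AMap H b'"
        using * by simp
      show "AMap H b = AMap H b'"
        by (rule F.cart_cancel[OF e]) (use * Gb Ra[OF g] Y[OF g] in simp_all)
    qed
    show "rel f h a d" if "f \<in> R" "g \<in> R" "h \<in> R" "rel f g a b" "rel g h b d" for f g h a b d
      by (rule R.rel_trans[OF that])
  qed (auto intro: R.rel_refl R.rel_precomp)
  obtain Z0 c where Z0: "OMap G Z0 = OMap F X" and "glued_by E G R (AMap F) Y rel Z0 c"
    using GR.objects_glue_indexed[OF G _ FR] X by auto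
  then have Z0_obj: "Z0 \<in> Obj E"
    and c: "\<And>f. f \<in> R \<Longrightarrow> c f \<in> Arr E" "\<And>f. f \<in> R \<Longrightarrow> Dom E (c f) = Y f" "\<And>f. f \<in> R \<Longrightarrow> Cod E (c f) = Z0"
      "\<And>f. f \<in> R \<Longrightarrow> AMap G (c f) = AMap F f"
    and c_eq: "\<And>f g a b. f \<in> R \<Longrightarrow> g \<in> R \<Longrightarrow> rel f g a b \<Longrightarrow> c f \<cdot>\<^bsub>E\<^esub> a = c g \<cdot>\<^bsub>E\<^esub> b"
    unfolding glued_by_def by blast+
  \<comment> \<open>The object \<open>Z0\<close> was glued over \<open>C\<close> only, so
    \<open>OMap H Z0\<close> lies over the same object as \<open>X\<close> but need not be
    \<open>X\<close>. The glued arrow \<open>w\<close> over an identity compares the two, and its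
    lift corrects \<open>Z0\<close> to an object exactly over \<open>X\<close>.\<close>
  have "\<exists>!w. w \<in> Arr D \<and> Dom D w = X \<and> Cod D w = OMap H Z0 \<and> AMap F w = Ident C (OMap F X) \<and>
    (\<forall>f \<in> R. w \<cdot>\<^bsub>D\<^esub> f = AMap H (c f))"
  proof (rule arrows_glueD[OF F X _ R])
    show "AMap H (c f) \<in> Arr D \<and> Dom D (AMap H (c f)) = Dom D f \<and> Cod D (AMap H (c f)) = OMap H Z0 \<and>
      AMap F (AMap H (c f)) = Ident C (OMap F X) \<cdot>\<^bsub>C\<^esub> AMap F f" if "f \<in> R" for f
      using c[OF that] Ra[OF that] Y[OF that] by simp
    show "AMap H (c f) \<cdot>\<^bsub>D\<^esub> s = AMap H (c g) \<cdot>\<^bsub>D\<^esub> t"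
      if f: "f \<in> R" and g: "g \<in> R" and s: "s \<in> Arr D" "Cod D s = Dom D f" and t: "t \<in> Arr D" "Cod D t = Dom D g"
        and st: "Dom D s = Dom D t" and eq: "f \<cdot>\<^bsub>D\<^esub> s = g \<cdot>\<^bsub>D\<^esub> t" for f g s t
    proof -
      obtain a where a: "a \<in> Arr E" "Cod E a = Y f" "AMap H a = s"
        by (rule H.lift_ex[of s "Y f"]) (use s Y[OF f] in auto)
      have "OMap H (Dom E a) = Dom D t"
        using H_simps(3)[OF a(1)] a(3) st by simp
      then obtain b where b: "rel f g a b" "AMap H b = t"
        using R.rel_ex[OF f g a(1,2), of t] t eq a(3) by auto
      have "AMap H (c f \<cdot>\<^bsub>E\<^esub> a) = AMap H (c g \<cdot>\<^bsub>E\<^esub> b)"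
        using c_eq[OF f g b(1)] by simp
      then show ?thesis
        using R.rel_arr[OF f g b(1)] c[OF f] c[OF g] a(3) b(2) by simp
    qed
  qed (use Z0_obj Z0 X in auto)
  then obtain w where w: "w \<in> Arr D" "Dom D w = X" "Cod D w = OMap H Z0"
    and wc: "\<And>f. f \<in> R \<Longrightarrow> w \<cdot>\<^bsub>D\<^esub> f = AMap H (c f)"
    by blast
  obtain w' where w': "w' \<in> Arr E" "Cod E w' = Z0" "AMap H w' = w"
    by (rule H.lift_ex[of w Z0]) (use w Z0_obj in auto)
  define Z where "Z = Dom E w'"
  have Z: "Z \<in> Obj E" "OMap H Z = X"
    using w' w H_simps(3)[OF w'(1)] by (auto simp: Z_def)
  have "\<exists>d. \<forall>f \<in> R. d f \<in> Arr E \<and> Dom E (d f) = Y f \<and> Cod E (d f) = Z \<and> w' \<cdot>\<^bsub>E\<^esub> d f = c f \<and> AMap H (d f) = f"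
    (is "\<exists>d. \<forall>f \<in> R. ?d f (d f)")
  proof (rule bchoice, intro ballI)
    fix f assume f: "f \<in> R"
    show "\<exists>d. ?d f d"
      by (rule H.cart_ex[of "c f" w' f]) (use c[OF f] w' wc[OF f] Ra[OF f] Y[OF f] Z in \<open>auto simp: Z_def\<close>)
  qed
  then obtain d where d: "\<And>f. f \<in> R \<Longrightarrow> d f \<in> Arr E" "\<And>f. f \<in> R \<Longrightarrow> Dom E (d f) = Y f" "\<And>f. f \<in> R \<Longrightarrow> Cod E (d f) = Z"
    "\<And>f. f \<in> R \<Longrightarrow> w' \<cdot>\<^bsub>E\<^esub> d f = c f" "\<And>f. f \<in> R \<Longrightarrow> AMap H (d f) = f"
    by blast
  have "d f \<cdot>\<^bsub>E\<^esub> a = d g \<cdot>\<^bsub>E\<^esub> b" if f: "f \<in> R" and g: "g \<in> R" and ab: "rel f g a b" for f g a b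
  proof -
    note ar = R.rel_arr[OF f g ab]
    have e: "w' \<cdot>\<^bsub>E\<^esub> (d f \<cdot>\<^bsub>E\<^esub> a) = w' \<cdot>\<^bsub>E\<^esub> (d g \<cdot>\<^bsub>E\<^esub> b)"
      using E.comp_eq_precomp1[OF d(4)[OF f], of a] E.comp_eq_precomp1[OF d(4)[OF g], of b]
        c_eq[OF f g ab] ar d(1-3)[OF f] d(1-3)[OF g] w' by (simp add: Z_def)
    show ?thesis
      by (rule H.cart_cancel[OF e]) (use ar d[OF f] d[OF g] w' in \<open>simp_all add: Z_def\<close>)
  qed
  then have "glued_by E H R (\<lambda>f. f) Y rel Z d"
    using Z d unfolding glued_by_def by blast
  with Z show "\<exists>Z c. OMap H Z = X \<and> glued_by E H R (\<lambda>f. f) Y rel Z c"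
    by blast
qed

lemma stack_comp:
  assumes "pretopology C J" "stack D C J F" "stack E D (induced_topology D F J) H"
  shows "stack E C J G"
  using assms arrows_glue_comp objects_glue_comp
  unfolding stack_iff[OF F.fibration_axioms assms(1)] stack_iff[OF G.fibration_axioms assms(1)]
    stack_iff[OF H.fibration_axioms pretopology_induced[OF F.fibration_axioms assms(1)]]
  by blast

lemma stack_upper:
  assumes "pretopology C J" "prestack D C J F" "stack E C J G"
  shows "stack E D (induced_topology D F J) H"
  using assms F.prestack_arrows_glue[OF assms(2)] arrows_glue_upper objects_glue_upper
  unfolding stack_iff[OF G.fibration_axioms assms(1)]
    stack_iff[OF H.fibration_axioms pretopology_induced[OF F.fibration_axioms assms(1)]]
  by blast

end

section \<open>The iso-comma category\<close>

locale fibered_over_base = triangle D C F E H G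
  for D :: "('p, 'n) cat" and C :: "('o, 'm) cat" and F :: "('p, 'n, 'o, 'm) fctr"
    and E :: "('q, 'k) cat" and H :: "('q, 'k, 'p, 'n) fctr" and G :: "('q, 'k, 'o, 'm) fctr" +
  assumes G_fibered: "fibered E C G"
begin

sublocale G: fibration E C G
  by standard (rule G_fibered)

definition comma_obj :: "('q \<times> 'n) set" where
  "comma_obj = {(e, u). e \<in> Obj E \<and> u \<in> Arr D \<and> Cod D u = OMap H e \<and> AMap F u = Ident C (OMap G e)}"

text \<open>Only the component in \<open>E\<close> of an arrow is recorded, together with source and
  target, since cartesianness determines the component in \<open>D\<close>. This makes the
  projection to \<open>E\<close> fully faithful by construction.\<close>

definition comma :: "('q \<times> 'n, ('q \<times> 'n) \<times> 'k \<times> ('q \<times> 'n)) cat" where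
  "comma = \<lparr>
     Obj = comma_obj,
     Arr = {(S, k, T). S \<in> comma_obj \<and> T \<in> comma_obj \<and> k \<in> Arr E \<and> Dom E k = fst S \<and> Cod E k = fst T},
     Dom = \<lambda>(S, k, T). S,
     Cod = \<lambda>(S, k, T). T,
     Ident = \<lambda>S. (S, Ident E (fst S), S),
     Comp = \<lambda>(S', k', T') (S, k, T). (S, k' \<cdot>\<^bsub>E\<^esub> k, T')\<rparr>"

definition comma_proj :: "('q \<times> 'n, ('q \<times> 'n) \<times> 'k \<times> ('q \<times> 'n), 'q, 'k) fctr" where
  "comma_proj = \<lparr>OMap = fst, AMap = \<lambda>(S, k, T). k\<rparr>"

text \<open>This becomes the functor \<open>P\<close>. It reads off the source of the arrow in the
  pair rather than \<open>H e\<close>; that source can vary while \<open>e\<close> stays, which is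
  where the strict lifts come from.\<close>

definition comma_base :: "('q \<times> 'n, ('q \<times> 'n) \<times> 'k \<times> ('q \<times> 'n), 'p, 'n) fctr" where
  "comma_base = \<lparr>OMap = \<lambda>S. Dom D (snd S),
     AMap = \<lambda>(S, k, T). cart_fact D F (snd T) (AMap G k) (AMap H k \<cdot>\<^bsub>D\<^esub> snd S)\<rparr>"

definition comma_incl :: "('q, 'k, 'q \<times> 'n, ('q \<times> 'n) \<times> 'k \<times> ('q \<times> 'n)) fctr" where
  "comma_incl = \<lparr>OMap = \<lambda>e. (e, Ident D (OMap H e)),
     AMap = \<lambda>k. ((Dom E k, Ident D (OMap H (Dom E k))), k, (Cod E k, Ident D (OMap H (Cod E k))))\<rparr>"

lemma comma_simps [simp]:
  "Obj comma = comma_obj"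
  "Dom comma (S, k, T) = S"
  "Cod comma (S, k, T) = T"
  "Ident comma S = (S, Ident E (fst S), S)"
  "(S', k', T') \<cdot>\<^bsub>comma\<^esub> (S, k, T) = (S, k' \<cdot>\<^bsub>E\<^esub> k, T')"
  by (auto simp: comma_def)

lemma comma_Arr [simp]:
  "(S, k, T) \<in> Arr comma \<longleftrightarrow> S \<in> comma_obj \<and> T \<in> comma_obj \<and> k \<in> Arr E \<and> Dom E k = fst S \<and> Cod E k = fst T"
  by (auto simp: comma_def)

lemma comma_hom:
  "(S, k, T) \<in> hom comma X Y \<longleftrightarrow> S = X \<and> T = Y \<and> X \<in> comma_obj \<and> Y \<in> comma_obj \<and>
     k \<in> Arr E \<and> Dom E k = fst X \<and> Cod E k = fst Y"
  by (auto simp: hom_def)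

lemma comma_objD [simp]:
  assumes "S \<in> comma_obj"
  shows "fst S \<in> Obj E" "snd S \<in> Arr D" "Cod D (snd S) = OMap H (fst S)"
    "AMap F (snd S) = Ident C (OMap G (fst S))" "OMap F (Dom D (snd S)) = OMap G (fst S)"
proof -
  show *: "fst S \<in> Obj E" "snd S \<in> Arr D" "Cod D (snd S) = OMap H (fst S)"
    "AMap F (snd S) = Ident C (OMap G (fst S))"
    using assms by (auto simp: comma_obj_def)
  show "OMap F (Dom D (snd S)) = OMap G (fst S)"
    using F.F_simps(3)[OF *(2)] * by simp
qed

lemma comma_objI: "e \<in> Obj E \<Longrightarrow> u \<in> Arr D \<Longrightarrow> Cod D u = OMap H e \<Longrightarrow> AMap F u = Ident C (OMap G e) \<Longrightarrow> (e, u) \<in> comma_obj"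
  by (simp add: comma_obj_def)

lemma category_comma: "category comma"
proof
  show "f \<in> Arr comma \<Longrightarrow> Dom comma f \<in> Obj comma" for f
    by (cases f) simp
  show "f \<in> Arr comma \<Longrightarrow> Cod comma f \<in> Obj comma" for f
    by (cases f) simp
  show "Ident comma S \<in> hom comma S S" if "S \<in> Obj comma" for S
    using that by (simp add: comma_hom)
  show "g \<cdot>\<^bsub>comma\<^esub> f \<in> hom comma S U" if "f \<in> hom comma S T" "g \<in> hom comma T U" for f g S T U
    using that by (cases f; cases g) (simp add: comma_hom)
  show "f \<cdot>\<^bsub>comma\<^esub> Ident comma S = f" if "f \<in> hom comma S T" for f S T
    using that by (cases f) (simp add: comma_hom)
  show "Ident comma T \<cdot>\<^bsub>comma\<^esub> f = f" if "f \<in> hom comma S T" for f S T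
    using that by (cases f) (simp add: comma_hom)
  show "h \<cdot>\<^bsub>comma\<^esub> g \<cdot>\<^bsub>comma\<^esub> f = h \<cdot>\<^bsub>comma\<^esub> (g \<cdot>\<^bsub>comma\<^esub> f)"
    if "f \<in> hom comma S T" "g \<in> hom comma T U" "h \<in> hom comma U V" for f g h S T U V
    using that by (cases f; cases g; cases h) (simp add: comma_hom)
qed

sublocale comma: category comma
  by (rule category_comma)

lemma comma_proj_simps [simp]:
  "OMap comma_proj S = fst S"
  "AMap comma_proj (S, k, T) = k"
  by (simp_all add: comma_proj_def)

lemma comma_incl_simps [simp]:
  "OMap comma_incl e = (e, Ident D (OMap H e))"
  "AMap comma_incl k = ((Dom E k, Ident D (OMap H (Dom E k))), k, (Cod E k, Ident D (OMap H (Cod E k))))"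
  by (simp_all add: comma_incl_def)

lemma comma_incl_obj [simp]: "e \<in> Obj E \<Longrightarrow> (e, Ident D (OMap H e)) \<in> comma_obj"
  by (rule comma_objI) simp_all

lemma comma_base_simps [simp]:
  assumes "S \<in> comma_obj" "T \<in> comma_obj" "k \<in> Arr E" "Dom E k = fst S" "Cod E k = fst T"
  shows "AMap comma_base (S, k, T) \<in> Arr D" "Dom D (AMap comma_base (S, k, T)) = Dom D (snd S)"
    "Cod D (AMap comma_base (S, k, T)) = Dom D (snd T)"
    "snd T \<cdot>\<^bsub>D\<^esub> AMap comma_base (S, k, T) = AMap H k \<cdot>\<^bsub>D\<^esub> snd S"
    "AMap F (AMap comma_base (S, k, T)) = AMap G k"
proof -
  have "AMap F (snd T) \<cdot>\<^bsub>C\<^esub> AMap G k = AMap F (AMap H k \<cdot>\<^bsub>D\<^esub> snd S)"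
    using assms by simp
  then show "AMap comma_base (S, k, T) \<in> Arr D" "Dom D (AMap comma_base (S, k, T)) = Dom D (snd S)"
    "Cod D (AMap comma_base (S, k, T)) = Dom D (snd T)"
    "snd T \<cdot>\<^bsub>D\<^esub> AMap comma_base (S, k, T) = AMap H k \<cdot>\<^bsub>D\<^esub> snd S"
    "AMap F (AMap comma_base (S, k, T)) = AMap G k"
    using assms F.cart_fact[of "AMap H k \<cdot>\<^bsub>D\<^esub> snd S" "snd T" "AMap G k"]
    by (simp_all add: comma_base_def)
qed

lemma comma_base_eqI:
  assumes "S \<in> comma_obj" "T \<in> comma_obj" "k \<in> Arr E" "Dom E k = fst S" "Cod E k = fst T"
    "v \<in> Arr D" "Cod D v = Dom D (snd T)" "snd T \<cdot>\<^bsub>D\<^esub> v = AMap H k \<cdot>\<^bsub>D\<^esub> snd S" "AMap F v = AMap G k"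
  shows "AMap comma_base (S, k, T) = v"
  by (rule F.cart_cancel[of "snd T"]) (use assms in simp_all)

lemma comma_base_obj [simp]: "OMap comma_base S = Dom D (snd S)"
  by (simp add: comma_base_def)

lemma is_functor_comma_proj: "is_functor comma E comma_proj"
  unfolding is_functor_def
  by (auto simp: hom_def category_comma E.category_axioms)

lemma is_functor_comma_incl: "is_functor E comma comma_incl"
  unfolding is_functor_def
  by (auto simp: hom_def category_comma E.category_axioms)

text \<open>Each value on an arrow is the unique filler of a square over a fixed base arrow, and
  pasted squares give composites.\<close>

lemma is_functor_comma_base: "is_functor comma D comma_base"
  unfolding is_functor_def
proof (intro conjI ballI impI)
  show "category comma" "category D"
    by (rule category_comma, rule F.D.category_axioms)
  show "OMap comma_base S \<in> Obj D" if "S \<in> Obj comma" for S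
    using that by simp
  show "AMap comma_base f \<in> hom D (OMap comma_base (Dom comma f)) (OMap comma_base (Cod comma f))"
    if "f \<in> Arr comma" for f
    using that by (cases f) (simp add: hom_def)
  show "AMap comma_base (Ident comma S) = Ident D (OMap comma_base S)" if "S \<in> Obj comma" for S
    unfolding comma_simps by (rule comma_base_eqI) (use that in simp_all)
  show "AMap comma_base (g \<cdot>\<^bsub>comma\<^esub> f) = AMap comma_base g \<cdot>\<^bsub>D\<^esub> AMap comma_base f"
    if fa: "f \<in> Arr comma" and ga: "g \<in> Arr comma" and gf: "Dom comma g = Cod comma f" for f g
  proof -
    obtain S k T where f: "f = (S, k, T)"
      by (cases f)
    obtain l U where g: "g = (T, l, U)"
      using gf f by (cases g) simp
    have o: "S \<in> comma_obj" "T \<in> comma_obj" "U \<in> comma_obj" "k \<in> Arr E" "l \<in> Arr E" "Dom E k = fst S"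
      "Cod E k = fst T" "Dom E l = fst T" "Cod E l = fst U"
      using fa ga by (simp_all add: f g)
    define p where "p = AMap comma_base f"
    define q where "q = AMap comma_base g"
    have p: "p \<in> Arr D" "Dom D p = Dom D (snd S)" "Cod D p = Dom D (snd T)" "snd T \<cdot>\<^bsub>D\<^esub> p = AMap H k \<cdot>\<^bsub>D\<^esub> snd S"
      "AMap F p = AMap G k"
      using o by (simp_all add: p_def f)
    have q: "q \<in> Arr D" "Dom D q = Dom D (snd T)" "Cod D q = Dom D (snd U)" "snd U \<cdot>\<^bsub>D\<^esub> q = AMap H l \<cdot>\<^bsub>D\<^esub> snd T"
      "AMap F q = AMap G l"
      using o by (simp_all add: q_def g)
    have "AMap comma_base (S, l \<cdot>\<^bsub>E\<^esub> k, U) = q \<cdot>\<^bsub>D\<^esub> p"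
    proof (rule comma_base_eqI)
      show "snd U \<cdot>\<^bsub>D\<^esub> (q \<cdot>\<^bsub>D\<^esub> p) = AMap H (l \<cdot>\<^bsub>E\<^esub> k) \<cdot>\<^bsub>D\<^esub> snd S"
        using F.D.comp_eq_precomp[OF q(4), of p] p q(1-3) o by simp
    qed (use o p q in simp_all)
    then show ?thesis
      by (simp add: f g p_def q_def)
  qed
qed

section \<open>The projections of the replacement to \<open>E\<close> and to
  \<open>D\<close>\<close>

lemma comma_proj_fibered: "fibered comma E comma_proj"
  unfolding fibered_def
proof (intro conjI ballI impI)
  show "is_functor comma E comma_proj"
    by (rule is_functor_comma_proj)
  show "\<exists>g \<in> Arr comma. Cod comma g = T \<and> AMap comma_proj g = f"
    if "f \<in> Arr E" "T \<in> Obj comma" "OMap comma_proj T = Cod E f" for f T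
    using that by (intro bexI[of _ "((Dom E f, Ident D (OMap H (Dom E f))), f, T)"]) simp_all
  show "\<exists>!g. g \<in> hom comma (Dom comma a) (Dom comma b) \<and> b \<cdot>\<^bsub>comma\<^esub> g = a \<and> AMap comma_proj g = f"
    if a: "a \<in> Arr comma" and b: "b \<in> Arr comma" and ab: "Cod comma a = Cod comma b"
      and f: "f \<in> hom E (OMap comma_proj (Dom comma a)) (OMap comma_proj (Dom comma b))"
      and eq: "AMap comma_proj b \<cdot>\<^bsub>E\<^esub> f = AMap comma_proj a" for a b f
  proof -
    obtain S k T where a': "a = (S, k, T)"
      by (cases a)
    obtain S' k' where b': "b = (S', k', T)"
      using ab a' by (cases b) simp
    show ?thesis
    proof (rule ex1I[of _ "(S, f, S')"])
      show "(S, f, S') \<in> hom comma (Dom comma a) (Dom comma b) \<and> b \<cdot>\<^bsub>comma\<^esub> (S, f, S') = a \<and> AMap comma_proj (S, f, S') = f"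
        using a b f eq by (simp add: a' b' comma_hom hom_def)
      show "g = (S, f, S')"
        if "g \<in> hom comma (Dom comma a) (Dom comma b) \<and> b \<cdot>\<^bsub>comma\<^esub> g = a \<and> AMap comma_proj g = f" for g
        using that by (cases g) (simp add: a' b' comma_hom)
    qed
  qed
qed

text \<open>The projection is fully faithful and surjective on objects, so gluing in \<open>comma\<close> is gluing in \<open>E\<close>.\<close>

lemma comma_proj_arrows_glue: "arrows_glue comma E J comma_proj"
  unfolding arrows_glue_def
proof (intro ballI allI impI)
  fix S T R h u
  assume S: "S \<in> Obj comma" and T: "T \<in> Obj comma" and R: "R \<in> induced_topology comma comma_proj J S"
    and h: "h \<in> Arr E" "Dom E h = OMap comma_proj S" "Cod E h = OMap comma_proj T"
    and u: "\<forall>a \<in> R. u a \<in> Arr comma \<and> Dom comma (u a) = Dom comma a \<and> Cod comma (u a) = T \<and>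
       AMap comma_proj (u a) = h \<cdot>\<^bsub>E\<^esub> AMap comma_proj a"
  show "\<exists>!w. w \<in> Arr comma \<and> Dom comma w = S \<and> Cod comma w = T \<and> AMap comma_proj w = h \<and>
      (\<forall>a \<in> R. w \<cdot>\<^bsub>comma\<^esub> a = u a)"
  proof (rule ex1I[of _ "(S, h, T)"])
    have "(S, h, T) \<cdot>\<^bsub>comma\<^esub> a = u a" if a: "a \<in> R" for a
    proof -
      obtain U k where a': "a = (U, k, S)"
        using R a by (cases a) (auto simp: induced_topology_def)
      obtain U' l T' where "u a = (U', l, T')"
        by (cases "u a")
      then show ?thesis
        using u a by (auto simp: a')
    qed
    then show "(S, h, T) \<in> Arr comma \<and> Dom comma (S, h, T) = S \<and> Cod comma (S, h, T) = T \<and>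
        AMap comma_proj (S, h, T) = h \<and> (\<forall>a \<in> R. (S, h, T) \<cdot>\<^bsub>comma\<^esub> a = u a)"
      using S T h by simp
    show "w = (S, h, T)" if "w \<in> Arr comma \<and> Dom comma w = S \<and> Cod comma w = T \<and> AMap comma_proj w = h \<and>
        (\<forall>a \<in> R. w \<cdot>\<^bsub>comma\<^esub> a = u a)" for w
      using that by (cases w) simp
  qed
qed

lemma comma_proj_objects_glue:
  assumes "pretopology E J"
  shows "objects_glue comma E J comma_proj"
  unfolding objects_glue_def
proof (intro ballI allI impI)
  interpret J: pretopology E J by fact
  fix X R Y rel
  assume X: "X \<in> Obj E" "R \<in> J X" and "descent_relation comma E comma_proj R (\<lambda>f. f) Y rel"
  then interpret R: descent_relation comma E comma_proj R "\<lambda>f. f" Y rel by simp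
  define Z where "Z = (X, Ident D (OMap H X))"
  have "glued_by comma comma_proj R (\<lambda>f. f) Y rel Z (\<lambda>f. (Y f, f, Z))"
    unfolding glued_by_def
  proof (intro conjI ballI allI impI)
    fix f g a b assume f: "f \<in> R" and g: "g \<in> R" and ab: "rel f g a b"
    show "(Y f, f, Z) \<cdot>\<^bsub>comma\<^esub> a = (Y g, g, Z) \<cdot>\<^bsub>comma\<^esub> b"
      using R.rel_arr[OF f g ab] by (cases a; cases b) simp
  qed (use X J.cover_arr[OF X] R.Y_obj in \<open>auto simp: Z_def\<close>)
  moreover have "OMap comma_proj Z = X"
    by (simp add: Z_def)
  ultimately show "\<exists>Z c. OMap comma_proj Z = X \<and> glued_by comma comma_proj R (\<lambda>f. f) Y rel Z c"
    by blast
qed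

lemma comma_proj_triangle: "fibered_triangle E C G comma comma_proj (G \<odot> comma_proj)"
proof
  show "is_functor comma C (G \<odot> comma_proj)"
    unfolding is_functor_def
    by (auto simp: hom_def category_comma F.C.category_axioms comp_functor_def)
  show "functor_eq comma (G \<odot> comma_proj) (G \<odot> comma_proj)"
    by (simp add: functor_eq_def)
qed (rule is_functor_comma_proj comma_proj_fibered)+

text \<open>No separate invariance of stacks under equivalence is proved: the projection is itself a
  stack over \<open>E\<close> for the induced topology, so composition of stacks with
  \<open>G\<close> applies.\<close>

lemma comma_stack:
  assumes "pretopology C J" "stack E C J G"
  shows "stack comma C J (G \<odot> comma_proj)"
proof -
  interpret Q: fibered_triangle E C G comma comma_proj "G \<odot> comma_proj"
    by (rule comma_proj_triangle)
  have J: "pretopology E (induced_topology E G J)"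
    by (rule pretopology_induced) (rule G.fibration_axioms, fact)
  show ?thesis
  proof (rule Q.stack_comp[OF assms])
    show "stack comma E (induced_topology E G J) comma_proj"
      unfolding stack_iff[OF Q.H.fibration_axioms J]
      using comma_proj_arrows_glue comma_proj_objects_glue[OF J] by blast
  qed
qed

text \<open>Strict lifts along \<open>comma_base\<close> are built from lifts for \<open>G\<close>.
  For \<open>v\<close> into the source of \<open>snd T\<close>, let \<open>k\<close> lift
  \<open>AMap F v\<close> for \<open>G\<close>; factoring \<open>snd T \<cdot> v\<close> through
  \<open>AMap H k\<close> gives the arrow \<open>u\<close> of the new pair, chosen so that the
  square with top \<open>v\<close> commutes.\<close>

lemma comma_base_triangle: "fibered_triangle D C F comma comma_base (G \<odot> comma_proj)"
proof -
  interpret Q: fibered_triangle E C G comma comma_proj "G \<odot> comma_proj"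
    by (rule comma_proj_triangle)
  interpret P: triangle D C F comma comma_base "G \<odot> comma_proj"
  proof
    show "functor_eq comma (F \<odot> comma_base) (G \<odot> comma_proj)"
      unfolding functor_eq_def
    proof (intro conjI ballI)
      show "OMap (F \<odot> comma_base) S = OMap (G \<odot> comma_proj) S" if "S \<in> Obj comma" for S
        using that by (simp add: comp_functor_def)
      show "AMap (F \<odot> comma_base) f = AMap (G \<odot> comma_proj) f" if "f \<in> Arr comma" for f
        using that by (cases f) (simp add: comp_functor_def)
    qed
  qed (rule is_functor_comma_base Q.G_functor)+
  have "fibered comma D comma_base"
  proof (rule P.fibered_upper)
    show "fibered comma C (G \<odot> comma_proj)"
      by (rule Q.G.fibered)
    fix v T assume v: "v \<in> Arr D" and T: "T \<in> Obj comma" "OMap comma_base T = Cod D v"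
    have T: "T \<in> comma_obj" "Dom D (snd T) = Cod D v"
      using T by simp_all
    have "OMap G (fst T) = Cod C (AMap F v)"
      using v comma_objD(5)[OF T(1)] T(2) by simp
    then obtain k where k: "k \<in> Arr E" "Cod E k = fst T" "AMap G k = AMap F v"
      using G.lift_ex[of "AMap F v" "fst T"] v T by auto
    have Fd: "OMap G (Dom E k) = OMap F (Dom D v)" "OMap F (Cod D v) = OMap G (fst T)"
      using G_simps(3)[OF k(1)] k(3) v comma_objD(5)[OF T(1)] T(2) by simp_all
    obtain u where u: "u \<in> Arr D" "Dom D u = Dom D v" "Cod D u = OMap H (Dom E k)"
      "AMap H k \<cdot>\<^bsub>D\<^esub> u = snd T \<cdot>\<^bsub>D\<^esub> v" "AMap F u = Ident C (OMap G (Dom E k))"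
      by (rule F.cart_ex[of "snd T \<cdot>\<^bsub>D\<^esub> v" "AMap H k" "Ident C (OMap G (Dom E k))"])
        (use v T k Fd in auto)
    let ?S = "(Dom E k, u)"
    have S: "?S \<in> comma_obj"
      by (rule comma_objI) (use k u in simp_all)
    have "AMap comma_base (?S, k, T) = v"
      by (rule comma_base_eqI) (use S T k u v in simp_all)
    then show "\<exists>f \<in> Arr comma. Cod comma f = T \<and> AMap comma_base f = v"
      using S T k by (intro bexI[of _ "(?S, k, T)"]) simp_all
  qed
  then show ?thesis
    by unfold_locales
qed

lemma comma_incl_equivalence:
  "fibered_equivalence C E G comma (G \<odot> comma_proj) comma_incl"
  unfolding fibered_equivalence_def
proof (intro conjI exI)
  show "fibered_map E G comma (G \<odot> comma_proj) comma_incl"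
    unfolding fibered_map_def functor_eq_def
    by (auto simp: is_functor_comma_incl comp_functor_def)
  show "fibered_map comma (G \<odot> comma_proj) E G comma_proj"
    unfolding fibered_map_def functor_eq_def
    by (auto simp: is_functor_comma_proj)
  show "two_isomorphic C E G E G (comma_proj \<odot> comma_incl) id_functor"
    unfolding two_isomorphic_def
    by (rule exI[of _ "Ident E"]) (auto simp: E.ident_iso comp_functor_def id_functor_def)
  show "two_isomorphic C comma (G \<odot> comma_proj) comma (G \<odot> comma_proj) (comma_incl \<odot> comma_proj) id_functor"
    unfolding two_isomorphic_def
  proof (intro exI conjI ballI)
    \<comment> \<open>The comparison is an identity in \<open>E\<close>; in \<open>D\<close> it is
      the arrow stored in \<open>S\<close>, traversed backwards.\<close>
    let ?\<eta> = "\<lambda>S. (OMap comma_incl (fst S), Ident E (fst S), S)"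
    show "?\<eta> S \<in> isos comma (OMap (comma_incl \<odot> comma_proj) S) (OMap id_functor S)" if "S \<in> Obj comma" for S
      unfolding isos_def mem_Collect_eq
    proof (intro conjI bexI)
      show "?\<eta> S \<in> hom comma (OMap (comma_incl \<odot> comma_proj) S) (OMap id_functor S)"
        using that by (simp add: comma_hom comp_functor_def id_functor_def)
      show "(S, Ident E (fst S), OMap comma_incl (fst S)) \<in> hom comma (OMap id_functor S) (OMap (comma_incl \<odot> comma_proj) S)"
        using that by (simp add: comma_hom comp_functor_def id_functor_def)
    qed (use that in \<open>simp_all add: comp_functor_def id_functor_def\<close>)
    show "AMap (G \<odot> comma_proj) (?\<eta> S) = Ident C (OMap (G \<odot> comma_proj) S)" if "S \<in> Obj comma" for S
      using that by (simp add: comp_functor_def)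
    show "?\<eta> (Cod comma f) \<cdot>\<^bsub>comma\<^esub> AMap (comma_incl \<odot> comma_proj) f = AMap id_functor f \<cdot>\<^bsub>comma\<^esub> ?\<eta> (Dom comma f)"
      if "f \<in> Arr comma" for f
      using that by (cases f) (simp add: comp_functor_def id_functor_def)
  qed
qed

lemma comma_base_incl: "functor_eq E (comma_base \<odot> comma_incl) H"
  unfolding functor_eq_def
proof (intro conjI ballI)
  show "OMap (comma_base \<odot> comma_incl) e = OMap H e" if "e \<in> Obj E" for e
    using that by (simp add: comp_functor_def)
  show "AMap (comma_base \<odot> comma_incl) k = AMap H k" if "k \<in> Arr E" for k
    unfolding comp_functor_def using that by (auto intro: comma_base_eqI)
qed

end

section \<open>Discrete fibers and the three statements\<close>

text \<open>A lift \<open>k\<close> of \<open>AMap F v\<close> for \<open>G\<close> has an image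
  that differs from \<open>v\<close> only by an arrow \<open>u\<close> over an identity.
  Discreteness turns \<open>u\<close> into an identity, so \<open>k\<close> is already a strict lift
  of \<open>v\<close>.\<close>

lemma (in triangle) discretely_fibered_upper:
  assumes "discretely_fibered D C F" "fibered E C G"
  shows "fibered E D H"
proof (rule fibered_upper[OF assms(2)])
  interpret G: fibration E C G
    by standard fact
  fix v Y assume v: "v \<in> Arr D" and Y: "Y \<in> Obj E" "OMap H Y = Cod D v"
  have GY: "OMap G Y = OMap F (Cod D v)"
    using FH_simps(1)[OF Y(1)] Y(2) by simp
  obtain k where k: "k \<in> Arr E" "Cod E k = Y" "AMap G k = AMap F v"
    by (rule G.lift_ex[of "AMap F v" Y]) (use v Y GY in auto)
  have Gk: "OMap G (Dom E k) = OMap F (Dom D v)"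
    using G_simps(3)[OF k(1)] k(3) v by simp
  let ?i = "Ident C (OMap F (Dom D v))"
  obtain u where u: "u \<in> Arr D" "Dom D u = Dom D v" "Cod D u = OMap H (Dom E k)"
    "AMap H k \<cdot>\<^bsub>D\<^esub> u = v" "AMap F u = ?i"
    by (rule F.cart_ex[of v "AMap H k" ?i]) (use v Y k Gk in auto)
  have "u \<in> Arr (fiber D C F (OMap F (Dom D v)))"
    using u k Gk by (simp add: fiber_def)
  moreover have "OMap F (Dom D v) \<in> Obj C"
    using v by simp
  ultimately obtain Z where "Z \<in> Obj (fiber D C F (OMap F (Dom D v)))" "u = Ident D Z"
    using assms(1) unfolding discretely_fibered_def by blast
  then have "Z \<in> Obj D" "u = Ident D Z"
    by (simp_all add: fiber_def)
  then have "AMap H k = v"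
    using u k by simp
  with k show "\<exists>k \<in> Arr E. Cod E k = Y \<and> AMap H k = v"
    by blast
qed

theorem theorem82:
  fixes C :: "('oc, 'mc) cat" and D :: "('od, 'md) cat" and E :: "('oe, 'me) cat"
    and F :: "('od, 'md, 'oc, 'mc) fctr"
    and G :: "('oe, 'me, 'oc, 'mc) fctr"
    and A :: "('oe, 'me, 'od, 'md) fctr"
    and J :: "'oc \<Rightarrow> 'mc set set"
  assumes "category C" and "category D" and "category E"
    and "is_functor D C F" and "is_functor E C G" and "is_functor E D A"
    and "functor_eq E (F \<odot> A) G"
    and "grothendieck_topology C J"
  shows
    "(stack D C J F \<and> stack E D (induced_topology D F J) A \<longrightarrow> stack E C J G) \<and>
     (stack E C J G \<and> prestack D C J F \<longrightarrow>
        (\<exists>(E' :: ('oe \<times> 'md, ('oe \<times> 'md) \<times> 'me \<times> ('oe \<times> 'md)) cat) G' I P.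
           stack E' C J G' \<and>
           fibered_equivalence C E G E' G' I \<and>
           fibered_map E' G' D F P \<and>
           functor_eq E (P \<odot> I) A \<and>
           stack E' D (induced_topology D F J) P)) \<and>
     (stack E C J G \<and> discretely_fibered D C F \<and> stack D C J F \<longrightarrow>
        stack E D (induced_topology D F J) A)"
proof (intro conjI impI)
  have J: "pretopology C J"
    by (rule grothendieck_pretopology) fact+
  have triangle: "triangle D C F E A G" if "prestack D C J F"
  proof
    show "fibered D C F"
      using that by (simp add: prestack_def)
  qed fact+
  show "stack E C J G" if "stack D C J F \<and> stack E D (induced_topology D F J) A"
  proof -
    interpret triangle D C F E A G
      by (rule triangle) (use that in \<open>simp add: stack_def\<close>)
    interpret fibered_triangle D C F E A G
      by standard (use that in \<open>simp add: stack_def prestack_def\<close>)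
    show ?thesis
      by (rule stack_comp[OF J]) (use that in auto)
  qed
  show "\<exists>(E' :: ('oe \<times> 'md, ('oe \<times> 'md) \<times> 'me \<times> ('oe \<times> 'md)) cat) G' I P.
           stack E' C J G' \<and>
           fibered_equivalence C E G E' G' I \<and>
           fibered_map E' G' D F P \<and>
           functor_eq E (P \<odot> I) A \<and>
           stack E' D (induced_topology D F J) P"
    if st: "stack E C J G \<and> prestack D C J F"
  proof -
    interpret triangle D C F E A G
      by (rule triangle) (use st in simp)
    interpret fibered_over_base D C F E A G
      by standard (use st in \<open>simp add: stack_def prestack_def\<close>)
    interpret P: fibered_triangle D C F comma comma_base "G \<odot> comma_proj"
      by (rule comma_base_triangle)
    \<comment> \<open>From here on the replacement is in the position of \<open>E\<close> in the
      discrete case: a stack over \<open>C\<close> whose functor to \<open>D\<close> is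
      fibered.\<close>
    have stack: "stack comma C J (G \<odot> comma_proj)"
      by (rule comma_stack[OF J]) (use st in simp)
    show ?thesis
    proof (intro exI conjI)
      show "fibered_map comma (G \<odot> comma_proj) D F comma_base"
        unfolding fibered_map_def using is_functor_comma_base P.FH by blast
      show "stack comma D (induced_topology D F J) comma_base"
        by (rule P.stack_upper[OF J _ stack]) (use st in simp)
    qed (rule stack comma_incl_equivalence comma_base_incl)+
  qed
  show "stack E D (induced_topology D F J) A"
    if st: "stack E C J G \<and> discretely_fibered D C F \<and> stack D C J F"
  proof -
    interpret triangle D C F E A G
      by (rule triangle) (use st in \<open>simp add: stack_def\<close>)
    interpret fibered_triangle D C F E A G
      by standard (rule discretely_fibered_upper, use st in \<open>simp_all add: stack_def prestack_def\<close>)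
    show ?thesis
      by (rule stack_upper[OF J]) (use st in \<open>auto simp: stack_def\<close>)
  qed
qed

end
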